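(* Let $d\ge1$ and fix an index $1\le j\le d$. (Continuum case.) Let $V\in C^1(\mathbb{R}^d)\cap L^\infty(\mathbb{R}^d)$ be real-valued with $\nabla V\in L^\infty(\mathbb{R}^d)$, and let $H=H_0+V$ on $L^2(\mathbb{R}^d)$ with $H_0=-\Delta$. Suppose that $\psi\in D(Q_j)\cap H^1(\mathbb{R}^d)$ satisfies $$\int_0^\infty(1+t)\,\|Ve^{-itH_0}\psi\|_{S_j(\mathbb{R}^d)}\,dt<\infty\quad\text{and}\quad\int_0^\infty(1+t)\,\|Ve^{-itH_0}P_j\psi\|_{L^2(\mathbb{R}^d)}\,dt<\infty .$$ Then $\Omega\psi$ and $\Omega P_j\psi$ exist and $$\lim_{t\to\infty}\frac{(Q_j)_H(t)}{t}\Omega\psi=2\,\Omega P_j\psi .$$ In particular, if $\psi\neq0$, then $\Omega\psi$ exhibits ballistic transport in the $Q_j$-direction. (Discrete case.) Let $V\in\ell^\infty(\mathbb{Z}^d)$ be real-valued and let $H=H_0+V$ on $\ell^2(\mathbb{Z}^d)$, with $H_0$ the discrete Laplacian. Suppose that $\psi\in D(Q_j)$ satisfies $$\int_0^\infty(1+t)\,\|Ve^{-itH_0}\psi\|_{S_j(\mathbb{Z}^d)}\,dt<\infty\quad\text{and}\quad\int_0^\infty(1+t)\,\|Ve^{-itH_0}P_j\psi\|_{\ell^2(\mathbb{Z}^d)}\,dt<\infty .$$ Then $\Omega\psi$ exists and $$\lim_{t\to\infty}\frac{(Q_j)_H(t)}{t}\Omega\psi=\Omega P_j\psi .$$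
   Context: $Q_j$ is multiplication by the $j$th coordinate, with maximal domain $D(Q_j)$, on $L^2(\mathbb{R}^d)$ or $\ell^2(\mathbb{Z}^d)$. On $\mathbb{Z}^d$, $(H_0\psi)(n)=\sum_{l=1}^d(\psi(n+e_l)+\psi(n-e_l))$. The momentum operators are $P_j=-i\partial_{x_j}$ on $\mathbb{R}^d$ and $(P_j\psi)(n)=i(\psi(n+e_j)-\psi(n-e_j))$ on $\mathbb{Z}^d$. For an operator $A$, $A_H(t)=e^{itH}Ae^{-itH}$. Put $\Omega(t)=e^{itH}e^{-itH_0}$; $\Omega\psi$ is said to exist if $\Omega\psi:=\lim_{t\to\infty}\Omega(t)\psi$ exists in norm. The norms are $\|f\|_{S_j(\mathbb{R}^d)}=\sqrt{\|f\|_{H^1}^2+\|Q_jf\|_{L^2}^2}$ and $\|f\|_{S_j(\mathbb{Z}^d)}=\sqrt{\|f\|_{\ell^2}^2+\|Q_jf\|_{\ell^2}^2}$ (with value $+\infty$ when $f$ is not in the corresponding domain). A state $\varphi\in D(Q_j)$ exhibits ballistic transport in the $Q_j$-direction if $\lim_{t\to\infty}\frac1t(Q_j)_H(t)\varphi$ exists (in norm) and is non-zero. The assertions include that $\Omega\psi\in D(Q_j)$ and that the displayed limits exist in norm. *)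

theory Defs
  imports "HOL-Analysis.Analysis"
begin

section \<open>The Hilbert spaces\<close>

text \<open>
  One type constructor covers both \<open>L\<^sup>2(\<real>\<^sup>d)\<close> and \<open>\<ell>\<^sup>2(\<int>\<^sup>d)\<close>: the underlying type carries a
  reference measure, which is Lebesgue measure on \<^typ>\<open>real ^ 'n\<close> and counting measure on
  \<^typ>\<open>'n \<Rightarrow> int\<close>.  In both cases \<open>d = CARD('n)\<close>.
\<close>

class ref_measure =
  fixes ref_measure :: "'a measure"

instantiation vec :: (euclidean_space, finite) ref_measure
begin
definition ref_measure_vec :: "('a ^ 'b) measure" where
  "ref_measure_vec = lborel"
instance ..
end

instantiation "fun" :: (finite, countable) ref_measure
begin
definition ref_measure_fun :: "('a \<Rightarrow> 'b) measure" where
  "ref_measure_fun = count_space UNIV"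
instance ..
end

definition square_integrable :: "('a::ref_measure \<Rightarrow> complex) \<Rightarrow> bool" where
  "square_integrable f \<longleftrightarrow>
     f \<in> borel_measurable ref_measure \<and> integrable ref_measure (\<lambda>x. (norm (f x))\<^sup>2)"

lemma square_integrable_0: "square_integrable (\<lambda>x. 0)"
  by (simp add: square_integrable_def)

lemma square_integrable_mult:
  assumes "square_integrable f" shows "square_integrable (\<lambda>x. c * f x)"
  using assms by (auto simp: square_integrable_def norm_mult power_mult_distrib)

lemma square_integrable_add:
  assumes f: "square_integrable f" and g: "square_integrable g"
  shows "square_integrable (\<lambda>x. f x + g x)"
proof -
  have m: "f \<in> borel_measurable ref_measure" "g \<in> borel_measurable ref_measure"
    using f g by (auto simp: square_integrable_def)
  have "integrable ref_measure (\<lambda>x. (norm (f x + g x))\<^sup>2)"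
  proof (rule Bochner_Integration.integrable_bound)
    show "integrable ref_measure (\<lambda>x. 2 * (norm (f x))\<^sup>2 + 2 * (norm (g x))\<^sup>2)"
      using f g by (auto simp: square_integrable_def)
    have "(norm (f x + g x))\<^sup>2 \<le> 2 * (norm (f x))\<^sup>2 + 2 * (norm (g x))\<^sup>2" for x
    proof -
      have "(norm (f x + g x))\<^sup>2 \<le> (norm (f x) + norm (g x))\<^sup>2"
        by (intro power_mono norm_triangle_ineq) auto
      also have "\<dots> \<le> 2 * (norm (f x))\<^sup>2 + 2 * (norm (g x))\<^sup>2"
        using sum_squares_bound[of "norm (f x)" "norm (g x)"] by (simp add: power2_sum)
      finally show ?thesis .
    qed
    then show "AE x in ref_measure. norm ((norm (f x + g x))\<^sup>2)
                 \<le> norm (2 * (norm (f x))\<^sup>2 + 2 * (norm (g x))\<^sup>2)"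
      by auto
  qed (use m in measurable)
  then show ?thesis using m by (simp add: square_integrable_def)
qed

lemma integrable_inner_square_integrable:
  assumes f: "square_integrable f" and g: "square_integrable g"
  shows "integrable ref_measure (\<lambda>x. f x \<bullet> g x)"
proof (rule Bochner_Integration.integrable_bound)
  have m: "f \<in> borel_measurable ref_measure" "g \<in> borel_measurable ref_measure"
    using f g by (auto simp: square_integrable_def)
  show "integrable ref_measure (\<lambda>x. (norm (f x))\<^sup>2 + (norm (g x))\<^sup>2)"
    using f g by (auto simp: square_integrable_def)
  show "(\<lambda>x. f x \<bullet> g x) \<in> borel_measurable ref_measure"
    using m by measurable
  have "\<bar>f x \<bullet> g x\<bar> \<le> (norm (f x))\<^sup>2 + (norm (g x))\<^sup>2" for x
  proof -
    have "\<bar>f x \<bullet> g x\<bar> \<le> norm (f x) * norm (g x)" by (rule Cauchy_Schwarz_ineq2)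
    moreover have "0 \<le> norm (f x) * norm (g x)" by simp
    moreover have "2 * norm (f x) * norm (g x) \<le> (norm (f x))\<^sup>2 + (norm (g x))\<^sup>2"
      by (rule sum_squares_bound)
    ultimately show ?thesis by linarith
  qed
  then show "AE x in ref_measure. norm (f x \<bullet> g x) \<le> norm ((norm (f x))\<^sup>2 + (norm (g x))\<^sup>2)"
    by auto
qed

quotient_type (overloaded) 'a L2 = "'a::ref_measure \<Rightarrow> complex" / partial:
  "\<lambda>f g. square_integrable f \<and> square_integrable g \<and> (AE x in ref_measure. f x = g x)"
proof (rule part_equivpI)
  show "\<exists>f::'a \<Rightarrow> complex. square_integrable f \<and> square_integrable f \<and> (AE x in ref_measure. f x = f x)"
    using square_integrable_0 by auto
  show "symp (\<lambda>f g::'a \<Rightarrow> complex. square_integrable f \<and> square_integrable g \<and>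
                (AE x in ref_measure. f x = g x))"
    by (auto simp: symp_def elim: AE_mp)
  show "transp (\<lambda>f g::'a \<Rightarrow> complex. square_integrable f \<and> square_integrable g \<and>
                (AE x in ref_measure. f x = g x))"
    unfolding transp_def by (auto intro: AE_mp[OF _ AE_mp])
qed

instantiation L2 :: (ref_measure) real_vector
begin

lift_definition zero_L2 :: "'a L2" is "\<lambda>x. 0"
  by (simp add: square_integrable_0)

lift_definition plus_L2 :: "'a L2 \<Rightarrow> 'a L2 \<Rightarrow> 'a L2" is "\<lambda>f g x. f x + g x"
  by (auto simp: square_integrable_add)

lift_definition uminus_L2 :: "'a L2 \<Rightarrow> 'a L2" is "\<lambda>f x. - f x"
  using square_integrable_mult[where c = "-1"] by auto

definition minus_L2 :: "'a L2 \<Rightarrow> 'a L2 \<Rightarrow> 'a L2" where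
  "minus_L2 f g = f + - g"

lift_definition scaleR_L2 :: "real \<Rightarrow> 'a L2 \<Rightarrow> 'a L2" is "\<lambda>r f x. of_real r * f x"
  by (auto simp: square_integrable_mult)

instance
proof
  fix a b c :: "'a L2" and r s :: real
  show "a + b + c = a + (b + c)"
    by transfer (auto simp: square_integrable_add add.assoc)
  show "a + b = b + a"
    by transfer (auto simp: square_integrable_add add.commute)
  show "0 + a = a" by transfer auto
  show "- a + a = 0"
    by transfer (auto simp: square_integrable_0)
  show "a - b = a + - b" by (simp add: minus_L2_def)
  show "r *\<^sub>R (a + b) = r *\<^sub>R a + r *\<^sub>R b"
    by transfer (auto simp: square_integrable_add square_integrable_mult distrib_left)
  show "(r + s) *\<^sub>R a = r *\<^sub>R a + s *\<^sub>R a"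
    by transfer (auto simp: square_integrable_add square_integrable_mult distrib_right)
  show "r *\<^sub>R s *\<^sub>R a = (r * s) *\<^sub>R a"
    by transfer (auto simp: square_integrable_mult mult.assoc)
  show "1 *\<^sub>R a = a" by transfer auto
qed

end

lift_definition scaleC :: "complex \<Rightarrow> 'a::ref_measure L2 \<Rightarrow> 'a L2" (infixr "*\<^sub>C" 75)
  is "\<lambda>c f x. c * f x"
  by (auto simp: square_integrable_mult)

text \<open>
  Only the real part of the usual complex inner product is needed, to obtain the norm
  \<open>\<parallel>f\<parallel> = sqrt (\<integral> |f|\<^sup>2)\<close>; the product \<^term>\<open>z \<bullet> w\<close> of complex numbers is \<open>Re (cnj z * w)\<close>.
\<close>

instantiation L2 :: (ref_measure) real_inner
begin

lift_definition inner_L2 :: "'a L2 \<Rightarrow> 'a L2 \<Rightarrow> real"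
  is "\<lambda>f g. integral\<^sup>L ref_measure (\<lambda>x. f x \<bullet> g x)"
  by (intro integral_cong_AE) (auto simp: square_integrable_def)

definition norm_L2 :: "'a L2 \<Rightarrow> real" where
  "norm_L2 f = sqrt (f \<bullet> f)"

definition dist_L2 :: "'a L2 \<Rightarrow> 'a L2 \<Rightarrow> real" where
  "dist_L2 f g = norm (f - g)"

definition sgn_L2 :: "'a L2 \<Rightarrow> 'a L2" where
  "sgn_L2 f = f /\<^sub>R norm f"

definition uniformity_L2 :: "('a L2 \<times> 'a L2) filter" where
  "uniformity_L2 = (INF e\<in>{0<..}. principal {(f, g). dist f g < e})"

definition open_L2 :: "'a L2 set \<Rightarrow> bool" where
  "open_L2 U \<longleftrightarrow> (\<forall>f\<in>U. eventually (\<lambda>(f', g). f' = f \<longrightarrow> g \<in> U) uniformity)"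

instance
proof
  fix a b c :: "'a L2" and r :: real and U :: "'a L2 set"
  show "dist a b = norm (a - b)" by (simp add: dist_L2_def)
  show "sgn a = a /\<^sub>R norm a" by (simp add: sgn_L2_def)
  show "uniformity = (INF e\<in>{0<..}. principal {(f, g::'a L2). dist f g < e})"
    by (simp add: uniformity_L2_def)
  show "open U \<longleftrightarrow> (\<forall>f\<in>U. eventually (\<lambda>(f', g). f' = f \<longrightarrow> g \<in> U) uniformity)"
    by (simp add: open_L2_def)
  show "norm a = sqrt (a \<bullet> a)" by (simp add: norm_L2_def)
  show "a \<bullet> b = b \<bullet> a"
    by transfer (simp add: inner_commute)
  show "(a + b) \<bullet> c = a \<bullet> c + b \<bullet> c"
    by transfer (auto simp: inner_add_left integrable_inner_square_integrable)
  have "(\<lambda>x. (of_real r * f x) \<bullet> g x) = (\<lambda>x. r * (f x \<bullet> g x))" for f g :: "'a \<Rightarrow> complex"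
    by (simp add: fun_eq_iff scaleR_conv_of_real[symmetric])
  then show "(r *\<^sub>R a) \<bullet> b = r * (a \<bullet> b)"
    by transfer simp
  show "0 \<le> a \<bullet> a" by transfer simp
  show "a \<bullet> a = 0 \<longleftrightarrow> a = 0"
    by transfer (auto simp: integral_nonneg_eq_0_iff_AE integrable_inner_square_integrable
                            square_integrable_0)
qed

end


section \<open>Unbounded operators and the groups they generate\<close>

text \<open>
  An operator is given by its graph; its domain is \<^const>\<open>Domain\<close> of the graph.  All operators
  below are single valued, and \<open>app A f\<close> is the value of \<open>A\<close> at a point \<open>f\<close> of the domain.
\<close>

type_synonym 'h operator = "('h \<times> 'h) set"

definition app :: "'h operator \<Rightarrow> 'h \<Rightarrow> 'h" where
  "app A f = (THE g. (f, g) \<in> A)"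

definition op_add :: "'h::plus operator \<Rightarrow> 'h operator \<Rightarrow> 'h operator" where
  "op_add A B = {(f, g + h) |f g h. (f, g) \<in> A \<and> (f, h) \<in> B}"

definition mult_op :: "('a::ref_measure \<Rightarrow> real) \<Rightarrow> 'a L2 operator" where
  "mult_op m = {(f, g). AE x in ref_measure. rep_L2 g x = of_real (m x) * rep_L2 f x}"

definition unitary_group :: "(real \<Rightarrow> 'a::ref_measure L2 \<Rightarrow> 'a L2) \<Rightarrow> bool" where
  "unitary_group U \<longleftrightarrow>
     (\<forall>t. (\<forall>f g. U t (f + g) = U t f + U t g) \<and> (\<forall>c f. U t (c *\<^sub>C f) = c *\<^sub>C U t f) \<and>
          (\<forall>f. norm (U t f) = norm f) \<and> surj (U t)) \<and>
     U 0 = id \<and> (\<forall>s t. U (s + t) = U s \<circ> U t) \<and>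
     (\<forall>f. continuous_on UNIV (\<lambda>t. U t f))"

text \<open>
  For self-adjoint \<open>H\<close>, \<open>exp_mi H t\<close> is \<open>exp (-i t H)\<close>: by Stone's theorem this is the unique
  strongly continuous unitary group whose generator is exactly \<open>-i H\<close>, including the domain.
\<close>

definition exp_mi :: "'a::ref_measure L2 operator \<Rightarrow> real \<Rightarrow> 'a L2 \<Rightarrow> 'a L2" where
  "exp_mi H = (THE U. unitary_group U \<and>
     H = {(f, g). ((\<lambda>t. U t f) has_vector_derivative (- \<i>) *\<^sub>C g) (at 0)})"

text \<open>\<open>heisenberg H A t\<close> is \<open>exp (i t H) A exp (-i t H)\<close> with its natural domain.\<close>

definition heisenberg :: "'a::ref_measure L2 operator \<Rightarrow> 'a L2 operator \<Rightarrow> real \<Rightarrow> 'a L2 operator" where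
  "heisenberg H A t = {(f, exp_mi H (- t) g) |f g. (exp_mi H t f, g) \<in> A}"

definition wave :: "'a::ref_measure L2 operator \<Rightarrow> 'a L2 operator \<Rightarrow> real \<Rightarrow> 'a L2 \<Rightarrow> 'a L2" where
  "wave H H0 t f = exp_mi H (- t) (exp_mi H0 t f)"

definition Omega_exists :: "'a::ref_measure L2 operator \<Rightarrow> 'a L2 operator \<Rightarrow> 'a L2 \<Rightarrow> bool" where
  "Omega_exists H H0 f \<longleftrightarrow> (\<exists>g. ((\<lambda>t. wave H H0 t f) \<longlongrightarrow> g) at_top)"

definition Omega :: "'a::ref_measure L2 operator \<Rightarrow> 'a L2 operator \<Rightarrow> 'a L2 \<Rightarrow> 'a L2" where
  "Omega H H0 f = Lim at_top (\<lambda>t. wave H H0 t f)"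

text \<open>
  \<open>asymptotic_velocity H Q f v\<close>: the vectors \<open>Q\<^sub>H(t) f / t\<close> are defined for all \<open>t > 0\<close> and
  converge in norm to \<open>v\<close>.
\<close>

definition asymptotic_velocity ::
  "'a::ref_measure L2 operator \<Rightarrow> 'a L2 operator \<Rightarrow> 'a L2 \<Rightarrow> 'a L2 \<Rightarrow> bool" where
  "asymptotic_velocity H Q f v \<longleftrightarrow>
     (\<forall>t>0. f \<in> Domain (heisenberg H Q t)) \<and>
     ((\<lambda>t. (1 / t) *\<^sub>R app (heisenberg H Q t) f) \<longlongrightarrow> v) at_top"

definition ballistic :: "'a::ref_measure L2 operator \<Rightarrow> 'a L2 operator \<Rightarrow> 'a L2 \<Rightarrow> bool" where
  "ballistic H Q f \<longleftrightarrow> f \<in> Domain Q \<and> (\<exists>v. v \<noteq> 0 \<and> asymptotic_velocity H Q f v)"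

definition ess_bounded :: "('a::ref_measure \<Rightarrow> real) \<Rightarrow> bool" where
  "ess_bounded V \<longleftrightarrow> V \<in> borel_measurable ref_measure \<and> (\<exists>C. AE x in ref_measure. \<bar>V x\<bar> \<le> C)"


section \<open>The continuum\<close>

definition partial :: "'n::finite \<Rightarrow> (real ^ 'n \<Rightarrow> real) \<Rightarrow> real ^ 'n \<Rightarrow> real" where
  "partial l u x = frechet_derivative u (at x) (axis l 1)"

definition C1 :: "(real ^ 'n::finite \<Rightarrow> real) \<Rightarrow> bool" where
  "C1 u \<longleftrightarrow> (\<forall>x. u differentiable (at x)) \<and> (\<forall>l. continuous_on UNIV (partial l u))"

text \<open>
  The weak derivative \<open>\<partial>\<^sub>l\<close> on \<open>L\<^sup>2\<close> with its maximal domain.  As in Gilbarg--Trudinger, first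
  order weak derivatives are tested against compactly supported \<open>C\<^sup>1\<close> functions; by mollification
  this is the same as testing against compactly supported smooth functions.
\<close>

definition weak_partial :: "'n::finite \<Rightarrow> (real ^ 'n) L2 operator" where
  "weak_partial l = {(f, g). \<forall>u. C1 u \<and> compact (closure {x. u x \<noteq> 0}) \<longrightarrow>
     integral\<^sup>L lborel (\<lambda>x. partial l u x *\<^sub>R rep_L2 f x) = - integral\<^sup>L lborel (\<lambda>x. u x *\<^sub>R rep_L2 g x)}"

definition H1 :: "(real ^ 'n::finite) L2 set" where
  "H1 = {f. \<forall>l. f \<in> Domain (weak_partial l)}"

definition H2 :: "(real ^ 'n::finite) L2 set" where
  "H2 = {f \<in> H1. \<forall>l. app (weak_partial l) f \<in> H1}"

definition H1_norm :: "(real ^ 'n::finite) L2 \<Rightarrow> real" where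
  "H1_norm f = sqrt ((norm f)\<^sup>2 + (\<Sum>l\<in>UNIV. (norm (app (weak_partial l) f))\<^sup>2))"

definition H0_cont :: "(real ^ 'n::finite) L2 operator" where
  "H0_cont = {(f, - (\<Sum>l\<in>UNIV. app (weak_partial l) (app (weak_partial l) f))) |f. f \<in> H2}"

definition Q_cont :: "'n::finite \<Rightarrow> (real ^ 'n) L2 operator" where
  "Q_cont j = mult_op (\<lambda>x. x $ j)"

definition P_cont :: "'n::finite \<Rightarrow> (real ^ 'n) L2 operator" where
  "P_cont j = {(f, (- \<i>) *\<^sub>C g) |f g. (f, g) \<in> weak_partial j}"

definition S_norm_cont :: "'n::finite \<Rightarrow> (real ^ 'n) L2 \<Rightarrow> ennreal" where
  "S_norm_cont j f =
     (if f \<in> H1 \<inter> Domain (Q_cont j)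
      then ennreal (sqrt ((H1_norm f)\<^sup>2 + (norm (app (Q_cont j) f))\<^sup>2)) else \<infinity>)"


section \<open>The lattice\<close>

text \<open>
  Counting measure has no null sets but the empty one, so \<^term>\<open>rep_L2 f\<close> is here the only
  representative of \<^term>\<open>f\<close>.  The updates \<open>n(l := n l + 1)\<close> and \<open>n(l := n l - 1)\<close> are
  \<open>n + e\<^sub>l\<close> and \<open>n - e\<^sub>l\<close>.
\<close>

definition H0_lat :: "('n::finite \<Rightarrow> int) L2 operator" where
  "H0_lat = {(f, g). \<forall>n. rep_L2 g n =
     (\<Sum>l\<in>UNIV. rep_L2 f (n(l := n l + 1)) + rep_L2 f (n(l := n l - 1)))}"

definition Q_lat :: "'n::finite \<Rightarrow> ('n \<Rightarrow> int) L2 operator" where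
  "Q_lat j = mult_op (\<lambda>n. real_of_int (n j))"

definition P_lat :: "'n::finite \<Rightarrow> ('n \<Rightarrow> int) L2 operator" where
  "P_lat j = {(f, g). \<forall>n. rep_L2 g n =
     \<i> * (rep_L2 f (n(j := n j + 1)) - rep_L2 f (n(j := n j - 1)))}"

definition S_norm_lat :: "'n::finite \<Rightarrow> ('n \<Rightarrow> int) L2 \<Rightarrow> ennreal" where
  "S_norm_lat j f =
     (if f \<in> Domain (Q_lat j)
      then ennreal (sqrt ((norm f)\<^sup>2 + (norm (app (Q_lat j) f))\<^sup>2)) else \<infinity>)"

end

theory Submission
  imports Defs
begin

text \<open>
  Put \<open>E\<^sub>a = exp (i a Q)\<close>.  A vector \<open>f\<close> lies in \<open>D(Q)\<close> with \<open>\<parallel>Q f\<parallel> \<le> C\<close> as soon as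
  \<open>\<parallel>E\<^sub>a f - f\<parallel> \<le> C a\<close> for small \<open>a > 0\<close>, so statements on \<open>Q\<close> become estimates for the
  unitary operators \<open>E\<^sub>a\<close>.

  In the continuum, conjugation with \<open>E\<^sub>a\<close> turns \<open>H\<^sub>0\<close> into \<open>H\<^sub>0 - 2 a P + a\<^sup>2\<close>, hence
  \<open>E\<^sub>a U\<^sub>0(t) = U\<^sub>0(t) exp (2 i a t P) exp (- i a\<^sup>2 t) E\<^sub>a\<close> for \<open>U\<^sub>0(t) = exp (- i t H\<^sub>0)\<close>, and
  differentiating at \<open>a = 0\<close> gives \<open>Q U\<^sub>0(t) \<psi> = U\<^sub>0(t) (Q \<psi> + 2 t P \<psi>)\<close>; on the lattice the
  commutator of \<open>H\<^sub>0\<close> and \<open>E\<^sub>a\<close> is bounded by \<open>2 \<bar>a\<bar>\<close>.  For \<open>U(t) = exp (- i t H)\<close> the same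
  commutator together with conservation of energy, which bounds \<open>P U(s) g\<close>, yields
  \<open>\<parallel>E\<^sub>a U(t) g - U(t) g\<parallel> \<le> C a (1 + \<bar>t\<bar>) \<parallel>g\<parallel>\<^sub>S\<close>.

  By Duhamel's formula \<open>U(t) \<Omega> \<psi> = U\<^sub>0(t) \<psi> + i \<integral>\<^sub>t\<^sup>\<infinity> U(t - s) V U\<^sub>0(s) \<psi> ds\<close>.  The estimate above
  and the first integrability hypothesis bound \<open>Q\<close> of the integral uniformly in \<open>t\<close>; after
  division by \<open>t\<close> only \<open>U(- t) U\<^sub>0(t) 2 P \<psi>\<close> survives, and it converges to \<open>2 \<Omega> P \<psi>\<close> by Cook's
  criterion.

  The groups exist by Stone's theorem, proved here for skew-adjoint operators on real Hilbert
  spaces.  Self-adjointness of \<open>- \<Delta>\<close> on \<open>H\<^sup>2\<close> comes from the projection theorem and difference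
  quotients, after identifying weak derivatives with generators of translation groups.
\<close>

text \<open>The unbounded \<open>Q\<close> cannot be moved through the Duhamel integral or the limit
  defining \<open>Omega\<close> without separate questions of domain, closedness and measurability.
  The maps \<open>x \<mapsto> phase m a x - x\<close> are bounded, so both exchanges are immediate,
  and Fatou's lemma turns a bound of order a back into membership in the domain. The S-norm thereby
  enters only as a pointwise upper bound for continuous integrands.

  The weight 1 + t has this origin: in the tail integral over s \<ge> t \<ge> 0 the vector V exp(-i
  s H_0) \<psi> is transported for a time of length s - t, during which Q grows at most linearly,
  and s - t \<le> s makes the bound independent of t.

  Since \<open>L2\<close> carries only a real inner product, operator theory is done over the reals:
  -iH is the skew operator treated there, and complex linearity returns as commutation with
  multiplication by i. In the continuum the energy argument needs differentiable orbits, so it runs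
  on \<open>H2\<close> first and reaches \<open>H1\<close> through resolvents of H_0.\<close>

section \<open>Calculus of curves in normed spaces\<close>

lemma has_vector_derivative_iff_quotient:
  fixes f :: "real \<Rightarrow> 'b::real_normed_vector"
  shows "(f has_vector_derivative d) (at x) \<longleftrightarrow> ((\<lambda>s. (f s - f x) /\<^sub>R (s - x)) \<longlongrightarrow> d) (at x)"
proof -
  have "norm ((f s - f x) /\<^sub>R (s - x) - d) = norm (f s - f x - (s - x) *\<^sub>R d) / norm (s - x)"
    if "s \<noteq> x" for s
  proof -
    have "(f s - f x) /\<^sub>R (s - x) - d = (f s - f x - (s - x) *\<^sub>R d) /\<^sub>R (s - x)"
      using that by (simp add: scaleR_diff_right)
    then show ?thesis
      by (simp add: divide_inverse_commute)
  qed
  then have "((\<lambda>s. norm ((f s - f x) /\<^sub>R (s - x) - d)) \<longlongrightarrow> 0) (at x) \<longleftrightarrow>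
      ((\<lambda>s. norm (f s - f x - (s - x) *\<^sub>R d) / norm (s - x)) \<longlongrightarrow> 0) (at x)"
    by (intro filterlim_cong refl) (auto simp: eventually_at_filter)
  moreover have "((\<lambda>s. norm ((f s - f x) /\<^sub>R (s - x) - d)) \<longlongrightarrow> 0) (at x) \<longleftrightarrow>
      ((\<lambda>s. (f s - f x) /\<^sub>R (s - x)) \<longlongrightarrow> d) (at x)"
    by (simp only: tendsto_norm_zero_iff LIM_zero_iff)
  moreover have "(f has_vector_derivative d) (at x) \<longleftrightarrow>
      ((\<lambda>s. norm (f s - f x - (s - x) *\<^sub>R d) / norm (s - x)) \<longlongrightarrow> 0) (at x)"
    unfolding has_vector_derivative_def has_derivative_iff_norm
    by (simp only: bounded_linear_scaleR_left simp_thms)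
  ultimately show ?thesis by simp
qed

text \<open>Mean value inequality for \<open>f x - x *\<^sub>R c\<close>. The free vector
  \<open>c\<close> serves two purposes: \<open>c = 0\<close> gives Lipschitz bounds, and the
  derivative at the base point gives first order expansions with an explicit error.\<close>

lemma vector_derivative_bound:
  fixes f :: "real \<Rightarrow> 'b::real_normed_vector"
  assumes d: "\<And>x. x \<in> closed_segment a b \<Longrightarrow> (f has_vector_derivative f' x) (at x)"
    and B: "\<And>x. x \<in> closed_segment a b \<Longrightarrow> norm (f' x - c) \<le> B"
  shows "norm (f b - f a - (b - a) *\<^sub>R c) \<le> \<bar>b - a\<bar> * B"
proof -
  let ?g = "\<lambda>x. f x - x *\<^sub>R c"
  have *: "(?g has_derivative (\<lambda>h. h *\<^sub>R (f' x - c))) (at x within closed_segment a b)"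
    if "x \<in> closed_segment a b" for x
  proof -
    have "(f has_derivative (\<lambda>h. h *\<^sub>R f' x)) (at x within closed_segment a b)"
      using d[OF that, unfolded has_vector_derivative_def] by (rule has_derivative_at_withinI)
    moreover have "((\<lambda>x. x *\<^sub>R c) has_derivative (\<lambda>h. h *\<^sub>R c)) (at x within closed_segment a b)"
      by (intro has_derivative_scaleR_left has_derivative_ident)
    ultimately show ?thesis
      unfolding scaleR_diff_right by (rule has_derivative_diff)
  qed
  have "norm (?g b - ?g a) \<le> B * norm (b - a)"
  proof (rule differentiable_bound[OF _ *])
    fix x assume "x \<in> closed_segment a b"
    then show "onorm (\<lambda>h. h *\<^sub>R (f' x - c)) \<le> B"
      using B[of x] by (intro onorm_le) (metis abs_ge_zero mult.commute mult_right_mono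
          norm_scaleR real_norm_def)
  qed auto
  then show ?thesis by (simp add: algebra_simps)
qed

section \<open>Orthogonal groups and their generators\<close>

text \<open>Real counterpart of a strongly continuous unitary group. Complex linearity is not part
  of it; it is recovered later from uniqueness of the group with a given generator.\<close>

locale ortho_group =
  fixes U :: "real \<Rightarrow> 'h::real_inner \<Rightarrow> 'h"
  assumes linear: "linear (U t)"
    and norm [simp]: "norm (U t f) = norm f"
    and zero [simp]: "U 0 f = f"
    and add: "U (s + t) f = U s (U t f)"
    and continuous: "continuous_on UNIV (\<lambda>t. U t f)"

definition generator :: "(real \<Rightarrow> 'h::real_normed_vector \<Rightarrow> 'h) \<Rightarrow> ('h \<times> 'h) set" where
  "generator U = {(f, g). ((\<lambda>t. U t f) has_vector_derivative g) (at 0)}"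

lemma generatorD: "(f, g) \<in> generator U \<Longrightarrow> ((\<lambda>t. U t f) has_vector_derivative g) (at 0)"
  by (simp add: generator_def)

lemma generator_unique: "(f, g) \<in> generator U \<Longrightarrow> (f, g') \<in> generator U \<Longrightarrow> g = g'"
  by (auto simp: generator_def intro: vector_derivative_unique_at)

context ortho_group
begin

lemma bounded_linear: "bounded_linear (U t)"
  using linear[of t] norm by (intro bounded_linear_intro[where K
      = 1]) (auto simp: linear_add linear_scale)

lemmas bl_simps = linear_add[OF linear] linear_diff[OF linear] linear_scale[OF linear]
  linear_0[OF linear] linear_neg[OF linear]

lemma inverse [simp]: "U (- t) (U t f) = f" "U t (U (- t) f) = f"
  using add[of "-t" t f] add[of t "-t" f] by auto

lemma inner [simp]: "U t f \<bullet> U t g = f \<bullet> g"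
  by (simp add: dot_norm flip: bl_simps)

lemma inner_left: "U t f \<bullet> g = f \<bullet> U (- t) g"
  using inner[of t f "U (- t) g"] by simp

text \<open>Joint continuity in time and vector: the isometries are Lipschitz with a common
  constant, so continuity of single orbits suffices.\<close>

lemma tendsto:
  assumes y: "(y \<longlongrightarrow> l) F" and r: "(r \<longlongrightarrow> t) F"
  shows "((\<lambda>x. U (r x) (y x)) \<longlongrightarrow> U t l) F"
proof -
  have "((\<lambda>x. U (r x) l) \<longlongrightarrow> U t l) F"
    using continuous[of l] r by (rule continuous_on_tendsto_compose) auto
  moreover have "((\<lambda>x. U (r x) (y x) - U (r x) l) \<longlongrightarrow> 0) F"
  proof (rule Lim_null_comparison)
    show "\<forall>\<^sub>F x in F. norm (U (r x) (y x) - U (r x) l) \<le> norm (y x - l)"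
      by (simp flip: bl_simps)
    show "((\<lambda>x. norm (y x - l)) \<longlongrightarrow> 0) F"
      using y by (simp add: tendsto_norm_zero LIM_zero)
  qed
  ultimately show ?thesis
    using tendsto_add by fastforce
qed

lemma has_vector_derivative_orbit:
  assumes "(f, g) \<in> generator U"
  shows "((\<lambda>s. U s f) has_vector_derivative U t g) (at t)"
proof -
  have "((\<lambda>s. s - t) has_vector_derivative 1) (at t)"
    by (auto intro!: derivative_eq_intros)
  then have "(((\<lambda>s. U s f) \<circ> (\<lambda>s. s - t)) has_vector_derivative 1 *\<^sub>R g) (at t)"
    by (rule vector_diff_chain_at) (use generatorD[OF assms] in simp)
  then have "((\<lambda>s. U t (U (s - t) f)) has_vector_derivative U t g) (at t)"
    by (intro bounded_linear.has_vector_derivative[OF bounded_linear]) (simp add: o_def)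
  then show ?thesis by (simp flip: add)
qed

text \<open>Product rule, from the splitting of \<open>y s\<close> into \<open>y t\<close> and
  \<open>y s - y t\<close>: only the value at the point of differentiation has to lie in the domain.
  The speed \<open>c\<close> is -1 for backward evolution in Duhamel arguments and
  \<open>2 * a\<close> or \<open>2 * t\<close> for translations.\<close>

lemma has_vector_derivative:
  assumes y: "(y has_vector_derivative y') (at t)" and h: "(y t, h) \<in> generator U"
  shows "((\<lambda>s. U (c * s) (y s)) has_vector_derivative (c *\<^sub>R U (c * t) h + U (c * t) y')) (at t)"
proof -
  have "((\<lambda>s. c * s) has_vector_derivative c) (at t)"
    by (auto intro!: derivative_eq_intros simp:
        has_real_derivative_iff_has_vector_derivative[symmetric])
  then have "(((\<lambda>s. U s (y t)) \<circ> (\<lambda>s. c * s)) has_vector_derivative (c *\<^sub>R U (c * t) h)) (at t)"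
    by (rule vector_diff_chain_at) (rule has_vector_derivative_orbit[OF h])
  moreover have "((\<lambda>s. U (c * s) (y s - y t)) has_vector_derivative U (c * t) y') (at t)"
  proof -
    have "((\<lambda>s. U (c * s) ((y s - y t) /\<^sub>R (s - t))) \<longlongrightarrow> U (c * t) y') (at t)"
      using y unfolding has_vector_derivative_iff_quotient by (intro tendsto tendsto_intros) auto
    then show ?thesis
      by (simp add: has_vector_derivative_iff_quotient bl_simps)
  qed
  ultimately have "((\<lambda>s. U (c * s) (y t) + U (c * s) (y s - y t)) has_vector_derivative
      (c *\<^sub>R U (c * t) h + U (c * t) y')) (at t)"
    unfolding o_def by (rule has_vector_derivative_add)
  then show ?thesis by (simp flip: bl_simps)
qed

lemma generator_orbit: "(f, g) \<in> generator U \<Longrightarrow> (U t f, U t g) \<in> generator U"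
proof -
  assume "(f, g) \<in> generator U"
  then have "((\<lambda>s. U t (U s f)) has_vector_derivative U t g) (at 0)"
    by (intro bounded_linear.has_vector_derivative[OF bounded_linear] generatorD)
  then show ?thesis by (simp add: generator_def add.commute flip: add)
qed

text \<open>The pairing of two orbits is constant in time; its derivative at 0 is integration by
  parts in abstract form.\<close>

lemma generator_skew:
  assumes "(f, g) \<in> generator U" "(f', g') \<in> generator U"
  shows "f \<bullet> g' = - (g \<bullet> f')"
proof -
  have "((\<lambda>t. U t f \<bullet> U t f') has_vector_derivative (U 0 f \<bullet> g' + g \<bullet> U 0 f')) (at 0)"
    using assms by (intro bounded_bilinear.has_vector_derivative[OF bounded_bilinear_inner]
        generatorD)
  moreover have "((\<lambda>t. U t f \<bullet> U t f') has_vector_derivative 0) (at 0)" by simp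
  ultimately show ?thesis
    by (metis vector_derivative_unique_at add.inverse_unique add.commute zero inverse(1)
        minus_unique)
qed

lemma generator_skew': "(f, g) \<in> generator U \<Longrightarrow> f \<bullet> g = 0"
  using generator_skew[of f g f g] by (simp add: inner_commute)

lemma subspace_generator: "subspace (generator U)"
  unfolding subspace_def generator_def
  by (auto simp: zero_prod_def bl_simps intro: has_vector_derivative_add
      bounded_linear.has_vector_derivative[OF bounded_linear_scaleR_right])

text \<open>The limit in k is taken in the undivided remainder at fixed t. The mean value inequality
  bounds it by \<open>norm (g k - g0)\<close>, which vanishes in this limit, and by the modulus of
  continuity of the orbit of \<open>g0\<close>, which survives the later division by t.\<close>

lemma generator_closed:
  assumes p: "\<And>k. (f k, g k) \<in> generator U" and f: "f \<longlonglongrightarrow> f0" and g: "g \<longlonglongrightarrow> g0"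
  shows "(f0, g0) \<in> generator U"
  unfolding generator_def has_vector_derivative_iff_quotient mem_Collect_eq prod.case
proof (rule tendstoI)
  fix e :: real assume e: "0 < e"
  have "((\<lambda>t. U t g0) \<longlongrightarrow> U 0 g0) (at 0)"
    by (intro tendsto tendsto_intros)
  then obtain d where d: "d > 0" "\<And>s. \<bar>s\<bar> < d \<Longrightarrow> norm (U s g0 - g0) \<le> e / 2"
    using e unfolding LIM_eq by (metis diff_zero half_gt_zero less_eq_real_def real_norm_def
        norm_zero right_minus_eq zero)
  have "dist ((U t f0 - U 0 f0) /\<^sub>R (t - 0)) g0 < e" if t: "t \<noteq> 0" "\<bar>t\<bar> < d" for t
  proof -
    have "norm (U t (f k) - f k - t *\<^sub>R g k) \<le> \<bar>t\<bar> * (2 * norm (g k - g0) + e / 2)" for k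
    proof -
      have "norm (U t (f k) - U 0 (f k) - (t - 0) *\<^sub>R g k)
          \<le> \<bar>t - 0\<bar> * (2 * norm (g k - g0) + e / 2)"
      proof (rule vector_derivative_bound[OF has_vector_derivative_orbit[OF p]])
        fix s assume "s \<in> closed_segment 0 t"
        then have "\<bar>s\<bar> < d" using t by (auto simp: closed_segment_eq_real_ivl split: if_splits)
        then have "norm (U s g0 - g0) \<le> e / 2" by (rule d)
        moreover have "U s (g k) - g k = U s (g k - g0) + (U s g0 - g0) + (g0 - g k)"
          by (simp add: bl_simps)
        moreover have "norm (U s (g k - g0)) = norm (g k - g0)" by simp
        ultimately show "norm (U s (g k) - g k) \<le> 2 * norm (g k - g0) + e / 2"
          using norm_triangle_ineq[of "U s (g k - g0) + (U s g0 - g0)" "g0 - g k"]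
            norm_triangle_ineq[of "U s (g k - g0)" "U s g0 - g0"]
          by (simp only: norm_minus_commute[of g0 "g k"])
      qed
      then show ?thesis by simp
    qed
    moreover have "(\<lambda>k. norm (U t (f k) - f k - t *\<^sub>R g k)) \<longlonglongrightarrow> norm (U t f0 - f0 - t *\<^sub>R g0)"
      by (intro tendsto_intros f g bounded_linear.tendsto[OF bounded_linear])
    moreover have "(\<lambda>k. \<bar>t\<bar> * (2 * norm (g k - g0) + e / 2)) \<longlonglongrightarrow> \<bar>t\<bar> * (2 * norm (g0 - g0) + e / 2)"
      by (intro tendsto_intros g)
    ultimately have "norm (U t f0 - f0 - t *\<^sub>R g0) \<le> \<bar>t\<bar> * (e / 2)"
      using LIMSEQ_le[of _ "norm (U t f0 - f0 - t *\<^sub>R g0)" _ "\<bar>t\<bar> * (2 * norm (g0 - g0) + e / 2)"]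
      by fastforce
    also have "\<dots> < \<bar>t\<bar> * e" using t e by simp
    finally have "norm (U t f0 - f0 - t *\<^sub>R g0) / \<bar>t\<bar> < e"
      using t by (simp add: pos_divide_less_eq mult.commute)
    moreover have "(U t f0 - U 0 f0) /\<^sub>R (t - 0) - g0 = (U t f0 - f0 - t *\<^sub>R g0) /\<^sub>R t"
      using t by (simp add: scaleR_diff_right)
    ultimately show ?thesis
      by (simp add: dist_norm divide_inverse_commute)
  qed
  then show "\<forall>\<^sub>F t in at 0. dist ((U t f0 - U 0 f0) /\<^sub>R (t - 0)) g0 < e"
    unfolding eventually_at using d(1) by (intro exI[of _ d]) (auto simp: dist_real_def)
qed

end

text \<open>On the domain of the smaller generator \<open>W (- s) (U s f)\<close> has derivative
  zero. Hence a single inclusion of generators has to be checked wherever two groups are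
  identified.\<close>

lemma ortho_group_eqI:
  assumes U: "ortho_group U" and W: "ortho_group W" and sub: "generator U \<subseteq> generator W"
    and dense: "closure (Domain (generator U)) = UNIV"
  shows "U t f = W t f"
proof -
  interpret U: ortho_group U by (rule U)
  interpret W: ortho_group W by (rule W)
  have "U t f = W t f" if "f \<in> Domain (generator U)" for f
  proof -
    from that obtain g where g: "(f, g) \<in> generator U" by (rule DomainE)
    have "((\<lambda>s. W (- 1 * s) (U s f)) has_vector_derivative 0) (at s)" for s
    proof -
      have "((\<lambda>s. W (- 1 * s) (U s f)) has_vector_derivative
          ((- 1) *\<^sub>R W (- 1 * s) (U s g) + W (- 1 * s) (U s g))) (at s)"
        by (rule W.has_vector_derivative[OF U.has_vector_derivative_orbit[OF g]])
          (use sub U.generator_orbit[OF g] in auto)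
      then show ?thesis by simp
    qed
    then have "((\<lambda>s. W (- 1 * s) (U s f)) has_derivative (\<lambda>h. 0)) (at s within UNIV)" for s
      by (simp add: has_vector_derivative_def)
    from has_derivative_zero_unique[OF convex_UNIV this UNIV_I UNIV_I, of t 0]
    have "W (- t) (U t f) = f" by simp
    then show ?thesis by (metis W.inverse(2))
  qed
  moreover have "closed {f. U t f = W t f}"
    by (intro closed_Collect_eq linear_continuous_on U.bounded_linear W.bounded_linear)
  ultimately show ?thesis
    using closure_minimal[of "Domain (generator U)" "{f. U t f = W t f}"] dense by auto
qed

section \<open>Projection onto closed subspaces\<close>

text \<open>The parallelogram identity, applied with midpoints in S, makes a minimising sequence
  Cauchy; orthogonality follows by varying the minimiser along z.\<close>

lemma orthogonal_projection:
  fixes x :: "'h::{real_inner,banach}"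
  assumes S: "subspace S" "closed S"
  obtains y where "y \<in> S" "\<And>z. z \<in> S \<Longrightarrow> (x - y) \<bullet> z = 0"
proof -
  define d where "d = (INF s\<in>S. (norm (x - s))\<^sup>2)"
  have ne: "S \<noteq> {}" using S(1) subspace_0 by blast
  have bdd: "bdd_below ((\<lambda>s. (norm (x - s))\<^sup>2) ` S)"
    by (rule bdd_belowI[of _ 0]) auto
  have d_le: "d \<le> (norm (x - s))\<^sup>2" if "s \<in> S" for s
    unfolding d_def using bdd that by (rule cINF_lower)
  have "\<exists>s\<in>S. (norm (x - s))\<^sup>2 < d + 1 / Suc n" for n
    using cINF_less_iff[OF ne bdd, of "d + 1 / Suc n"] by (simp add: d_def)
  then obtain s where s: "\<And>n. s n \<in> S" "\<And>n. (norm (x - s n))\<^sup>2 < d + 1 / Suc n"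
    by metis
  have close: "(norm (s n - s m))\<^sup>2 \<le> 2 / Suc n + 2 / Suc m" for n m
  proof -
    have "(1/2) *\<^sub>R (s n + s m) \<in> S"
      using s(1) S(1) by (intro subspace_scale subspace_add) auto
    from d_le[OF this] have "4 * d \<le> (norm ((x - s n) + (x - s m)))\<^sup>2"
      by (simp add: power2_norm_eq_inner inner_diff inner_add algebra_simps inner_commute)
    moreover have "(norm (s n - s m))\<^sup>2 + (norm ((x - s n) + (x - s m)))\<^sup>2
        = 2 * (norm (x - s n))\<^sup>2 + 2 * (norm (x - s m))\<^sup>2"
      by (simp add: power2_norm_eq_inner inner_diff inner_add algebra_simps inner_commute)
    ultimately show ?thesis using s(2)[of n] s(2)[of m] by simp
  qed
  have "Cauchy s"
  proof (rule metric_CauchyI)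
    fix e :: real assume e: "0 < e"
    then obtain N where N: "4 / e\<^sup>2 < of_nat N" using reals_Archimedean2 by blast
    show "\<exists>N. \<forall>m\<ge>N. \<forall>n\<ge>N. dist (s m) (s n) < e"
    proof (intro exI allI impI)
      fix m n assume mn: "N \<le> m" "N \<le> n"
      have *: "2 / Suc k < e\<^sup>2 / 2" if "N \<le> k" for k
      proof -
        have "4 / e\<^sup>2 < Suc k" using N that by simp
        then show ?thesis using e by (simp add: field_simps)
      qed
      have "(norm (s m - s n))\<^sup>2 < e\<^sup>2"
        using close[of m n] *[OF mn(1)] *[OF mn(2)] by simp
      then show "dist (s m) (s n) < e"
        using e by (simp add: dist_norm power2_less_imp_less)
    qed
  qed
  then obtain y where y: "s \<longlonglongrightarrow> y" by (metis Cauchy_convergent convergentD)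
  have "y \<in> S" using closed_sequentially[OF S(2)] s(1) y by blast
  have min: "(norm (x - y))\<^sup>2 \<le> d"
  proof (rule LIMSEQ_le)
    show "(\<lambda>n. (norm (x - s n))\<^sup>2) \<longlonglongrightarrow> (norm (x - y))\<^sup>2"
      by (intro tendsto_intros y)
    show "(\<lambda>n. d + 1 / Suc n) \<longlonglongrightarrow> d"
      using LIMSEQ_inverse_real_of_nat_add[of d] by (simp add: inverse_eq_divide)
  qed (use s(2) less_imp_le in blast)
  have "(x - y) \<bullet> z = 0" if z: "z \<in> S" for z
  proof (cases "z = 0")
    case False
    \<comment> \<open>The minimum point of the quadratic polynomial
      \<open>(norm (x - y - t *\<^sub>R z))\<^sup>2\<close> in t.\<close>
    define t where "t = ((x - y) \<bullet> z) / (z \<bullet> z)"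
    have zz: "z \<bullet> z > 0" using False by simp
    have "y + t *\<^sub>R z \<in> S" using S(1) z \<open>y \<in> S\<close> by (intro subspace_add subspace_scale)
    from order_trans[OF min d_le[OF this]]
    have "0 \<le> t * t * (z \<bullet> z) - 2 * t * ((x - y) \<bullet> z)"
      by (simp add: power2_norm_eq_inner inner_diff inner_add algebra_simps inner_commute)
    also have "\<dots> = - (((x - y) \<bullet> z)\<^sup>2 / (z \<bullet> z))"
      using zz by (simp add: t_def power2_eq_square)
    finally have "((x - y) \<bullet> z)\<^sup>2 \<le> 0"
      using zz by (simp add: divide_le_0_iff)
    then show ?thesis by simp
  qed simp
  with \<open>y \<in> S\<close> show ?thesis by (rule that)
qed

lemma dense_subspaceI:
  fixes S :: "'h::{real_inner,banach} set"
  assumes S: "subspace S" and orth: "\<And>v. (\<And>s. s \<in> S \<Longrightarrow> v \<bullet> s = 0) \<Longrightarrow> v = 0"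
  shows "closure S = UNIV"
proof -
  have "x \<in> closure S" for x
  proof -
    have "subspace (closure S)"
    proof (rule subspaceI)
      show "0 \<in> closure S" using S closure_subset subspace_0 by blast
      show "a + b \<in> closure S" if ab: "a \<in> closure S" "b \<in> closure S" for a b
      proof -
        obtain p q where "\<forall>n. p n \<in> S" "p \<longlonglongrightarrow> a" "\<forall>n. q n \<in> S" "q \<longlonglongrightarrow> b"
          using ab unfolding closure_sequential by blast
        then show ?thesis
          unfolding closure_sequential
          by (intro exI[of _ "\<lambda>n. p n + q n"]) (auto intro: tendsto_add subspace_add[OF S])
      qed
      show "r *\<^sub>R a \<in> closure S" if a: "a \<in> closure S" for r :: real and a
      proof -
        obtain p :: "nat \<Rightarrow> 'h" where "\<forall>n. p n \<in> S" "p \<longlonglongrightarrow> a"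
          using a unfolding closure_sequential by blast
        then show ?thesis
          unfolding closure_sequential
          by (intro exI[of _ "\<lambda>n. r *\<^sub>R p n"]) (auto intro: tendsto_scaleR subspace_scale[OF S])
      qed
    qed
    then obtain y where y: "y \<in> closure S" "\<And>z. z \<in> closure S \<Longrightarrow> (x - y) \<bullet> z = 0"
      using orthogonal_projection[of "closure S" x] by auto
    then have "x - y = 0" using orth closure_subset by (metis subsetD)
    then show ?thesis using y(1) by simp
  qed
  then show ?thesis by blast
qed

section \<open>Bounded skew operators\<close>

text \<open>A relaxed fixed point iteration. Skewness makes \<open>w\<close> and \<open>B w\<close>
  orthogonal, so Pythagoras yields a contraction for every nonzero r, however small compared with
  the norm of B; a Neumann series would need r to be large.\<close>

lemma bounded_skew_surj:
  fixes B :: "'h::{real_inner,banach} \<Rightarrow> 'h"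
  assumes B: "bounded_linear B" and skew: "\<And>f. f \<bullet> B f = 0" and r: "r \<noteq> 0"
  shows "\<exists>x. r *\<^sub>R x - B x = g"
proof -
  interpret B: bounded_linear B by (rule B)
  obtain K where K: "K > 0" "\<And>x. norm (B x) \<le> norm x * K" using B.pos_bounded by blast
  \<comment> \<open>This \<open>p\<close> minimises the squared contraction factor
    \<open>(1 - p * r)\<^sup>2 + p\<^sup>2 * K\<^sup>2\<close>, and \<open>q\<close> is the square
    root of the minimum.\<close>
  define p where "p = r / (r\<^sup>2 + K\<^sup>2)"
  define q where "q = sqrt (1 - r\<^sup>2 / (r\<^sup>2 + K\<^sup>2))"
  have pos: "r\<^sup>2 + K\<^sup>2 > 0" using K by (simp add: add_nonneg_pos)
  have q2: "1 - r\<^sup>2 / (r\<^sup>2 + K\<^sup>2) = K\<^sup>2 / (r\<^sup>2 + K\<^sup>2)"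
    using pos diff_divide_distrib[of "r\<^sup>2 + K\<^sup>2" "r\<^sup>2" "r\<^sup>2 + K\<^sup>2"] r by simp
  have "0 \<le> q" "q < 1" using pos r by (auto simp: q_def q2)
  let ?T = "\<lambda>x. x - p *\<^sub>R (r *\<^sub>R x - B x - g)"
  have con: "dist (?T x) (?T y) \<le> q * dist x y" for x y
  proof -
    define w where "w = x - y"
    have T: "?T x - ?T y = (1 - p * r) *\<^sub>R w + p *\<^sub>R B w"
      by (simp add: w_def B.diff algebra_simps)
    have "orthogonal ((1 - p * r) *\<^sub>R w) (p *\<^sub>R B w)"
      by (simp add: orthogonal_def skew)
    then have "(norm (?T x - ?T y))\<^sup>2 = (norm ((1 - p * r) *\<^sub>R w))\<^sup>2 + (norm (p *\<^sub>R B w))\<^sup>2"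
      unfolding T by (rule norm_add_Pythagorean)
    also have "\<dots> = (1 - p * r)\<^sup>2 * (norm w)\<^sup>2 + p\<^sup>2 * (norm (B w))\<^sup>2"
      by (simp add: power_mult_distrib)
    also have "\<dots> \<le> (1 - p * r)\<^sup>2 * (norm w)\<^sup>2 + p\<^sup>2 * (K\<^sup>2 * (norm w)\<^sup>2)"
      using power_mono[OF K(2)[of w], of 2] by (intro add_left_mono mult_left_mono)
        (auto simp: power_mult_distrib mult.commute)
    also have "\<dots> = (1 - 2 * p * r + p\<^sup>2 * (r\<^sup>2 + K\<^sup>2)) * (norm w)\<^sup>2"
      by (simp add: power2_eq_square algebra_simps)
    also have "1 - 2 * p * r + p\<^sup>2 * (r\<^sup>2 + K\<^sup>2) = 1 - r\<^sup>2 / (r\<^sup>2 + K\<^sup>2)"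
    proof -
      have "p * (r\<^sup>2 + K\<^sup>2) = r" "p * r = r\<^sup>2 / (r\<^sup>2 + K\<^sup>2)"
        using pos by (simp_all add: p_def power2_eq_square)
      then show ?thesis by (simp add: power2_eq_square[of p] mult.assoc)
    qed
    also have "\<dots> = q\<^sup>2" using pos by (simp add: q_def q2)
    finally have "(norm (?T x - ?T y))\<^sup>2 \<le> (q * norm w)\<^sup>2" by (simp add: power_mult_distrib)
    then show ?thesis
      using \<open>0 \<le> q\<close> by (simp add: dist_norm w_def power2_le_iff_abs_le)
  qed
  have "\<exists>!x. ?T x = x"
    by (rule banach_fix_type[OF \<open>0 \<le> q\<close> \<open>q < 1\<close>]) (intro allI con)
  then obtain x where "?T x = x" by (rule ex1E)
  then have "r *\<^sub>R x - B x = g" using r pos by (simp add: p_def)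
  then show ?thesis by blast
qed

lemma skew_ode_unique:
  fixes B :: "'h::real_inner \<Rightarrow> 'h"
  assumes B: "linear B" and skew: "\<And>f. f \<bullet> B f = 0"
    and y: "\<And>t. (y has_vector_derivative B (y t)) (at t)"
    and z: "\<And>t. (z has_vector_derivative B (z t)) (at t)"
    and 0: "y 0 = z 0"
  shows "y t = z t"
proof -
  let ?w = "\<lambda>t. y t - z t"
  have "((\<lambda>t. ?w t \<bullet> ?w t) has_vector_derivative (?w t \<bullet> B (?w t) + B (?w t) \<bullet> ?w t)) (at t)" for t
    using has_vector_derivative_diff[OF y z, of t]
    by (intro bounded_bilinear.has_vector_derivative[OF bounded_bilinear_inner])
      (simp_all add: linear_diff[OF B])
  then have "((\<lambda>t. ?w t \<bullet> ?w t) has_derivative (\<lambda>h. 0)) (at t within UNIV)" for t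
    by (simp only: skew inner_commute[of "B _"] has_vector_derivative_def add_0 scaleR_zero_right)
  from has_derivative_zero_unique[OF convex_UNIV this UNIV_I UNIV_I, of t 0]
  show ?thesis using 0 by simp
qed

lemma bounded_ode_exists:
  fixes B :: "'h::banach \<Rightarrow> 'h"
  assumes B: "bounded_linear B"
  shows "\<exists>y. y 0 = f \<and> (\<forall>t. (y has_vector_derivative B (y t)) (at t))"
proof -
  interpret B: bounded_linear B by (rule B)
  obtain K where K: "K > 0" "\<And>x. norm (B x) \<le> norm x * K" using B.pos_bounded by blast
  have pow: "norm ((B ^^ i) f) \<le> K ^ i * norm f" for i
  proof (induction i)
    case (Suc i)
    have "norm (B ((B ^^ i) f)) \<le> norm ((B ^^ i) f) * K" by (rule K)
    also have "\<dots> \<le> (K ^ i * norm f) * K" using Suc K(1) by (intro mult_right_mono) auto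
    finally show ?case by (simp add: algebra_simps)
  qed simp
  \<comment> \<open>The terms of the exponential series exp(x B) f.\<close>
  define p where "p i x = (x ^ i / fact i) *\<^sub>R (B ^^ i) f" for i and x :: real
  define y where "y x = (\<Sum>i. p i x)" for x
  have unif: "uniform_limit {-r<..<r} (\<lambda>n x. \<Sum>i<n. p i x) y sequentially" for r
    unfolding y_def
  proof (rule Weierstrass_m_test)
    fix i x assume x: "x \<in> {-r<..<r}"
    have "norm (p i x) \<le> (r ^ i / fact i) * (K ^ i * norm f)"
      unfolding p_def using x pow[of i]
      by (auto simp: power_abs abs_mult intro!: mult_mono divide_right_mono power_mono)
    then show "norm (p i x) \<le> (inverse (fact i) * (r * K) ^ i) * norm f"
      by (simp add: power_mult_distrib divide_inverse algebra_simps)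
  qed (intro summable_mult2 summable_exp)
  have "(y has_vector_derivative B (y t)) (at t)" for t
  proof -
    define S where "S = {-(\<bar>t\<bar>+1)<..<\<bar>t\<bar>+1}"
    have t: "t \<in> S" by (auto simp: S_def)
    have sums: "(\<lambda>i. p i x) sums y x" if "x \<in> S" for x
      using tendsto_uniform_limitI[OF unif[of "\<bar>t\<bar>+1"]] that by (simp add: sums_def S_def)
    have "\<exists>g. \<forall>x\<in>S. (\<lambda>i. p i x) sums (g x) \<and> (g has_derivative (\<lambda>h. h *\<^sub>R B (y x))) (at x within S)"
    proof (rule has_derivative_series)
      show "(p n has_derivative (\<lambda>h. h *\<^sub>R ((real n * x ^ (n - 1) / fact n) *\<^sub>R (B ^^ n) f))) (at
          x within S)" for n x
        unfolding p_def
        by (auto intro!: derivative_eq_intros simp: fun_eq_iff)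
      fix e :: real assume e: "0 < e"
      then have "\<forall>\<^sub>F n in sequentially. \<forall>x\<in>S. dist (\<Sum>i<n. p i x) (y x) < e / K"
        using K(1) unif[of "\<bar>t\<bar>+1"] unfolding S_def uniform_limit_iff by (meson divide_pos_pos)
      then obtain N where N: "\<And>n x. n \<ge> N \<Longrightarrow> x \<in> S \<Longrightarrow> norm ((\<Sum>i<n. p i x) - y x) < e / K"
        unfolding eventually_sequentially dist_norm by blast
      show "\<forall>\<^sub>F n in sequentially. \<forall>x\<in>S. \<forall>h.
          norm ((\<Sum>i<n. h *\<^sub>R ((real i * x ^ (i - 1) / fact i) *\<^sub>R (B ^^ i) f)) - h *\<^sub>R B (y x))
              \<le> e * norm h"
        unfolding eventually_sequentially
      \<comment> \<open>One index beyond N: differentiation lowers the degree, so the derivative of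
        a sum of n terms is \<open>B\<close> applied to a sum of n - 1 terms.\<close>
      proof (intro exI[of _ "Suc N"] allI impI ballI)
        fix n x h assume n: "Suc N \<le> n" and x: "x \<in> S"
        then obtain m where m: "n = Suc m" "N \<le> m" by (cases n) auto
        have "(\<Sum>i<n. (real i * x ^ (i - 1) / fact i) *\<^sub>R (B ^^ i) f) = (\<Sum>i<m. B (p i x))"
          unfolding m(1) sum.lessThan_Suc_shift
          by (simp add: p_def B.scaleR fact_Suc del: of_nat_Suc cong: sum.cong)
        also have "\<dots> = B (\<Sum>i<m. p i x)" by (simp add: B.sum)
        finally have "(\<Sum>i<n. h *\<^sub>R ((real i * x ^ (i - 1) / fact i) *\<^sub>R (B ^^ i) f)) - h *\<^sub>R B (y x)
            = h *\<^sub>R B ((\<Sum>i<m. p i x) - y x)"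
          by (simp add: scaleR_sum_right[symmetric] scaleR_diff_right B.diff del: scaleR_scaleR)
        also have "norm \<dots> \<le> \<bar>h\<bar> * (norm ((\<Sum>i<m. p i x) - y x) * K)"
          by (simp add: K(2) mult_left_mono)
        also have "\<dots> \<le> \<bar>h\<bar> * (e / K * K)"
          using N[OF m(2) x] K(1) by (intro mult_left_mono mult_right_mono) auto
        finally show "norm ((\<Sum>i<n. h *\<^sub>R ((real i * x ^ (i - 1) / fact i) *\<^sub>R (B ^^ i) f)) - h *\<^sub>R
            B (y x)) \<le> e * norm h"
          using K(1) by (simp add: mult.commute)
      qed
    qed (use t sums S_def in auto)
    then obtain g where g: "\<And>x. x \<in> S \<Longrightarrow> (\<lambda>i. p i x) sums (g x)"
      "\<And>x. x \<in> S \<Longrightarrow> (g has_derivative (\<lambda>h. h *\<^sub>R B (y x))) (at x within S)" by blast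
    have "g x = y x" if "x \<in> S" for x using g(1) sums that sums_unique2 by blast
    then have "(y has_derivative (\<lambda>h. h *\<^sub>R B (y t))) (at t within S)"
      using g(2)[OF t] has_derivative_transform[OF t, of y g] by metis
    then show ?thesis
      using at_within_open[OF t] by (simp add: has_vector_derivative_def S_def)
  qed
  moreover have "y 0 = f"
  proof -
    have "p i 0 = 0" if "i \<notin> {0}" for i using that by (simp add: p_def)
    from sums_finite[OF _ this, of "{0}"] have "(\<lambda>i. p i 0) sums p 0 0" by simp
    then show ?thesis by (simp add: y_def sums_iff p_def)
  qed
  ultimately show ?thesis by blast
qed

text \<open>Conservation of the norm comes from skewness, the group law and the commutation property
  from uniqueness for the differential equation. Commutation is what allows the flows of different
  Yosida approximations to be compared in Stone's theorem.\<close>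

lemma bounded_skew_group:
  fixes B :: "'h::{real_inner,banach} \<Rightarrow> 'h"
  assumes B: "bounded_linear B" and skew: "\<And>f. f \<bullet> B f = 0"
  obtains U where "ortho_group U"
    "\<And>f t. ((\<lambda>t. U t f) has_vector_derivative B (U t f)) (at t)"
    "\<And>C f t. bounded_linear C \<Longrightarrow> (\<And>f. C (B f) = B (C f)) \<Longrightarrow> C (U t f) = U t (C f)"
proof -
  interpret B: bounded_linear B by (rule B)
  have lin: "linear B" by (rule bounded_linear.linear[OF B])
  obtain U where U0: "\<And>f. U f 0 = f"
    and U: "\<And>f t. ((\<lambda>t. U f t) has_vector_derivative B (U f t)) (at t)"
    using bounded_ode_exists[OF B] by metis
  have uniq: "U f t = z t" if "\<And>t. (z has_vector_derivative B (z t)) (at t)" "z 0 = f" for f z t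
    by (rule skew_ode_unique[OF lin skew U that(1)]) (simp add: that(2) U0)
  have com: "C (U f t) = U (C f) t" if C: "bounded_linear C" "\<And>f. C (B f) = B (C f)" for C f t
    by (rule uniq[symmetric]) (use bounded_linear.has_vector_derivative[OF C(1) U] in \<open>simp_all
        add: C(2) U0\<close>)
  have "ortho_group (\<lambda>t f. U f t)"
  proof
    fix f g s t and r :: real
    show "U (f + g) t = U f t + U g t"
      by (rule uniq) (use has_vector_derivative_add[OF U U] in \<open>simp_all add: B.add U0\<close>)
    show "U (r *\<^sub>R f) t = r *\<^sub>R U f t"
      using com[of "(*\<^sub>R) r"] by (simp add: B.scaleR bounded_linear_scaleR_right)
    show "U f 0 = f" by (rule U0)
    have "((\<lambda>r. r + t) has_vector_derivative 1) (at r)" for r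
      by (auto intro!: derivative_eq_intros)
    from vector_diff_chain_at[OF this U[of f]]
    have "((\<lambda>s. U f (s + t)) has_vector_derivative B (U f (s + t))) (at s)" for s
      by (simp add: o_def)
    then show "U f (s + t) = U (U f t) s"
      by (intro uniq[symmetric, where z = "\<lambda>s. U f (s + t)"]) simp_all
    show "continuous_on UNIV (U f)"
      using U[of f] has_vector_derivative_continuous continuous_at_imp_continuous_on by blast
    have "((\<lambda>t. U f t \<bullet> U f t) has_vector_derivative (U f t \<bullet> B (U f t) + B (U f t) \<bullet> U f t)) (at
        t)" for t
      by (intro bounded_bilinear.has_vector_derivative[OF bounded_bilinear_inner] U)
    then have "((\<lambda>t. U f t \<bullet> U f t) has_derivative (\<lambda>h. 0)) (at t within UNIV)" for t
      by (simp only: skew inner_commute[of "B _"] has_vector_derivative_def add_0 scaleR_zero_right)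
    from has_derivative_zero_unique[OF convex_UNIV this UNIV_I UNIV_I, of t 0]
    show "norm (U f t) = norm f" by (simp add: U0 norm_eq_sqrt_inner)
  qed
  then show ?thesis using U com by (intro that[of "\<lambda>t f. U f t"]) auto
qed

section \<open>Stone's theorem on real Hilbert spaces\<close>

lemma norm_triangle3: "norm (a + b + c) \<le> norm a + norm b + norm c"
  using norm_triangle_ineq[of "a + b" c] norm_triangle_ineq[of a b] by linarith

lemma divide_Suc_mult_le:
  fixes e k x :: real
  assumes "0 < e" "0 < k" "0 \<le> x"
  shows "e / (k * (x + 1)) * x \<le> e / k"
proof -
  have "e / (k * (x + 1)) * x \<le> e / (k * (x + 1)) * (x + 1)"
    using assms by (intro mult_left_mono) auto
  also have "\<dots> = e / k" using assms by simp
  finally show ?thesis .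
qed

text \<open>The range criterion for skew-adjointness: \<open>1 - r A\<close> is onto for small r of
  both signs. Only small r are asked for, because a bounded perturbation preserves the condition
  with a smaller bound \<open>c\<close>.\<close>

locale skew_adjoint =
  fixes A :: "('h::{real_inner,banach} \<times> 'h) set" and c :: real
  assumes subspace: "subspace A"
    and skew: "(f, g) \<in> A \<Longrightarrow> f \<bullet> g = 0"
    and single: "(0, g) \<in> A \<Longrightarrow> g = 0"
    and c: "0 < c"
    and surj: "r \<noteq> 0 \<Longrightarrow> \<bar>r\<bar> < c \<Longrightarrow> \<exists>f h. (f, h) \<in> A \<and> f - r *\<^sub>R h = g"
begin

abbreviation small :: "real \<Rightarrow> bool" where
  "small r \<equiv> r \<noteq> 0 \<and> \<bar>r\<bar> < c"

text \<open>The resolvent (1 - r A)^(-1), a contraction that tends strongly to the identity as r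
  tends to 0.\<close>

definition R :: "real \<Rightarrow> 'h \<Rightarrow> 'h" where
  "R r g = (THE f. \<exists>h. (f, h) \<in> A \<and> f - r *\<^sub>R h = g)"

lemma A_add: "(f, g) \<in> A \<Longrightarrow> (f', g') \<in> A \<Longrightarrow> (f + f', g + g') \<in> A"
  using subspace_add[OF subspace, of "(f, g)" "(f', g')"] by simp

lemma A_diff: "(f, g) \<in> A \<Longrightarrow> (f', g') \<in> A \<Longrightarrow> (f - f', g - g') \<in> A"
  using subspace_diff[OF subspace, of "(f, g)" "(f', g')"] by simp

lemma A_scale: "(f, g) \<in> A \<Longrightarrow> (a *\<^sub>R f, a *\<^sub>R g) \<in> A"
  using subspace_scale[OF subspace, of "(f, g)" a] by simp

lemma norm_resolvent:
  assumes "(f, h) \<in> A"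
  shows "(norm (f - r *\<^sub>R h))\<^sup>2 = (norm f)\<^sup>2 + r\<^sup>2 * (norm h)\<^sup>2"
  unfolding power2_norm_eq_inner using skew[OF assms]
  by (simp add: inner_diff inner_commute[of h f]) (simp add: power2_eq_square)

lemma R_eq:
  assumes f: "(f, h) \<in> A"
  shows "R r (f - r *\<^sub>R h) = f"
  unfolding R_def
proof (rule the_equality)
  show "\<exists>h'. (f, h') \<in> A \<and> f - r *\<^sub>R h' = f - r *\<^sub>R h" using f by blast
  fix f' assume "\<exists>h'. (f', h') \<in> A \<and> f' - r *\<^sub>R h' = f - r *\<^sub>R h"
  then obtain h' where h': "(f', h') \<in> A" "f' - r *\<^sub>R h' = f - r *\<^sub>R h" by blast
  have "(f' - f) - r *\<^sub>R (h' - h) = 0" using h'(2) by (simp add: algebra_simps)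
  then have "(norm (f' - f))\<^sup>2 + r\<^sup>2 * (norm (h' - h))\<^sup>2 = 0"
    using norm_resolvent[OF A_diff[OF h'(1) f], of r] by simp
  then have "(norm (f' - f))\<^sup>2 = 0"
    by (simp add: add_nonneg_eq_0_iff)
  then show "f' = f" by simp
qed

lemma R_graph:
  assumes "small r"
  obtains h where "(R r g, h) \<in> A" "R r g - r *\<^sub>R h = g"
proof -
  obtain f h where f: "(f, h) \<in> A" "f - r *\<^sub>R h = g" using surj assms by blast
  then have "R r g = f" using R_eq[OF f(1), of r] by simp
  with f show ?thesis by (intro that) auto
qed

lemma norm_R: "small r \<Longrightarrow> norm (R r g) \<le> norm g"
proof -
  assume "small r"
  then obtain h where h: "(R r g, h) \<in> A" "R r g - r *\<^sub>R h = g" by (rule R_graph)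
  have "(norm g)\<^sup>2 = (norm (R r g))\<^sup>2 + r\<^sup>2 * (norm h)\<^sup>2"
    using norm_resolvent[OF h(1), of r, unfolded h(2)] .
  then have "(norm (R r g))\<^sup>2 \<le> (norm g)\<^sup>2"
    by (metis le_add_same_cancel1 mult_nonneg_nonneg zero_le_power2)
  then show ?thesis by (rule power2_le_imp_le) simp
qed

lemma bounded_linear_R: assumes r: "small r" shows "bounded_linear (R r)"
proof (rule bounded_linear_intro[where K = 1])
  fix g g' :: 'h and a :: real
  obtain h where h: "(R r g, h) \<in> A" "R r g - r *\<^sub>R h = g" by (rule R_graph[OF r])
  obtain h' where h': "(R r g', h') \<in> A" "R r g' - r *\<^sub>R h' = g'" by (rule R_graph[OF r])
  have "R r g + R r g' - r *\<^sub>R (h + h') = (R r g - r *\<^sub>R h) + (R r g' - r *\<^sub>R h')"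
    by (simp add: scaleR_add_right)
  note * = this[unfolded h(2) h'(2)]
  show "R r (g + g') = R r g + R r g'" using R_eq[OF A_add[OF h(1) h'(1)], of r] unfolding * .
  have "a *\<^sub>R R r g - r *\<^sub>R a *\<^sub>R h = a *\<^sub>R (R r g - r *\<^sub>R h)"
    by (simp add: scaleR_diff_right mult.commute)
  note * = this[unfolded h(2)]
  show "R r (a *\<^sub>R g) = a *\<^sub>R R r g" using R_eq[OF A_scale[OF h(1)], of r a] unfolding * .
qed (use norm_R[OF r] in simp)

lemma R_adjoint:
  assumes r: "small r"
  shows "R r g \<bullet> g' = g \<bullet> R (- r) g'"
proof -
  obtain h where h: "(R r g, h) \<in> A" "R r g - r *\<^sub>R h = g" by (rule R_graph[OF r])
  have "small (- r)" using r by simp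
  then obtain h' where h': "(R (- r) g', h') \<in> A" "R (- r) g' - (- r) *\<^sub>R h' = g'"
    by (rule R_graph)
  have "(R r g + R (-r) g') \<bullet> (h + h') = 0" by (rule skew[OF A_add[OF h(1) h'(1)]])
  then have *: "R r g \<bullet> h' = - (h \<bullet> R (-r) g')"
    using skew[OF h(1)] skew[OF h'(1)] by (simp add: inner_add inner_commute)
  have "R r g \<bullet> g' = R r g \<bullet> (R (- r) g' + r *\<^sub>R h')" using h'(2) by simp
  also have "\<dots> = (R r g - r *\<^sub>R h) \<bullet> R (- r) g'"
    using * by (simp add: inner_add inner_diff)
  finally show ?thesis using h(2) by simp
qed

text \<open>For \<open>f = R r (R s g)\<close> the vector A f is a multiple of
  \<open>f - R s g\<close> and so lies in the domain again. Both orders therefore solve the same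
  equation (1 - s A)(1 - r A) f = g.\<close>

lemma R_commute:
  assumes r: "small r" and s: "small s"
  shows "R r (R s g) = R s (R r g)"
proof -
  have False: "r \<noteq> 0" using r by simp
  define f where "f = R r (R s g)"
  obtain h1 where h1: "(R s g, h1) \<in> A" "R s g - s *\<^sub>R h1 = g" by (rule R_graph[OF s])
  obtain h where h: "(f, h) \<in> A" "f - r *\<^sub>R h = R s g" unfolding f_def by (rule R_graph[OF r])
  define k where "k = inverse r *\<^sub>R (h - h1)"
  have rk: "r *\<^sub>R k = h - h1" using False by (simp add: k_def)
  have "r *\<^sub>R h = f - R s g" using h(2) by (simp add: algebra_simps)
  then have "h = inverse r *\<^sub>R (f - R s g)"
    using False by (metis scaleR_scaleR left_inverse scaleR_one)
  then have hk: "(h, k) \<in> A" unfolding k_def using A_scale[OF A_diff[OF h(1) h1(1)]] by metis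
  have "(f - s *\<^sub>R h) - r *\<^sub>R (h - s *\<^sub>R k) = (f - r *\<^sub>R h) - s *\<^sub>R (h - r *\<^sub>R k)"
    by (simp add: algebra_simps)
  also have "\<dots> = g" using h(2) h1(2) by (simp add: rk)
  finally have "R r g = f - s *\<^sub>R h"
    using R_eq[OF A_diff[OF h(1) A_scale[OF hk]], of r s] by simp
  then have "R s (R r g) = f" using R_eq[OF h(1)] by simp
  then show ?thesis by (simp add: f_def)
qed

lemma R_generator:
  assumes f: "(f, h) \<in> A" and r: "small r"
  shows "R r f - f = r *\<^sub>R R r h" "(R r f, R r h) \<in> A"
proof -
  interpret R: bounded_linear "R r" by (rule bounded_linear_R[OF r])
  have "f = R r (f - r *\<^sub>R h)" by (rule R_eq[OF f, symmetric])
  then have "f = R r f - r *\<^sub>R R r h" by (simp only: R.diff R.scaleR)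
  then show 1: "R r f - f = r *\<^sub>R R r h" by (simp add: algebra_simps)
  show "(R r f, R r h) \<in> A"
  proof -
    have False: "r \<noteq> 0" using r by simp
    obtain k where k: "(R r f, k) \<in> A" "R r f - r *\<^sub>R k = f" by (rule R_graph[OF r])
    then have "r *\<^sub>R k = r *\<^sub>R R r h" using 1 by (simp add: algebra_simps)
    then show ?thesis using k(1) False by simp
  qed
qed

lemma R_intertwine:
  assumes C: "linear C" and CA: "\<And>f g. (f, g) \<in> A \<Longrightarrow> (C f, C g) \<in> A" and r: "small r"
  shows "R r (C g) = C (R r g)"
proof -
  obtain h where h: "(R r g, h) \<in> A" "R r g - r *\<^sub>R h = g" by (rule R_graph[OF r])
  have "C (R r g) - r *\<^sub>R C h = C (R r g - r *\<^sub>R h)"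
    by (simp add: linear_scale[OF C] linear_diff[OF C])
  also have "\<dots> = C g" by (simp only: h(2))
  finally show ?thesis using R_eq[OF CA[OF h(1)], of r] by simp
qed

text \<open>If v is orthogonal to the domain, pairing v = (1 - r A) R v with R v leaves only the
  squared norm of R v, by skewness.\<close>

lemma dense: "closure (Domain A) = UNIV"
proof (rule dense_subspaceI)
  have "subspace (fst ` A)" using linear_fst subspace by (rule linear_subspace_image)
  then show "subspace (Domain A)" by (simp add: Domain_fst)
  fix v assume v: "\<And>s. s \<in> Domain A \<Longrightarrow> v \<bullet> s = 0"
  have r: "small (c / 2)" using c by simp
  obtain h where h: "(R (c/2) v, h) \<in> A" "R (c/2) v - (c/2) *\<^sub>R h = v" by (rule R_graph[OF r])
  have "v \<bullet> R (c/2) v = 0" by (rule v) (use h(1) in blast)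
  then have "(R (c/2) v - (c/2) *\<^sub>R h) \<bullet> R (c/2) v = 0" by (simp only: h(2))
  moreover have "h \<bullet> R (c/2) v = 0" using skew[OF h(1)] by (simp add: inner_commute)
  ultimately have 0: "R (c/2) v = 0" by (simp add: inner_diff_left)
  have "h = 0" using h(1) unfolding 0 by (rule single)
  then show "v = 0" using h(2) unfolding 0 by simp
qed

text \<open>On the domain the error is \<open>r *\<^sub>R R r h\<close>, of order r; contractivity
  carries the convergence to the closure.\<close>

lemma R_tendsto: "((\<lambda>r. R r f) \<longlongrightarrow> f) (at 0)"
proof (rule tendstoI)
  fix e :: real assume e: "0 < e"
  have "f \<in> closure (Domain A)" using dense by simp
  then obtain f' where f': "f' \<in> Domain A" "dist f' f < e / 3"
    using e by (metis closure_approachable divide_pos_pos zero_less_numeral)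
  then obtain h where h: "(f', h) \<in> A" by (auto simp: Domain_iff)
  define d where "d = min c (e / (3 * (norm h + 1)))"
  have "0 < d" using c e by (simp add: d_def add_nonneg_pos)
  have "dist (R r f) f < e" if r: "r \<noteq> 0" "\<bar>r\<bar> < d" for r
  proof -
    have rc: "small r" using r by (simp add: d_def)
    interpret R: bounded_linear "R r" by (rule bounded_linear_R[OF rc])
    have "norm (R r f' - f') \<le> \<bar>r\<bar> * norm h"
      using R_generator(1)[OF h rc] norm_R[OF rc, of h] by (simp add: mult_left_mono)
    also have "\<dots> \<le> (e / (3 * (norm h + 1))) * norm h"
      using r by (intro mult_right_mono) (auto simp: d_def)
    also have "\<dots> \<le> e / 3"
      using e by (intro divide_Suc_mult_le) auto
    finally have 1: "norm (R r f' - f') \<le> e / 3" .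
    have 2: "norm (R r (f - f')) < e / 3"
      using norm_R[OF rc, of "f - f'"] f'(2) by (simp add: dist_norm norm_minus_commute)
    have "R r f - f = R r (f - f') + (R r f' - f') + (f' - f)" by (simp add: R.diff)
    then have "norm (R r f - f) \<le> norm (R r (f - f')) + norm (R r f' - f') + norm (f' - f)"
      by (metis norm_triangle3)
    then show ?thesis using 1 2 f'(2) by (simp add: dist_norm)
  qed
  then show "\<forall>\<^sub>F r in at 0. dist (R r f) f < e"
    unfolding eventually_at using \<open>0 < d\<close> by (auto simp: dist_real_def)
qed

text \<open>
  This is \<open>A (1 - r\<^sup>2 A\<^sup>2)\<^sup>-\<^sup>1\<close>; unlike the usual approximation \<open>A (1 - r A)\<^sup>-\<^sup>1\<close> it is skew.
\<close>

definition yosida :: "real \<Rightarrow> 'h \<Rightarrow> 'h" where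
  "yosida r g = inverse (2 * r) *\<^sub>R (R r g - R (- r) g)"

lemma bounded_linear_yosida:
  assumes r: "small r" shows "bounded_linear (yosida r)"
proof -
  have "small (- r)" using r by simp
  from bounded_linear_sub[OF bounded_linear_R[OF r] bounded_linear_R[OF this]]
  show ?thesis
    unfolding yosida_def[abs_def] by (rule bounded_linear_compose[OF bounded_linear_scaleR_right])
qed

lemma yosida_skew: "small r \<Longrightarrow> g \<bullet> yosida r g = 0"
  using R_adjoint[of r g g] by (simp add: yosida_def inner_diff inner_commute)

lemma yosida_commute:
  assumes r: "small r" and s: "small s"
  shows "yosida r (yosida s g) = yosida s (yosida r g)"
proof -
  have *: "small (- r)" "small (- s)" using r s by auto
  interpret a: bounded_linear "R r" by (rule bounded_linear_R[OF r])
  interpret b: bounded_linear "R s" by (rule bounded_linear_R[OF s])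
  interpret a': bounded_linear "R (- r)" by (rule bounded_linear_R[OF *(1)])
  interpret b': bounded_linear "R (- s)" by (rule bounded_linear_R[OF *(2)])
  show ?thesis
    unfolding yosida_def a.scaleR a.diff b.scaleR b.diff a'.scaleR a'.diff b'.scaleR b'.diff
      R_commute[OF s r] R_commute[OF s *(1)] R_commute[OF *(2) r] R_commute[OF *(2) *(1)]
    by (simp add: algebra_simps)
qed

lemma yosida_eq:
  assumes f: "(f, h) \<in> A" and r: "small r"
  shows "yosida r f = (1/2) *\<^sub>R (R r h + R (- r) h)"
proof -
  have "R r f - R (- r) f = r *\<^sub>R (R r h + R (- r) h)"
    using R_generator(1)[OF f r] R_generator(1)[OF f, of "- r"] r
    by (simp add: algebra_simps)
  then show ?thesis using r by (simp add: yosida_def)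
qed

end

text \<open>The bounded approximations commute, which makes their groups a Cauchy sequence on the
  domain of A. That the generator of the limit contains A is an estimate; that it is no larger is
  the maximality of a skew operator for which \<open>1 - r A\<close> is onto.\<close>

theorem (in skew_adjoint) stone:
  obtains U where "ortho_group U" "generator U = A"
proof -
  define rr where "rr n = c / (real n + 2)" for n
  have rr: "small (rr n)" for n
    using c by (auto simp: rr_def field_simps add_pos_nonneg)
  have rr_lim: "rr \<longlonglongrightarrow> 0"
    unfolding rr_def using tendsto_divide_0[OF tendsto_const[of c]
        filterlim_at_top_imp_at_infinity[OF filterlim_tendsto_add_at_top[OF tendsto_const[of 2]
            filterlim_real_sequentially]]]
    by (simp add: add.commute)
  then have rr_at: "filterlim rr (at 0) sequentially"
    using rr by (simp add: filterlim_at)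
  define B where "B n = yosida (rr n)" for n
  have B: "bounded_linear (B n)" "f \<bullet> B n f = 0" "B n (B m f) = B m (B n f)" for n m f
    using rr by (simp_all add: B_def bounded_linear_yosida yosida_skew yosida_commute)
  have B_lim: "(\<lambda>n. B n f) \<longlonglongrightarrow> h" if f: "(f, h) \<in> A" for f h
  proof -
    have "(\<lambda>n. R (rr n) h) \<longlonglongrightarrow> h" by (rule filterlim_compose[OF R_tendsto rr_at])
    moreover have "filterlim (\<lambda>n. - rr n) (at 0) sequentially"
      using tendsto_minus[OF rr_lim] rr by (simp add: filterlim_at)
    then have "(\<lambda>n. R (- rr n) h) \<longlonglongrightarrow> h" by (rule filterlim_compose[OF R_tendsto])
    ultimately have "(\<lambda>n. (1/2) *\<^sub>R (R (rr n) h + R (- rr n) h)) \<longlonglongrightarrow> (1/2) *\<^sub>R (h + h)"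
      by (intro tendsto_intros)
    moreover have "(1/2) *\<^sub>R (h + h) = h" by (simp flip: scaleR_2)
    ultimately show ?thesis unfolding B_def yosida_eq[OF f rr] by simp
  qed
  have "\<exists>V. ortho_group V \<and> (\<forall>f t. ((\<lambda>t. V t f) has_vector_derivative B n (V t f)) (at t))
      \<and> (\<forall>C f t. bounded_linear C \<longrightarrow> (\<forall>f. C (B n f) = B n (C f)) \<longrightarrow> C (V t f) = V t (C f))" for n
    using bounded_skew_group[OF B(1)[of n] B(2)[of _ n]] by metis
  then obtain V where V: "\<And>n. ortho_group (V n)"
    and dV: "\<And>n f t. ((\<lambda>t. V n t f) has_vector_derivative B n (V n t f)) (at t)"
    and cV: "\<And>n C f t. bounded_linear C \<Longrightarrow> (\<And>f. C (B n f) = B n (C f)) \<Longrightarrow> C (V n t f) = V n t (C f)"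
    by metis
  interpret V: ortho_group "V n" for n by (rule V)
  have gV: "(f, B n f) \<in> generator (V n)" for f n
    using dV[of n f 0] by (simp add: generator_def)
  \<comment> \<open>\<open>B n\<close> and \<open>B m\<close> commute with the flow of
    \<open>B m\<close>, so the derivative of \<open>V n (- s) (V m s f)\<close> is an isometric
    image of \<open>B m f - B n f\<close>, whose norm does not depend on s.\<close>
  have diff: "norm (V n t f - V m t f) \<le> \<bar>t\<bar> * norm (B n f - B m f)" for n m t f
  proof -
    have "norm (V n (- 1 * t) (V m t f) - V n (- 1 * 0) (V m 0 f) - (t - 0) *\<^sub>R 0)
        \<le> \<bar>t - 0\<bar> * norm (B n f - B m f)"
    proof (rule vector_derivative_bound[OF V.has_vector_derivative[OF dV gV]])
      fix s
      have "(- 1) *\<^sub>R V n (- 1 * s) (B n (V m s f)) + V n (- 1 * s) (B m (V m s f)) - 0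
          = V n (- 1 * s) (V m s (B m f - B n f))"
        using cV[where C = "B n" and n = m and f = f and t = s] cV[where C = "B m" and n = m and f
            = f and t = s]
          B(1,3) by (simp add: V.bl_simps)
      then show "norm ((- 1) *\<^sub>R V n (- 1 * s) (B n (V m s f)) + V n (- 1 * s) (B m (V m s f)) - 0)
          \<le> norm (B n f - B m f)"
        by (simp add: norm_minus_commute)
    qed
    moreover have "V n (- t) (V m t f) - f = V n (- t) (V m t f - V n t f)"
      by (simp add: V.bl_simps)
    ultimately show ?thesis by (simp add: norm_minus_commute)
  qed
  have conv: "convergent (\<lambda>n. V n t f)" for t f
  proof (rule Cauchy_convergent, rule metric_CauchyI)
    fix e :: real assume e: "0 < e"
    have "f \<in> closure (Domain A)" using dense by simp
    then obtain f' where f': "f' \<in> Domain A" "dist f' f < e / 4"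
      using e by (metis closure_approachable divide_pos_pos zero_less_numeral)
    then obtain h where h: "(f', h) \<in> A" by (auto simp: Domain_iff)
    have "Cauchy (\<lambda>n. B n f')" using B_lim[OF h] by (rule LIMSEQ_imp_Cauchy)
    moreover have "0 < e / (2 * (\<bar>t\<bar> + 1))" using e by (simp add: add_nonneg_pos)
    ultimately obtain N where N: "\<And>m n. N \<le> m \<Longrightarrow> N \<le> n \<Longrightarrow> norm (B m f' - B n f') < e / (2 * (\<bar>t\<bar> +
        1))"
      unfolding Cauchy_iff by blast
    show "\<exists>N. \<forall>m\<ge>N. \<forall>n\<ge>N. dist (V m t f) (V n t f) < e"
    proof (intro exI allI impI)
      fix m n assume mn: "N \<le> m" "N \<le> n"
      have "norm (V m t f' - V n t f') \<le> \<bar>t\<bar> * (e / (2 * (\<bar>t\<bar> + 1)))"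
        using diff[where t = t and f = f' and n = m and m = n] N[OF mn]
            by (meson mult_left_mono abs_ge_zero less_imp_le order_trans)
      also have "\<dots> \<le> e / 2"
        using divide_Suc_mult_le[of e 2 "\<bar>t\<bar>"] e by (simp add: mult.commute)
      finally have 1: "norm (V m t f' - V n t f') \<le> e / 2" .
      have "V m t f - V n t f = V m t (f - f') + (V m t f' - V n t f') + V n t (f' - f)"
        by (simp add: V.bl_simps)
      then have "norm (V m t f - V n t f) \<le> norm (f - f') + norm (V m t f' - V n t f') + norm (f'
          - f)"
        by (metis norm_triangle3 V.norm)
      then show "dist (V m t f) (V n t f) < e"
        using 1 f'(2) by (simp add: dist_norm norm_minus_commute)
    qed
  qed
  define U where "U t f = lim (\<lambda>n. V n t f)" for t f
  have U: "(\<lambda>n. V n t f) \<longlonglongrightarrow> U t f" for t f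
    using conv by (simp add: U_def convergent_LIMSEQ_iff)
  have U_add: "U t (f + g) = U t f + U t g" for t f g
    by (rule LIMSEQ_unique[OF U]) (use tendsto_add[OF U[of t f] U[of t g]] in \<open>simp add:
        V.bl_simps\<close>)
  have U_scale: "U t (a *\<^sub>R g) = a *\<^sub>R U t g" for t a g
    by (rule LIMSEQ_unique[OF U]) (use tendsto_scaleR[OF tendsto_const U[of t g]] in \<open>simp add:
        V.bl_simps\<close>)
  have U_lin: "linear (U t)" for t by (rule linearI) (simp_all add: U_add U_scale)
  have U_norm: "norm (U t f) = norm f" for t f
    by (rule LIMSEQ_unique[OF tendsto_norm[OF U]]) simp
  have VB: "B n (V n t f) = V n t (B n f)" for n t f by (rule cV[OF B(1)]) simp
  \<comment> \<open>The vector \<open>h\<close> need not lie in the domain of A, so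
    \<open>B n h\<close> is not controlled. A nearby \<open>h'\<close> in the domain takes its
    place, for which \<open>B n h'\<close> converges to \<open>k\<close>.\<close>
  have U_est: "norm (U t f - f - t *\<^sub>R h) \<le> \<bar>t\<bar> * (2 * norm (h - h') + \<bar>t\<bar> * norm k)"
    if f: "(f, h) \<in> A" and h: "(h', k) \<in> A" for t f h h' k
  proof (rule LIMSEQ_le)
    show "(\<lambda>n. norm (V n t f - f - t *\<^sub>R B n f)) \<longlonglongrightarrow> norm (U t f - f - t *\<^sub>R h)"
      by (intro tendsto_intros U B_lim f)
    show "(\<lambda>n. \<bar>t\<bar> * (2 * norm (B n f - h') + \<bar>t\<bar> * norm (B n h')))
        \<longlonglongrightarrow> \<bar>t\<bar> * (2 * norm (h - h') + \<bar>t\<bar> * norm k)"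
      by (intro tendsto_intros B_lim f h)
    have "norm (V n t f - V n 0 f - (t - 0) *\<^sub>R B n f) \<le> \<bar>t - 0\<bar> * (2 * norm (B n f - h') + \<bar>t\<bar> *
        norm (B n h'))" for n
    proof (rule vector_derivative_bound[OF dV])
      fix s assume "s \<in> closed_segment 0 t"
      then have s: "\<bar>s\<bar> \<le> \<bar>t\<bar>" by (auto simp: closed_segment_eq_real_ivl split: if_splits)
      have "norm (V n s h' - V n 0 h' - (s - 0) *\<^sub>R 0) \<le> \<bar>s - 0\<bar> * norm (B n h')"
        by (rule vector_derivative_bound[OF dV]) (simp add: VB)
      also have "\<dots> \<le> \<bar>t\<bar> * norm (B n h')" using s by (intro mult_right_mono) auto
      finally have 1: "norm (V n s h' - h') \<le> \<bar>t\<bar> * norm (B n h')" by simp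
      have "B n (V n s f) - B n f = V n s (B n f - h') + (V n s h' - h') + (h' - B n f)"
        using cV[OF B(1), where n = n and f = f and t = s] by (simp add: V.bl_simps)
      then have "norm (B n (V n s f) - B n f) \<le> norm (B n f - h') + norm (V n s h' - h') + norm
          (h' - B n f)"
        by (metis norm_triangle3 V.norm)
      then show "norm (B n (V n s f) - B n f) \<le> 2 * norm (B n f - h') + \<bar>t\<bar> * norm (B n h')"
        using 1 by (simp add: norm_minus_commute)
    qed
    then show "\<exists>N. \<forall>n\<ge>N. norm (V n t f - f - t *\<^sub>R B n f)
        \<le> \<bar>t\<bar> * (2 * norm (B n f - h') + \<bar>t\<bar> * norm (B n h'))"
      by simp
  qed
  have sub: "(f, h) \<in> generator U" if f: "(f, h) \<in> A" for f h
    unfolding generator_def has_vector_derivative_iff_quotient mem_Collect_eq prod.case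
  proof (rule tendstoI)
    fix e :: real assume e: "0 < e"
    have "h \<in> closure (Domain A)" using dense by simp
    then obtain h' where h': "h' \<in> Domain A" "dist h' h < e / 4"
      using e by (metis closure_approachable divide_pos_pos zero_less_numeral)
    then obtain k where k: "(h', k) \<in> A" by (auto simp: Domain_iff)
    define d where "d = e / (2 * (norm k + 1))"
    have d: "0 < d" using e by (simp add: d_def add_nonneg_pos)
    have "dist ((U t f - U 0 f) /\<^sub>R (t - 0)) h < e" if t: "t \<noteq> 0" "\<bar>t\<bar> < d" for t
    proof -
      have "U 0 f = f" using LIMSEQ_unique[OF U[of 0 f]] by simp
      then have "(U t f - U 0 f) /\<^sub>R (t - 0) - h = (U t f - f - t *\<^sub>R h) /\<^sub>R t"
        using t(1) by (simp add: scaleR_diff_right)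
      then have "dist ((U t f - U 0 f) /\<^sub>R (t - 0)) h = norm (U t f - f - t *\<^sub>R h) / \<bar>t\<bar>"
        by (simp add: dist_norm divide_inverse_commute)
      also have "\<dots> \<le> 2 * norm (h - h') + \<bar>t\<bar> * norm k"
        using U_est[OF f k, of t] t(1) by (simp add: pos_divide_le_eq mult.commute)
      also have "\<bar>t\<bar> * norm k \<le> d * norm k" using t(2) by (intro mult_right_mono) auto
      also have "d * norm k \<le> e / 2" 
        unfolding d_def using e by (intro divide_Suc_mult_le) auto
      finally show ?thesis using h'(2) by (simp add: dist_norm norm_minus_commute)
    qed
    then show "\<forall>\<^sub>F t in at 0. dist ((U t f - U 0 f) /\<^sub>R (t - 0)) h < e"
      unfolding eventually_at using d by (auto simp: dist_real_def)
  qed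
  have og: "ortho_group U"
  proof (rule ortho_group.intro)
    show "linear (U t)" for t by (rule U_lin)
    show "norm (U t f) = norm f" for t f by (rule U_norm)
    show U0: "U 0 f = f" for f using LIMSEQ_unique[OF U[of 0 f]] by simp
    show Uadd: "U (s + t) f = U s (U t f)" for s t f
    proof (rule LIMSEQ_unique[OF U])
      have "(\<lambda>n. V n s (V n t f - U t f)) \<longlonglongrightarrow> 0"
        by (rule Lim_null_comparison[where g = "\<lambda>n. norm (V n t f - U t f)"])
          (use U[of t f] in \<open>simp_all add: tendsto_norm_zero LIM_zero\<close>)
      from tendsto_add[OF this U[of s "U t f"]]
      show "(\<lambda>n. V n (s + t) f) \<longlonglongrightarrow> U s (U t f)" by (simp add: V.add V.bl_simps)
    qed
    show "continuous_on UNIV (\<lambda>t. U t f)" for f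
      unfolding continuous_on_iff
    proof (intro ballI allI impI)
      fix t e :: real assume e: "0 < e"
      have "f \<in> closure (Domain A)" using dense by simp
      then obtain f' where f': "f' \<in> Domain A" "dist f' f < e / 4"
        using e by (metis closure_approachable divide_pos_pos zero_less_numeral)
      then obtain h where "(f', h) \<in> A" by (auto simp: Domain_iff)
      then have "isCont (\<lambda>t. U t f') 0"
        using sub has_vector_derivative_continuous unfolding generator_def by blast
      then obtain d where d: "d > 0" "\<And>s. \<bar>s\<bar> < d \<Longrightarrow> norm (U s f' - f') < e / 4"
        using e unfolding continuous_at_eps_delta by (metis U0 diff_zero dist_norm real_norm_def
            zero_less_divide_iff zero_less_numeral)
      show "\<exists>d>0. \<forall>s\<in>UNIV. dist s t < d \<longrightarrow> dist (U s f) (U t f) < e"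
      proof (intro exI conjI ballI impI)
        fix s assume "dist s t < d"
        then have "norm (U (s - t) f' - f') < e / 4" using d(2) by (simp add: dist_real_def)
        moreover have "U s f - U t f = U s (f - f') + U t (U (s - t) f' - f') + U t (f' - f)"
          by (simp add: linear_diff[OF U_lin] flip: Uadd)
        then have "norm (U s f - U t f) \<le> norm (f - f') + norm (U (s - t) f' - f') + norm (f' - f)"
          by (metis norm_triangle3 U_norm)
        ultimately show "dist (U s f) (U t f) < e"
          using e f'(2) by (simp add: dist_norm norm_minus_commute)
      qed (rule d)
    qed
  qed
  interpret U: ortho_group U by (rule og)
  \<comment> \<open>Solving \<open>f' - r h' = f - r g\<close> inside A and subtracting gives an
    element of the generator whose first entry is r times its second; skewness forces it to
    vanish.\<close>
  have "(f, g) \<in> A" if g: "(f, g) \<in> generator U" for f g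
  proof -
    define r where "r = c / 2"
    have r: "r \<noteq> 0" "\<bar>r\<bar> < c" using c by (auto simp: r_def)
    obtain f' h' where f': "(f', h') \<in> A" "f' - r *\<^sub>R h' = f - r *\<^sub>R g" using surj[OF r] by blast
    have "(f - f', g - h') \<in> generator U"
      using subspace_diff[OF U.subspace_generator g sub[OF f'(1)]] by simp
    then have *: "(f - f') \<bullet> (g - h') = 0" by (rule U.generator_skew')
    have eq: "f - f' = r *\<^sub>R (g - h')" using f'(2) by (simp add: algebra_simps)
    have "f - f' = 0" using * unfolding eq using r(1) by simp
    moreover from this have "g - h' = 0" using eq r(1) by simp
    ultimately show ?thesis using f'(1) by simp
  qed
  then have "generator U = A" using sub by auto
  with og show ?thesis by (rule that)
qed

text \<open>The equation for the perturbed resolvent is the fixed point problem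
  \<open>f = R r (g + r *\<^sub>R B f)\<close>. It is a contraction as soon as |r| K < 1, which is
  the origin of the new bound on r.\<close>

lemma (in skew_adjoint) bounded_perturbation:
  assumes B: "bounded_linear B" and skewB: "\<And>f. f \<bullet> B f = 0"
  shows "\<exists>c'. skew_adjoint {(f, g + B f) |f g. (f, g) \<in> A} c'"
proof -
  interpret B: bounded_linear B by (rule B)
  obtain K where K: "K > 0" "\<And>x. norm (B x) \<le> norm x * K" using B.pos_bounded by blast
  have "skew_adjoint {(f, g + B f) |f g. (f, g) \<in> A} (min c (1 / K))"
  proof
    show "subspace {(f, g + B f) |f g. (f, g) \<in> A}"
    proof (rule subspaceI)
      have "(0, 0) \<in> A" using subspace_0[OF subspace] by (simp add: zero_prod_def)
      then show "0 \<in> {(f, g + B f) |f g. (f, g) \<in> A}" by (force simp: zero_prod_def B.zero)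
      show "x + y \<in> {(f, g + B f) |f g. (f, g) \<in> A}"
        if xy: "x \<in> {(f, g + B f) |f g. (f, g) \<in> A}" "y \<in> {(f, g + B f) |f g. (f, g) \<in> A}" for x y
      proof -
        obtain f g f' g' where "(f, g) \<in> A" "x = (f, g + B f)" "(f', g') \<in> A" "y = (f', g' + B f')"
          using xy by blast
        then show ?thesis using A_add[of f g f' g']
          by (auto simp: B.add intro!: exI[of _ "g + g'"])
      qed
      show "a *\<^sub>R x \<in> {(f, g + B f) |f g. (f, g) \<in> A}"
        if x: "x \<in> {(f, g + B f) |f g. (f, g) \<in> A}" for a :: real and x
      proof -
        obtain f g where "(f, g) \<in> A" "x = (f, g + B f)" using x by blast
        then show ?thesis using A_scale[of f g a]
          by (auto simp: B.scaleR scaleR_add_right intro!: exI[of _ "a *\<^sub>R g"])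
      qed
    qed
    show "f \<bullet> g = 0" if "(f, g) \<in> {(f, g + B f) |f g. (f, g) \<in> A}" for f g
      using that skew skewB by (auto simp: inner_add)
    show "g = 0" if "(0, g) \<in> {(f, g + B f) |f g. (f, g) \<in> A}" for g
      using that single by (auto simp: B.zero)
    show "0 < min c (1 / K)" using c K by simp
    fix r g assume r0: "r \<noteq> 0" and r: "\<bar>r\<bar> < min c (1 / K)"
    then have rc: "small r" by simp
    have q: "0 \<le> \<bar>r\<bar> * K" "\<bar>r\<bar> * K < 1" using K r by (auto simp: field_simps)
    interpret R: bounded_linear "R r" by (rule bounded_linear_R[OF rc])
    have con: "dist (R r (g + r *\<^sub>R B x)) (R r (g + r *\<^sub>R B y)) \<le> \<bar>r\<bar> * K * dist x y" for x y
    proof -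
      have "R r (g + r *\<^sub>R B x) - R r (g + r *\<^sub>R B y) = R r (r *\<^sub>R B (x - y))"
        by (simp add: R.diff[symmetric] B.diff algebra_simps)
      then have "dist (R r (g + r *\<^sub>R B x)) (R r (g + r *\<^sub>R B y)) \<le> norm (r *\<^sub>R B (x - y))"
        using norm_R[OF rc, of "r *\<^sub>R B (x - y)"] by (simp add: dist_norm)
      also have "\<dots> \<le> \<bar>r\<bar> * (norm (x - y) * K)"
        using K(2) by (simp add: mult_left_mono)
      finally show ?thesis by (simp add: dist_norm algebra_simps)
    qed
    have "\<exists>!f. R r (g + r *\<^sub>R B f) = f"
      by (rule banach_fix_type[OF q]) (intro allI con)
    then obtain f where f: "R r (g + r *\<^sub>R B f) = f" by (rule ex1E)
    obtain h where "(f, h) \<in> A" "f - r *\<^sub>R h = g + r *\<^sub>R B f"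
      using R_graph[OF rc, of "g + r *\<^sub>R B f"] f by auto
    then have "(f, h + B f) \<in> {(f, g + B f) |f g. (f, g) \<in> A}" "f - r *\<^sub>R (h + B f) = g"
      by (auto simp: algebra_simps)
    then show "\<exists>f h. (f, h) \<in> {(f, g + B f) |f g. (f, g) \<in> A} \<and> f - r *\<^sub>R h = g" by blast
  qed
  then show ?thesis by blast
qed

section \<open>Duhamel's formula\<close>

lemma (in ortho_group) continuous_on_compose:
  assumes "continuous_on S y" "continuous_on S r"
  shows "continuous_on S (\<lambda>x. U (r x) (y x))"
  using assms unfolding continuous_on_def by (auto intro: tendsto)

lemma bounded_linear_eq_on_dense:
  assumes "bounded_linear f" "bounded_linear g" and "closure S = UNIV"
    and "\<And>x. x \<in> S \<Longrightarrow> f x = g x"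
  shows "f x = g x"
proof -
  have "closed {x. f x = g x}"
    by (intro closed_Collect_eq linear_continuous_on assms)
  then show ?thesis
    using closure_minimal[of S "{x. f x = g x}"] assms(3,4) by auto
qed

text \<open>Both sides are bounded and linear in f, so f may be taken in the domain of the generator
  of W, where the integrand is minus the derivative of \<open>U (- s) (W s f)\<close>.\<close>

lemma duhamel:
  fixes U W :: "real \<Rightarrow> 'h::{real_inner,banach} \<Rightarrow> 'h"
  assumes U: "ortho_group U" and W: "ortho_group W"
    and dense: "closure (Domain (generator W)) = UNIV"
    and B: "bounded_linear B"
    and pert: "\<And>f g. (f, g) \<in> generator W \<Longrightarrow> (f, g + B f) \<in> generator U"
    and ab: "a \<le> b"
  shows "integral {a..b} (\<lambda>s. U (- s) (B (W s f))) = U (- a) (W a f) - U (- b) (W b f)"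
proof (rule bounded_linear_eq_on_dense[OF _ _ dense,
      where f = "\<lambda>f. integral {a..b} (\<lambda>s. U (- s) (B (W s f)))"
        and g = "\<lambda>f. U (- a) (W a f) - U (- b) (W b f)"])
  interpret U: ortho_group U by (rule U)
  interpret W: ortho_group W by (rule W)
  interpret B: bounded_linear B by (rule B)
  let ?G = "\<lambda>f s. U (- s) (B (W s f))"
  have cont: "continuous_on S (?G f)" for S f
    using continuous_on_subset[OF W.continuous subset_UNIV]
    by (intro U.continuous_on_compose continuous_intros
        bounded_linear.continuous_on[OF B])
  have int: "?G f integrable_on {a..b}" for f
    using cont by (rule integrable_continuous_real)
  obtain K where K: "K > 0" "\<And>x. norm (B x) \<le> norm x * K" using B.pos_bounded by blast
  show "bounded_linear (\<lambda>f. integral {a..b} (?G f))"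
  proof (rule bounded_linear_intro[where K = "K * (b - a)"])
    show "integral {a..b} (?G (f + g)) = integral {a..b} (?G f) + integral {a..b} (?G g)" for f g
      unfolding U.bl_simps W.bl_simps B.add by (rule integral_add[OF int int])
    show "integral {a..b} (?G (r *\<^sub>R f)) = r *\<^sub>R integral {a..b} (?G f)" for f and r :: real
      unfolding U.bl_simps W.bl_simps B.scaleR by (rule integral_cmul)
    show "norm (integral {a..b} (?G f)) \<le> norm f * (K * (b - a))" for f
      using integral_bound[OF ab cont, of f "norm f * K"] K(2)[of "W _ f"] by (simp add: mult.assoc)
  qed
  show "bounded_linear (\<lambda>f. U (- a) (W a f) - U (- b) (W b f))"
    by (intro bounded_linear_sub bounded_linear_compose[OF U.bounded_linear W.bounded_linear])
  fix f assume "f \<in> Domain (generator W)"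
  then obtain g where g: "(f, g) \<in> generator W" by (rule DomainE)
  have "((\<lambda>s. U (- 1 * s) (W s f)) has_vector_derivative - ?G f s) (at s within {a..b})" for s
  proof -
    have "((\<lambda>s. U (- 1 * s) (W s f)) has_vector_derivative
        ((- 1) *\<^sub>R U (- 1 * s) (W s g + B (W s f)) + U (- 1 * s) (W s g))) (at s)"
      by (rule U.has_vector_derivative[OF W.has_vector_derivative_orbit[OF g]])
        (rule pert[OF W.generator_orbit[OF g]])
    then show ?thesis
      by (simp add: U.bl_simps has_vector_derivative_at_within)
  qed
  then have "((\<lambda>s. - ?G f s) has_integral (U (- 1 * b) (W b f) - U (- 1 * a) (W a f))) {a..b}"
    by (rule fundamental_theorem_of_calculus[OF ab])
  from has_integral_neg[OF this] show "integral {a..b} (?G f) = U (- a) (W a f) - U (- b) (W b f)"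
    by (simp add: integral_unique)
qed

lemma mult_self_le_imp_le:
  fixes a b :: real
  assumes "a * a \<le> b * a" "0 \<le> a" "0 \<le> b"
  shows "a \<le> b"
  using assms mult_right_le_imp_le[of a a b] by (cases "a = 0") auto

section \<open>The Laplacian of commuting groups\<close>

text \<open>Abstract form of the translations along the coordinate axes. Elliptic regularity then
  becomes Hilbert space theory, with (T m s u - u)/s as difference quotients.\<close>

locale commuting_groups =
  fixes T :: "'n::finite \<Rightarrow> real \<Rightarrow> 'h::{real_inner,banach} \<Rightarrow> 'h"
  assumes group: "ortho_group (T l)"
    and commute: "T l s (T m r f) = T m r (T l s f)"
    and dense: "closure {f. \<forall>l. f \<in> Domain (generator (T l))} = UNIV"
begin

sublocale T: ortho_group "T l" for l by (rule group)

abbreviation d :: "'n \<Rightarrow> 'h \<Rightarrow> 'h" where "d l \<equiv> app (generator (T l))"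

definition H1 :: "'h set" where "H1 = {f. \<forall>l. f \<in> Domain (generator (T l))}"

definition H2 :: "'h set" where "H2 = {f \<in> H1. \<forall>l. d l f \<in> H1}"

definition lap :: "'h \<Rightarrow> 'h" where "lap f = (\<Sum>l\<in>UNIV. d l (d l f))"

lemma d_eq: "(f, g) \<in> generator (T l) \<Longrightarrow> d l f = g"
  unfolding app_def by (blast intro: generator_unique)

lemma d_iff: "f \<in> Domain (generator (T l)) \<Longrightarrow> (f, d l f) \<in> generator (T l)"
  using d_eq by blast

lemma H1_d: "f \<in> H1 \<Longrightarrow> (f, d l f) \<in> generator (T l)"
  by (simp add: H1_def d_iff)

lemma H1I: "(\<And>l. (f, g l) \<in> generator (T l)) \<Longrightarrow> f \<in> H1"
  unfolding H1_def by blast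

lemma gen_add: "(f, g) \<in> generator (T l) \<Longrightarrow> (f', g') \<in> generator (T l)
    \<Longrightarrow> (f + f', g + g') \<in> generator (T l)"
  using subspace_add[OF T.subspace_generator, of "(f, g)" l "(f', g')"] by simp

lemma gen_diff: "(f, g) \<in> generator (T l) \<Longrightarrow> (f', g') \<in> generator (T l)
    \<Longrightarrow> (f - f', g - g') \<in> generator (T l)"
  using subspace_diff[OF T.subspace_generator, of "(f, g)" l "(f', g')"] by simp

lemma gen_scale: "(f, g) \<in> generator (T l) \<Longrightarrow> (a *\<^sub>R f, a *\<^sub>R g) \<in> generator (T l)"
  using subspace_scale[OF T.subspace_generator, of "(f, g)" l a] by simp

lemma gen_commute:
  assumes C: "bounded_linear C" "\<And>s f. C (T l s f) = T l s (C f)" and f: "(f, g) \<in> generator (T l)"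
  shows "(C f, C g) \<in> generator (T l)"
  using bounded_linear.has_vector_derivative[OF C(1) generatorD[OF f]]
      by (simp add: generator_def C(2))

lemma H1_lin:
  assumes "f \<in> H1" "g \<in> H1"
  shows "f + g \<in> H1" "d l (f + g) = d l f + d l g" "f - g \<in> H1" "d l (f - g) = d l f - d l g"
proof -
  have a: "(f + g, d l f + d l g) \<in> generator (T l)" for l by (intro gen_add H1_d assms)
  show "f + g \<in> H1" by (rule H1I[OF a])
  show "d l (f + g) = d l f + d l g" by (rule d_eq[OF a])
  have b: "(f - g, d l f - d l g) \<in> generator (T l)" for l by (intro gen_diff H1_d assms)
  show "f - g \<in> H1" by (rule H1I[OF b])
  show "d l (f - g) = d l f - d l g" by (rule d_eq[OF b])
qed

lemma H1_scale:
  assumes "f \<in> H1"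
  shows "a *\<^sub>R f \<in> H1" "d l (a *\<^sub>R f) = a *\<^sub>R d l f"
proof -
  have c: "(a *\<^sub>R f, a *\<^sub>R d l f) \<in> generator (T l)" for l by (intro gen_scale H1_d assms)
  show "a *\<^sub>R f \<in> H1" by (rule H1I[OF c])
  show "d l (a *\<^sub>R f) = a *\<^sub>R d l f" using c by (rule d_eq)
qed

lemma H1_commute:
  assumes C: "bounded_linear C" "\<And>l s f. C (T l s f) = T l s (C f)" and f: "f \<in> H1"
  shows "C f \<in> H1" "d l (C f) = C (d l f)"
proof -
  have a: "(C f, C (d l f)) \<in> generator (T l)" for l by (rule gen_commute[OF C H1_d[OF f]])
  show "C f \<in> H1" by (rule H1I[OF a])
  show "d l (C f) = C (d l f)" by (rule d_eq[OF a])
qed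

lemma H2_lin:
  assumes "f \<in> H2" "g \<in> H2"
  shows "f + g \<in> H2" "lap (f + g) = lap f + lap g" "f - g \<in> H2" "lap (f - g) = lap f - lap g"
  using assms by (auto simp: H2_def lap_def H1_lin sum.distrib sum_subtractf)

lemma H2_scale:
  assumes "f \<in> H2"
  shows "a *\<^sub>R f \<in> H2" "lap (a *\<^sub>R f) = a *\<^sub>R lap f"
  using assms by (auto simp: H2_def lap_def H1_scale scaleR_sum_right)

lemma H2_commute:
  assumes C: "bounded_linear C" "\<And>l s f. C (T l s f) = T l s (C f)" and f: "f \<in> H2"
  shows "C f \<in> H2" "lap (C f) = C (lap f)"
  using f H1_commute[OF C] by (auto simp: H2_def lap_def bounded_linear.linear[OF C(1)] linear_sum)

lemma dense_H1: "closure H1 = UNIV"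
  using dense by (simp add: H1_def)

lemma d_skew: "f \<in> H1 \<Longrightarrow> g \<in> H1 \<Longrightarrow> d l f \<bullet> g = - (f \<bullet> d l g)"
  using T.generator_skew[OF H1_d H1_d, of f g l] by simp

lemma lap_inner: "f \<in> H2 \<Longrightarrow> g \<in> H1 \<Longrightarrow> lap f \<bullet> g = - (\<Sum>l\<in>UNIV. d l f \<bullet> d l g)"
  unfolding lap_def inner_sum_left sum_negf[symmetric] by (rule sum.cong) (auto simp: H2_def d_skew)

lemma lap_symmetric: "f \<in> H2 \<Longrightarrow> g \<in> H2 \<Longrightarrow> lap f \<bullet> g = f \<bullet> lap g"
  using lap_inner[of f g] lap_inner[of g f] by (simp add: H2_def inner_commute)

text \<open>The weak formulation of u - lap u = f.\<close>

definition weak :: "'h \<Rightarrow> 'h \<Rightarrow> bool" where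
  "weak u f \<longleftrightarrow> u \<in> H1 \<and> (\<forall>v\<in>H1. (f - u) \<bullet> v = (\<Sum>l\<in>UNIV. d l u \<bullet> d l v))"

text \<open>The solution is the first component of the projection of (f, 0) onto the closed graph of
  the gradient; orthogonality of the remainder to the graph is the weak equation.\<close>

lemma weak_exists: "\<exists>u. weak u f"
proof -
  define S where "S = {(u, v). \<forall>l. (u, v $ l) \<in> generator (T l)}"
  have "subspace S"
    unfolding subspace_def S_def
    using subspace_0[OF T.subspace_generator] by (auto simp: zero_prod_def gen_add gen_scale)
  moreover have "closed S"
    unfolding closed_sequential_limits
  proof (intro allI impI, elim conjE)
    fix x :: "nat \<Rightarrow> 'h \<times> ('h ^ 'n)" and l
    assume x: "\<forall>n. x n \<in> S" "x \<longlonglongrightarrow> l"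
    have "(fst l, snd l $ i) \<in> generator (T i)" for i
    proof (rule T.generator_closed)
      show "(fst (x n), snd (x n) $ i) \<in> generator (T i)" for n
        using x(1) by (auto simp: S_def split: prod.splits dest!: spec[of _ n])
      show "(\<lambda>n. fst (x n)) \<longlonglongrightarrow> fst l" "(\<lambda>n. snd (x n) $ i) \<longlonglongrightarrow> snd l $ i"
        by (intro tendsto_intros x)+
    qed
    then show "l \<in> S" by (auto simp: S_def split: prod.splits)
  qed
  ultimately obtain y where y: "y \<in> S" "\<And>z. z \<in> S \<Longrightarrow> ((f, 0) - y) \<bullet> z = 0"
    using orthogonal_projection[of S "(f, 0)"] by blast
  obtain u w where uw: "y = (u, w)" by (cases y)
  have u: "(u, w $ l) \<in> generator (T l)" for l using y(1) by (simp add: S_def uw)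
  have w: "w $ l = d l u" for l by (rule d_eq[OF u, symmetric])
  have "(f - u) \<bullet> v = (\<Sum>l\<in>UNIV. d l u \<bullet> d l v)" if v: "v \<in> H1" for v
  proof -
    have "(v, \<chi> l. d l v) \<in> S" by (simp add: S_def H1_d[OF v])
    from y(2)[OF this] show ?thesis
      by (simp add: uw inner_vec_def w sum_negf)
  qed
  moreover have "u \<in> H1" using u by (rule H1I)
  ultimately show ?thesis unfolding weak_def by blast
qed

lemma weak_diff: "weak u f \<Longrightarrow> weak u' f' \<Longrightarrow> weak (u - u') (f - f')"
proof -
  assume *: "weak u f" "weak u' f'"
  then have 1: "u \<in> H1" "u' \<in> H1" by (simp_all add: weak_def)
  have "(f - f' - (u - u')) \<bullet> v = (\<Sum>l\<in>UNIV. d l (u - u') \<bullet> d l v)" if v: "v \<in> H1" for v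
  proof -
    have "(f - f' - (u - u')) \<bullet> v = (f - u) \<bullet> v - (f' - u') \<bullet> v"
      by (simp add: inner_diff_left)
    also have "(f - u) \<bullet> v = (\<Sum>l\<in>UNIV. d l u \<bullet> d l v)" using * v by (simp add: weak_def)
    also have "(f' - u') \<bullet> v = (\<Sum>l\<in>UNIV. d l u' \<bullet> d l v)" using * v by (simp add: weak_def)
    finally show ?thesis by (simp add: H1_lin[OF 1] inner_diff_left sum_subtractf)
  qed
  then show ?thesis using H1_lin(3)[OF 1] by (simp add: weak_def)
qed

lemma weak_scale: "weak u f \<Longrightarrow> weak (a *\<^sub>R u) (a *\<^sub>R f)"
  by (simp add: weak_def H1_scale sum_distrib_left flip: scaleR_diff_right)

lemma weak_T: assumes "weak u f" shows "weak (T m s u) (T m s f)"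
proof -
  have u: "u \<in> H1" using assms by (simp add: weak_def)
  note c = H1_commute[OF T.bounded_linear commute]
  show ?thesis
    unfolding weak_def
  proof (intro conjI ballI)
    fix v assume v: "v \<in> H1"
    have "(T m s f - T m s u) \<bullet> v = (f - u) \<bullet> T m (- s) v"
      by (simp add: T.inner_left flip: T.bl_simps)
    also have "\<dots> = (\<Sum>l\<in>UNIV. d l u \<bullet> d l (T m (- s) v))"
      using assms c(1)[OF v] by (simp add: weak_def)
    also have "\<dots> = (\<Sum>l\<in>UNIV. d l (T m s u) \<bullet> d l v)"
      by (simp add: c(2)[OF u] c(2)[OF v] T.inner_left)
    finally show "(T m s f - T m s u) \<bullet> v = (\<Sum>l\<in>UNIV. d l (T m s u) \<bullet> d l v)" .
  qed (rule c(1)[OF u])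
qed

lemma weak_energy: "weak u f \<Longrightarrow> (norm u)\<^sup>2 + (\<Sum>l\<in>UNIV. (norm (d l u))\<^sup>2) = f \<bullet> u"
  unfolding weak_def power2_norm_eq_inner by (auto simp: inner_diff)

lemma weak_bound:
  assumes "weak u f" shows "norm u \<le> norm f" "norm (d l u) \<le> norm f"
proof -
  note e = weak_energy[OF assms]
  have nn: "0 \<le> (\<Sum>l\<in>UNIV. (norm (d l u))\<^sup>2)" by (intro sum_nonneg) auto
  have cs: "f \<bullet> u \<le> norm f * norm u" by (rule norm_cauchy_schwarz)
  have "norm u * norm u \<le> norm f * norm u"
    using e nn cs by (simp add: power2_eq_square)
  then show 1: "norm u \<le> norm f"
    by (rule mult_self_le_imp_le) simp_all
  have "(norm (d l u))\<^sup>2 \<le> (\<Sum>l\<in>UNIV. (norm (d l u))\<^sup>2)"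
    by (rule member_le_sum) auto
  also have "\<dots> \<le> norm f * norm f"
    using e cs 1 mult_left_mono[OF 1 norm_ge_zero[of f]] zero_le_power2[of "norm u"] by linarith
  finally have "(norm (d l u))\<^sup>2 \<le> (norm f)\<^sup>2" by (simp only: power2_eq_square[of "norm f"])
  then show "norm (d l u) \<le> norm f" by (rule power2_le_imp_le) simp
qed

text \<open>By translation invariance the difference quotient of u minus \<open>u'\<close> is a weak
  solution whose right-hand side tends to 0. The energy bounds transfer this convergence to the
  solution and to its first derivatives at once.\<close>

lemma weak_regularity_step:
  assumes u: "weak u f" and f: "(f, g) \<in> generator (T m)" and u': "weak u' g"
  shows "(u, u') \<in> generator (T m)" "(d l u, d l u') \<in> generator (T m)"
proof -
  have u1: "u \<in> H1" "u' \<in> H1" using u u' by (auto simp: weak_def)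
  note c = H1_commute[OF T.bounded_linear commute]
  let ?q = "\<lambda>s. (T m s u - u) /\<^sub>R s"
  let ?r = "\<lambda>s. (T m s f - f) /\<^sub>R s"
  have lim: "((\<lambda>s. norm (?r s - g)) \<longlongrightarrow> 0) (at 0)"
    using generatorD[OF f, unfolded has_vector_derivative_iff_quotient]
    by (simp add: tendsto_norm_zero LIM_zero)
  have w: "weak (?q s - u') (?r s - g)" for s
    by (intro weak_diff weak_scale weak_T u u')
  have "((\<lambda>s. ?q s - u') \<longlongrightarrow> 0) (at 0)"
    by (rule Lim_null_comparison[OF _ lim]) (use weak_bound(1)[OF w] in simp)
  then show "(u, u') \<in> generator (T m)"
    by (simp add: generator_def has_vector_derivative_iff_quotient LIM_zero_iff)
  have "((\<lambda>s. d l (?q s - u')) \<longlongrightarrow> 0) (at 0)"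
    by (rule Lim_null_comparison[OF _ lim]) (use weak_bound(2)[OF w] in simp)
  moreover have "d l (?q s - u') = (T m s (d l u) - d l u) /\<^sub>R s - d l u'" for s
  proof -
    have "T m s u \<in> H1" by (rule c(1)[OF u1(1)])
    then show ?thesis using u1 by (simp add: H1_lin H1_scale c(2))
  qed
  ultimately show "(d l u, d l u') \<in> generator (T m)"
    by (simp add: generator_def has_vector_derivative_iff_quotient LIM_zero_iff)
qed

text \<open>Here \<open>u'\<close> is the m-th derivative of u, so this is the a priori bound for
  second derivatives. Moving the derivative from g back to f is the point: in the approximation that
  follows, f converges while g is uncontrolled.\<close>

lemma weak_regularity_bound:
  assumes u: "weak u f" and f: "(f, g) \<in> generator (T m)" and u': "weak u' g"
  shows "norm (d l u') \<le> norm f"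
proof -
  have 1: "u' \<in> H1" using u' by (simp add: weak_def)
  define S where "S = (\<Sum>l\<in>UNIV. (norm (d l u'))\<^sup>2)"
  have le: "(norm (d k u'))\<^sup>2 \<le> S" for k
    unfolding S_def by (rule member_le_sum) auto
  have "S \<le> g \<bullet> u'" using weak_energy[OF u'] zero_le_power2[of "norm u'"] unfolding S_def
      by linarith
  also have "g \<bullet> u' = - (f \<bullet> d m u')"
    using T.generator_skew[OF f H1_d[OF 1]] by simp
  also have "\<dots> \<le> norm f * norm (d m u')"
    using Cauchy_Schwarz_ineq2[of f "d m u'"] by linarith
  also have "norm (d m u') \<le> sqrt S" using le by (simp add: real_le_rsqrt)
  finally have "S \<le> norm f * sqrt S" by (simp add: mult_left_mono)
  moreover have "0 \<le> S" unfolding S_def by (intro sum_nonneg) auto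
  ultimately have "sqrt S * sqrt S \<le> norm f * sqrt S" by simp
  then have "sqrt S \<le> norm f"
    by (rule mult_self_le_imp_le) (simp_all add: \<open>0 \<le> S\<close>)
  moreover have "norm (d l u') \<le> sqrt S" using le by (simp add: real_le_rsqrt)
  ultimately show ?thesis by linarith
qed

text \<open>For right-hand sides \<open>F k\<close> in \<open>H1\<close> the second derivatives
  \<open>d l (w' k)\<close> exist; the preceding bound makes them Cauchy, and closedness of the
  generator passes to the limit.\<close>

lemma weak_H2: assumes u: "weak u f" shows "u \<in> H2"
proof -
  have u1: "u \<in> H1" using u by (simp add: weak_def)
  have "d l u \<in> Domain (generator (T m))" for l m
  proof -
    have "f \<in> closure H1" using dense_H1 by simp
    then obtain F where F: "\<And>k. F k \<in> H1" "F \<longlonglongrightarrow> f" unfolding closure_sequential by blast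
    define w where "w k = (SOME u. weak u (F k))" for k
    define w' where "w' k = (SOME u. weak u (d m (F k)))" for k
    have w: "weak (w k) (F k)" and w': "weak (w' k) (d m (F k))" for k
      unfolding w_def w'_def by (rule someI_ex[OF weak_exists])+
    have step: "(d l (w k), d l (w' k)) \<in> generator (T m)" for k
      by (rule weak_regularity_step(2)[OF w H1_d[OF F(1)] w'])
    have w1: "w k \<in> H1" "w' k \<in> H1" for k using w w' by (auto simp: weak_def)
    have bound: "norm (d l (w' j) - d l (w' k)) \<le> norm (F j - F k)" for j k
      using weak_regularity_bound[OF weak_diff[OF w w] gen_diff[OF H1_d[OF F(1)] H1_d[OF F(1)]]
          weak_diff[OF w' w']]
      by (simp add: H1_lin w1)
    have "Cauchy (\<lambda>k. d l (w' k))"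
    proof (rule metric_CauchyI)
      fix e :: real assume "0 < e"
      then obtain N where "\<And>j k. N \<le> j \<Longrightarrow> N \<le> k \<Longrightarrow> dist (F j) (F k) < e"
        using LIMSEQ_imp_Cauchy[OF F(2)] unfolding Cauchy_def by blast
      then show "\<exists>N. \<forall>j\<ge>N. \<forall>k\<ge>N. dist (d l (w' j)) (d l (w' k)) < e"
        using bound unfolding dist_norm by (meson le_less_trans)
    qed
    then obtain z where z: "(\<lambda>k. d l (w' k)) \<longlonglongrightarrow> z" by (metis Cauchy_convergent convergentD)
    have "(\<lambda>k. norm (F k - f)) \<longlonglongrightarrow> 0" using F(2) by (simp add: tendsto_norm_zero LIM_zero)
    then have "(\<lambda>k. d l (w k) - d l u) \<longlonglongrightarrow> 0"
      by (rule Lim_null_comparison[rotated])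
        (use weak_bound(2)[OF weak_diff[OF w u]] w1 u1 in \<open>simp add: H1_lin\<close>)
    then have "(\<lambda>k. d l (w k)) \<longlonglongrightarrow> d l u" by (simp add: LIM_zero_iff)
    from T.generator_closed[OF step this z] show ?thesis by (rule DomainI)
  qed
  then show ?thesis using u1 by (simp add: H2_def H1_def)
qed

theorem resolvent_lap: "\<exists>u\<in>H2. u - lap u = f"
proof -
  obtain u where u: "weak u f" using weak_exists by blast
  have u2: "u \<in> H2" by (rule weak_H2[OF u])
  have "(f - u) \<bullet> v = (- lap u) \<bullet> v" for v
  proof (rule bounded_linear_eq_on_dense[OF bounded_linear_inner_right bounded_linear_inner_right
      dense_H1])
    fix v assume "v \<in> H1"
    then show "(f - u) \<bullet> v = (- lap u) \<bullet> v"
      using u lap_inner[OF u2] by (simp add: weak_def)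
  qed
  from this[of "f - u + lap u"] have "(f - u + lap u) \<bullet> (f - u + lap u) = 0"
    by (simp add: inner_add_left)
  then have "f - u + lap u = 0" by (simp only: inner_eq_zero_iff)
  then have "u - lap u = f" by (simp add: algebra_simps)
  with u2 show ?thesis by blast
qed

end

text \<open>\<open>J\<close> stands for multiplication by i, reduced to what a real Hilbert space
  sees of it: an isometric complex structure commuting with the groups.\<close>

locale complex_commuting_groups = commuting_groups T
  for T :: "'n::finite \<Rightarrow> real \<Rightarrow> 'h::{real_inner,banach} \<Rightarrow> 'h" +
  fixes J :: "'h \<Rightarrow> 'h"
  assumes linear_J: "linear J"
    and norm_J [simp]: "norm (J f) = norm f"
    and J_J [simp]: "J (J f) = - f"
    and J_T: "J (T l s f) = T l s (J f)"
begin

lemma bounded_linear_J: "bounded_linear J"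
  using linear_J by (intro bounded_linear_intro[where K = 1]) (auto simp: linear_add linear_scale)

lemma inner_J [simp]: "J f \<bullet> J g = f \<bullet> g"
  by (simp add: dot_norm flip: linear_add[OF linear_J])

lemma J_skew: "f \<bullet> J g = - (J f \<bullet> g)"
  using inner_J[of f "J g"] by simp

lemma J_skew' [simp]: "f \<bullet> J f = 0"
  using J_skew[of f f] by (simp add: inner_commute)

text \<open>The shifted operator J (lap - 1) is treated first because it has the bounded inverse
  \<open>K (J g)\<close>. Its range condition becomes an equation for the bounded skew map J K,
  solvable for every nonzero r, and the shift is undone by adding the bounded map J.\<close>

theorem skew_adjoint_J_lap: "\<exists>c. skew_adjoint {(f, J (lap f)) |f. f \<in> H2} c"
proof -
  define A where "A = {(f, J (lap f - f)) |f. f \<in> H2}"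
  note J = linear_add[OF linear_J] linear_diff[OF linear_J] linear_scale[OF linear_J]
    linear_0[OF linear_J] linear_neg[OF linear_J]
  have H2_0: "0 \<in> H2" "lap 0 = 0"
    using resolvent_lap[of 0] H2_scale[of _ 0] by force+
  obtain K where K: "\<And>g. K g \<in> H2" "\<And>g. K g - lap (K g) = g" using resolvent_lap by metis
  have inj: "u = v" if "u \<in> H2" "v \<in> H2" "u - lap u = v - lap v" for u v
  proof -
    have w: "u - v \<in> H2" by (rule H2_lin(3)[OF that(1,2)])
    have "lap u - lap v = u - v" using that(3) by (simp add: algebra_simps)
    then have l: "lap (u - v) = u - v" by (simp only: H2_lin(4)[OF that(1,2)])
    from w have "lap (u - v) \<bullet> (u - v) = - (\<Sum>l\<in>UNIV. d l (u - v) \<bullet> d l (u - v))"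
      by (intro lap_inner) (auto simp: H2_def)
    then have "(u - v) \<bullet> (u - v) \<le> 0" unfolding l by (simp add: sum_nonneg)
    then show ?thesis using inner_ge_zero[of "u - v"] by (simp add: antisym)
  qed
  have K_le: "norm (K g) \<le> norm g" for g
  proof -
    have "lap (K g) \<bullet> K g \<le> 0" using lap_inner[of "K g" "K g"] K(1) by (simp add: sum_nonneg H2_def)
    then have "K g \<bullet> K g \<le> (K g - lap (K g)) \<bullet> K g" by (simp add: inner_diff)
    also have "\<dots> \<le> norm g * norm (K g)" unfolding K(2) by (rule norm_cauchy_schwarz)
    finally have "norm (K g) * norm (K g) \<le> norm g * norm (K g)"
      by (simp add: norm_eq_sqrt_inner)
    then show ?thesis by (rule mult_self_le_imp_le) simp_all
  qed
  have "bounded_linear K"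
  proof (rule bounded_linear_intro[where K = 1])
    show "K (f + g) = K f + K g" for f g
    proof (rule inj[OF K(1) H2_lin(1)[OF K(1) K(1)]])
      have "K f + K g - lap (K f + K g) = (K f - lap (K f)) + (K g - lap (K g))"
        by (simp add: H2_lin K(1))
      then show "K (f + g) - lap (K (f + g)) = K f + K g - lap (K f + K g)" by (simp add: K(2))
    qed
    show "K (a *\<^sub>R f) = a *\<^sub>R K f" for f and a :: real
    proof (rule inj[OF K(1) H2_scale(1)[OF K(1)]])
      have "a *\<^sub>R K f - lap (a *\<^sub>R K f) = a *\<^sub>R (K f - lap (K f))"
        by (simp add: H2_scale[OF K(1)] scaleR_diff_right)
      then show "K (a *\<^sub>R f) - lap (K (a *\<^sub>R f)) = a *\<^sub>R K f - lap (a *\<^sub>R K f)" by (simp add: K(2))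
    qed
  qed (use K_le in simp)
  have K_sym: "K f \<bullet> g = f \<bullet> K g" for f g
    using lap_symmetric[OF K(1) K(1), of f g] K(2)[of f] K(2)[of g]
    by (metis inner_diff_left inner_diff_right)
  have K_J: "K (J g) = J (K g)" for g
  proof (rule inj)
    note c = H2_commute[OF bounded_linear_J J_T K(1)]
    show "K (J g) \<in> H2" "J (K g) \<in> H2" by (rule K(1), rule c(1))
    have "J (K g) - lap (J (K g)) = J (K g - lap (K g))" by (simp add: c(2) J)
    then show "K (J g) - lap (K (J g)) = J (K g) - lap (J (K g))" by (simp add: K(2))
  qed
  have "skew_adjoint A 1"
  proof (rule skew_adjoint.intro)
    show "subspace A"
      unfolding subspace_def
    proof (intro conjI allI ballI)
      show "0 \<in> A" using H2_0 by (force simp: A_def zero_prod_def J)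
      fix x y assume "x \<in> A" "y \<in> A"
      then obtain f g where "f \<in> H2" "x = (f, J (lap f - f))" "g \<in> H2" "y = (g, J (lap g - g))"
        by (auto simp: A_def)
      then show "x + y \<in> A"
        by (auto simp: A_def H2_lin J intro!: exI[of _ "f + g"])
    next
      fix a :: real and x assume "x \<in> A"
      then obtain f where "f \<in> H2" "x = (f, J (lap f - f))" by (auto simp: A_def)
      then show "a *\<^sub>R x \<in> A"
        by (auto simp: A_def H2_scale J scaleR_diff_right intro!: exI[of _ "a *\<^sub>R f"])
    qed
    show "f \<bullet> g = 0" if "(f, g) \<in> A" for f g
    proof -
      have f: "f \<in> H2" "g = J (lap f) - J f" using that by (auto simp: A_def J)
      have "lap (J f) \<bullet> f = J f \<bullet> lap f"
        using lap_symmetric H2_commute(1)[OF bounded_linear_J J_T] f(1) by blast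
      then have "J (lap f) \<bullet> f = J f \<bullet> lap f"
        by (simp add: H2_commute(2)[OF bounded_linear_J J_T f(1)])
      then have "f \<bullet> J (lap f) = 0"
        using J_skew[of f "lap f"] by (simp add: inner_commute)
      then show ?thesis by (simp add: f(2) inner_diff)
    qed
    show "g = 0" if "(0, g) \<in> A" for g
      using that H2_0 by (auto simp: A_def J)
    fix r :: real and g :: 'h assume r: "r \<noteq> 0"
    have "bounded_linear (\<lambda>x. J (K x))"
      by (rule bounded_linear_compose[OF bounded_linear_J \<open>bounded_linear K\<close>])
    moreover have "f \<bullet> J (K f) = 0" for f
    proof -
      have "J (K f) \<bullet> f = J f \<bullet> K f" by (simp add: K_sym flip: K_J)
      then show ?thesis using J_skew[of f "K f"] by (simp add: inner_commute)
    qed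
    ultimately obtain x where x: "r *\<^sub>R x - J (K x) = - J g"
      using bounded_skew_surj[OF _ _ r, of "\<lambda>x. J (K x)" "- J g"] by blast
    \<comment> \<open>the solution of \<open>f - r J (lap f - f) = g\<close> is \<open>f = K x\<close>, where \<open>K = (1 - lap)\<^sup>-\<^sup>1\<close>\<close>
    have "lap (K x) - K x = - x" using K(2)[of x] by (simp add: algebra_simps eq_neg_iff_add_eq_0)
    then have "K x - r *\<^sub>R J (lap (K x) - K x) = K x + r *\<^sub>R J x" by (simp add: J)
    also have "\<dots> = J (r *\<^sub>R x - J (K x))" by (simp add: J)
    also have "\<dots> = g" unfolding x by (simp add: J)
    finally show "\<exists>f h. (f, h) \<in> A \<and> f - r *\<^sub>R h = g"
      unfolding A_def using K(1) by blast
  qed simp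
  then interpret A: skew_adjoint A 1 .
  have "\<exists>c'. skew_adjoint {(f, g + J f) |f g. (f, g) \<in> A} c'"
    by (rule A.bounded_perturbation[OF bounded_linear_J J_skew'])
  moreover have "{(f, g + J f) |f g. (f, g) \<in> A} = {(f, J (lap f)) |f. f \<in> H2}"
    by (auto simp: A_def J)
  ultimately show ?thesis by simp
qed

end

section \<open>Wave operators and asymptotic velocity\<close>

text \<open>
  Nothing is assumed about the measurability of \<open>G\<close>, which is the weighted \<open>S\<close>-norm below.
\<close>

lemma integral_le_nn_integral:
  fixes n :: "real \<Rightarrow> real"
  assumes n: "continuous_on {a..b} n" "\<And>s. 0 \<le> n s" and a: "0 \<le> a"
    and le: "\<And>s. s \<in> {a..b} \<Longrightarrow> ennreal (n s) \<le> G s"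
  shows "ennreal (integral {a..b} n) \<le> (\<integral>\<^sup>+s\<in>{0..}. G s \<partial>lborel)"
proof -
  have "(n has_integral integral {a..b} n) {a..b}"
    using integrable_continuous_real[OF n(1)] by (rule integrable_integral)
  then have "ennreal (integral {a..b} n) = (\<integral>\<^sup>+s. ennreal (indicator {a..b} s * n s) \<partial>lborel)"
    using nn_integral_has_integral_lebesgue[of "{a..b}" n] n(2) by simp
  also have "\<dots> \<le> (\<integral>\<^sup>+s\<in>{0..}. G s \<partial>lborel)"
    by (rule nn_integral_mono) (use le a in \<open>auto simp: indicator_def\<close>)
  finally show ?thesis .
qed

locale wave_pair =
  fixes U W :: "real \<Rightarrow> 'h::{real_inner,banach} \<Rightarrow> 'h" and B :: "'h \<Rightarrow> 'h"
  assumes U: "ortho_group U" and W: "ortho_group W"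
    and dense: "closure (Domain (generator W)) = UNIV"
    and B: "bounded_linear B"
    and pert: "(f, g) \<in> generator W \<Longrightarrow> (f, g + B f) \<in> generator U"
begin

sublocale U: ortho_group U by (rule U)
sublocale W: ortho_group W by (rule W)

lemma continuous_integrand: "continuous_on S (\<lambda>s. U (t - s) (B (W s f)))"
  using continuous_on_subset[OF W.continuous subset_UNIV]
  by (intro U.continuous_on_compose continuous_intros bounded_linear.continuous_on[OF B])

text \<open>The bounded map \<open>L\<close> is the identity in Cook's criterion and the increment
  of the phase group after time t in the estimate of the position.\<close>

lemma norm_difference_le:
  fixes L :: "'h \<Rightarrow> 'b::banach"
  assumes L: "bounded_linear L" and ab: "a \<le> b"
  shows "norm (L (U (- b) (W b f) - U (- a) (W a f)))
    \<le> integral {a..b} (\<lambda>s. norm (L (U (- s) (B (W s f)))))"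
proof -
  let ?G = "\<lambda>s. U (- s) (B (W s f))"
  have cont: "continuous_on {a..b} ?G"
    using continuous_integrand[of _ 0] by simp
  have int: "?G integrable_on {a..b}" using cont by (rule integrable_continuous_real)
  have "L (U (- b) (W b f) - U (- a) (W a f)) = - L (integral {a..b} ?G)"
    using duhamel[OF U W dense B pert ab, of f] by (simp add: bounded_linear.linear[OF L] flip:
        linear_neg)
  also have "L (integral {a..b} ?G) = integral {a..b} (L \<circ> ?G)"
    by (rule integral_linear[OF int L, symmetric])
  also have "norm (- \<dots>) \<le> integral {a..b} (\<lambda>s. norm (L (?G s)))"
    unfolding norm_minus_cancel
    by (rule Henstock_Kurzweil_Integration.integral_norm_bound_integral[of "L \<circ> ?G"])
      (auto intro!: integrable_continuous_real continuous_on_norm bounded_linear.continuous_on[OF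
          L] cont simp: o_def)
  finally show ?thesis .
qed

text \<open>The integral \<open>h\<close> of the perturbation is increasing and bounded, so its
  oscillation beyond a late N is small, and it dominates the oscillation of the wave.\<close>

lemma cook:
  assumes fin: "(\<integral>\<^sup>+t\<in>{0..}. ennreal (norm (B (W t f))) \<partial>lborel) < \<infinity>"
  shows "\<exists>g. ((\<lambda>t. U (- t) (W t f)) \<longlongrightarrow> g) at_top"
proof -
  let ?F = "\<lambda>t. U (- t) (W t f)"
  let ?n = "\<lambda>s. norm (B (W s f))"
  define h where "h b = integral {0..b} ?n" for b
  define I where "I = enn2real (\<integral>\<^sup>+t\<in>{0..}. ennreal (?n t) \<partial>lborel)"
  have cont: "continuous_on S ?n" for S
    using continuous_on_norm[OF continuous_integrand[of S 0 f]] by simp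
  have int: "?n integrable_on {a..b}" for a b by (rule integrable_continuous_real[OF cont])
  have "ennreal (h b) \<le> (\<integral>\<^sup>+t\<in>{0..}. ennreal (?n t) \<partial>lborel)" for b
    unfolding h_def by (rule integral_le_nn_integral[OF cont]) auto
  then have "h b \<le> I" for b
    using fin unfolding I_def by (metis enn2real_mono enn2real_ennreal infinity_ennreal_def h_def
        integral_nonneg int norm_ge_zero)
  then have bdd: "bdd_above (h ` {0..})" by (intro bdd_aboveI[of _ I]) auto
  have diff: "norm (?F b - ?F a) \<le> h b - h a" if "0 \<le> a" "a \<le> b" for a b
  proof -
    have "h a + integral {a..b} ?n = h b"
      unfolding h_def by (rule Henstock_Kurzweil_Integration.integral_combine[OF that int])
    then show ?thesis using norm_difference_le[OF bounded_linear_ident that(2), of f] by simp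
  qed
  have near: "\<exists>N\<ge>0. \<forall>a\<ge>N. \<forall>b\<ge>N. norm (?F b - ?F a) < e" if e: "0 < e" for e
  proof -
    define L where "L = (SUP b\<in>{0..}. h b)"
    obtain N where N: "N \<ge> 0" "L - e < h N"
      using less_cSUP_iff[OF _ bdd, of "L - e"] e unfolding L_def by auto
    have *: "norm (?F b - ?F a) < e" if "N \<le> a" "a \<le> b" for a b
    proof -
      have "0 \<le> norm (?F a - ?F N)" by simp
      also have "\<dots> \<le> h a - h N" using diff[of N a] N that by simp
      finally have "h N \<le> h a" by simp
      moreover have "h b \<le> L" unfolding L_def using N that by (intro cSUP_upper bdd) auto
      ultimately show ?thesis using diff[of a b] N that by linarith
    qed
    have "norm (?F b - ?F a) < e" if "N \<le> a" "N \<le> b" for a b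
      using *[of a b] *[of b a] that by (cases "a \<le> b") (auto simp: norm_minus_commute)
    then show ?thesis using N(1) by blast
  qed
  have "Cauchy (\<lambda>n. ?F (real n))"
  proof (rule metric_CauchyI)
    fix e :: real assume "0 < e"
    then obtain N where N: "\<And>a b. N \<le> a \<Longrightarrow> N \<le> b \<Longrightarrow> norm (?F b - ?F a) < e" using near by blast
    obtain M where M: "N \<le> real M" using real_arch_simple by blast
    show "\<exists>M. \<forall>m\<ge>M. \<forall>n\<ge>M. dist (?F (real m)) (?F (real n)) < e"
    proof (intro exI allI impI)
      fix m n assume "M \<le> m" "M \<le> n"
      then show "dist (?F (real m)) (?F (real n)) < e"
        unfolding dist_norm using M by (intro N) linarith+
    qed
  qed
  then obtain g where g: "(\<lambda>n. ?F (real n)) \<longlonglongrightarrow> g" by (metis Cauchy_convergent convergentD)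
  have "(?F \<longlongrightarrow> g) at_top"
  proof (rule tendstoI)
    fix e :: real assume e: "0 < e"
    then obtain N where N: "\<And>a b. N \<le> a \<Longrightarrow> N \<le> b \<Longrightarrow> norm (?F b - ?F a) < e / 2"
      using near[of "e / 2"] by auto
    have "norm (?F t - g) \<le> e / 2" if t: "N \<le> t" for t
    proof (rule LIMSEQ_le_const2)
      show "(\<lambda>n. norm (?F t - ?F (real n))) \<longlonglongrightarrow> norm (?F t - g)" by (intro tendsto_intros g)
      obtain M where M: "N \<le> real M" using real_arch_simple by blast
      show "\<exists>M. \<forall>n\<ge>M. norm (?F t - ?F (real n)) \<le> e / 2"
      proof (intro exI allI impI)
        fix n assume "M \<le> n"
        then show "norm (?F t - ?F (real n)) \<le> e / 2"
          using M t by (intro less_imp_le[OF N]) linarith+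
      qed
    qed
    then show "\<forall>\<^sub>F t in at_top. dist (?F t) g < e"
      unfolding eventually_at_top_linorder dist_norm using e by (intro exI[of _ N]) fastforce
  qed
  then show ?thesis by blast
qed

text \<open>\<open>U t f'\<close> is the free vector \<open>W t f\<close> plus a Duhamel tail. The
  generator of E is known on the first by \<open>free\<close> and bounded by \<open>C * I\<close> on
  the second, uniformly in t, so the tail vanishes after division by t. Keeping \<open>S\<close> and
  the Lipschitz criterion \<open>E_domain\<close> abstract lets continuum and lattice share the
  argument.\<close>

theorem asymptotic_velocity:
  assumes E: "ortho_group E"
    and E_domain: "\<And>f C. (\<And>a. 0 < a \<Longrightarrow> a \<le> 1 \<Longrightarrow> norm (E a f - f) \<le> C * a) \<Longrightarrow>
        \<exists>g. (f, g) \<in> generator E \<and> norm g \<le> C"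
    and S: "\<And>g r a. 0 < a \<Longrightarrow> a \<le> 1 \<Longrightarrow>
        ennreal (norm (E a (U r g) - U r g)) \<le> ennreal (C * a * (1 + \<bar>r\<bar>)) * S g"
    and C: "0 < C"
    and fin: "(\<integral>\<^sup>+t\<in>{0..}. ennreal (1 + t) * S (B (W t f)) \<partial>lborel) < \<infinity>"
    and free: "\<And>t. 0 \<le> t \<Longrightarrow> (W t f, W t q + t *\<^sub>R W t p) \<in> generator E"
    and f': "((\<lambda>t. U (- t) (W t f)) \<longlongrightarrow> f') at_top"
    and p': "((\<lambda>t. U (- t) (W t p)) \<longlongrightarrow> p') at_top"
  shows "\<exists>v. (\<forall>t\<ge>0. (U t f', v t) \<in> generator E) \<and> ((\<lambda>t. (1 / t) *\<^sub>R U (- t) (v t)) \<longlongrightarrow> p') at_top"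
proof -
  interpret E: ortho_group E by (rule E)
  let ?F = "\<lambda>t. U (- t) (W t f)"
  define I where "I = enn2real (\<integral>\<^sup>+t\<in>{0..}. ennreal (1 + t) * S (B (W t f)) \<partial>lborel)"
  have I: "(\<integral>\<^sup>+t\<in>{0..}. ennreal (1 + t) * S (B (W t f)) \<partial>lborel) = ennreal I"
    using fin by (simp add: I_def)
  have "\<exists>g. (U t f' - W t f, g) \<in> generator E \<and> norm g \<le> C * I" if t: "0 \<le> t" for t
  proof (rule E_domain)
    fix a :: real assume a: "0 < a" "a \<le> 1"
    let ?L = "\<lambda>x. E a (U t x) - U t x"
    have L: "bounded_linear ?L"
      by (intro bounded_linear_sub bounded_linear_compose[OF E.bounded_linear] U.bounded_linear)
    have bound: "norm (?L (?F b - ?F t)) \<le> C * I * a" if b: "t \<le> b" for b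
    proof -
      let ?n = "\<lambda>s. norm (?L (U (- s) (B (W s f))))"
      have k: "0 < C * a" using C a by simp
      \<comment> \<open>The factor \<open>C * a\<close> is divided out first, so that the remaining
        integral is compared with a number independent of a and t.\<close>
      have "ennreal (integral {t..b} (\<lambda>s. ?n s / (C * a))) \<le> ennreal I"
        unfolding I[symmetric]
      proof (rule integral_le_nn_integral[OF _ _ t])
        show "continuous_on {t..b} (\<lambda>s. ?n s / (C * a))"
          using continuous_integrand[of _ 0] k
          by (intro continuous_on_divide continuous_on_norm bounded_linear.continuous_on[OF L]
              continuous_on_const) auto
        fix s assume s: "s \<in> {t..b}"
        have "ennreal (?n s) \<le> ennreal (C * a * (1 + \<bar>t - s\<bar>)) * S (B (W s f))"
          using S[OF a, of "t - s" "B (W s f)"] by (simp flip: U.add)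
        \<comment> \<open>Since 0 \<le> t \<le> s, the transport time satisfies |t - s| \<le> s: the
          bound becomes uniform in t at the price of the weight 1 + s.\<close>
        also have "\<dots> \<le> ennreal (C * a * (1 + s)) * S (B (W s f))"
          using s t a C by (intro mult_right_mono ennreal_leI mult_left_mono) auto
        also have "ennreal (C * a * (1 + s)) = ennreal (C * a) * ennreal (1 + s)"
          using s t a C by (intro ennreal_mult) auto
        finally have le: "ennreal (?n s) \<le> ennreal (C * a) * (ennreal (1 + s) * S (B (W s f)))"
          by (simp only: mult.assoc)
        have "ennreal (?n s / (C * a)) = ennreal (1 / (C * a)) * ennreal (?n s)"
          using k by (subst ennreal_mult[symmetric]) auto
        also have "\<dots> \<le> ennreal (1 / (C * a)) * (ennreal (C * a) * (ennreal (1 + s) * S (B (W s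
            f))))"
          by (rule mult_left_mono[OF le]) simp
        also have "\<dots> = (ennreal (1 / (C * a)) * ennreal (C * a)) * (ennreal (1 + s) * S (B (W s
            f)))"
          by (simp only: mult.assoc)
        also have "ennreal (1 / (C * a)) * ennreal (C * a) = 1"
          using k by (subst ennreal_mult[symmetric]) auto
        finally show "ennreal (?n s / (C * a)) \<le> ennreal (1 + s) * S (B (W s f))" by simp
      qed (use k in simp)
      then have "integral {t..b} ?n / (C * a) \<le> I"
        using ennreal_le_iff[of I] by (simp add: I_def)
      then have "integral {t..b} ?n \<le> C * a * I" using k
          by (simp add: pos_divide_le_eq mult.commute)
      then show ?thesis using norm_difference_le[OF L b, of f] by (simp add: algebra_simps)
    qed
    \<comment> \<open>For fixed a the map \<open>?L\<close> is bounded, so the limit defining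
      \<open>f'\<close> can be taken inside it.\<close>
    have "((\<lambda>b. norm (?L (?F b - ?F t))) \<longlongrightarrow> norm (?L (f' - ?F t))) at_top"
      by (intro tendsto_norm bounded_linear.tendsto[OF L] tendsto_diff f' tendsto_const)
    then have "norm (?L (f' - ?F t)) \<le> C * I * a"
      by (rule tendsto_upperbound)
        (use bound in \<open>auto simp: eventually_at_top_linorder\<close>)
    then show "norm (E a (U t f' - W t f) - (U t f' - W t f)) \<le> C * I * a"
      by (simp add: U.bl_simps)
  qed
  then obtain g where g: "\<And>t. 0 \<le> t \<Longrightarrow> (U t f' - W t f, g t) \<in> generator E"
    "\<And>t. 0 \<le> t \<Longrightarrow> norm (g t) \<le> C * I" by metis
  \<comment> \<open>Only the middle term grows with t.\<close>
  define v where "v t = W t q + t *\<^sub>R W t p + g t" for t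
  have "(U t f', v t) \<in> generator E" if t: "0 \<le> t" for t
    using subspace_add[OF E.subspace_generator free[OF t] g(1)[OF t]] by (simp add: v_def)
  moreover have "((\<lambda>t. (1 / t) *\<^sub>R U (- t) (v t)) \<longlongrightarrow> p') at_top"
  proof -
    have "((\<lambda>t. (1 / t) *\<^sub>R U (- t) (W t q + g t)) \<longlongrightarrow> 0) at_top"
    proof (rule Lim_null_comparison)
      show "\<forall>\<^sub>F t in at_top. norm ((1 / t) *\<^sub>R U (- t) (W t q + g t)) \<le> (norm q + C * I) / t"
        unfolding eventually_at_top_linorder
      proof (intro exI[of _ 1] allI impI)
        fix t :: real assume t: "1 \<le> t"
        have "norm (W t q + g t) \<le> norm q + C * I"
          using norm_triangle_ineq[of "W t q" "g t"] g(2)[of t] t by simp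
        then show "norm ((1 / t) *\<^sub>R U (- t) (W t q + g t)) \<le> (norm q + C * I) / t"
          using t by (simp add: divide_right_mono)
      qed
      show "((\<lambda>t. (norm q + C * I) / t) \<longlongrightarrow> 0) at_top"
        by (rule tendsto_divide_0[OF tendsto_const filterlim_at_top_imp_at_infinity[OF
            filterlim_ident]])
    qed
    from tendsto_add[OF this p']
    have "((\<lambda>t. (1 / t) *\<^sub>R U (- t) (W t q + g t) + U (- t) (W t p)) \<longlongrightarrow> p') at_top" by simp
    moreover have "\<forall>\<^sub>F t in at_top. (1 / t) *\<^sub>R U (- t) (W t q + g t) + U (- t) (W t p)
        = (1 / t) *\<^sub>R U (- t) (v t)"
      unfolding eventually_at_top_linorder
      by (intro exI[of _ 1]) (auto simp: v_def U.bl_simps scaleR_add_right)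
    ultimately show ?thesis by (rule Lim_transform_eventually)
  qed
  ultimately show ?thesis by blast
qed

end

section \<open>Elements of \<open>L2\<close> as functions\<close>

lemma square_integrable_rep [simp]: "square_integrable (rep_L2 f)"
  using Quotient3_rep_reflp[OF Quotient3_L2] by blast

lemma abs_rep_L2: "abs_L2 (rep_L2 f) = f"
  by (rule Quotient3_abs_rep[OF Quotient3_L2])

lemma L2_eqI:
  assumes "AE x in ref_measure. rep_L2 f x = rep_L2 g x"
  shows "f = g"
  using Quotient3_rel_rep[OF Quotient3_L2, of f g] assms by simp

lemma rep_abs_L2: "square_integrable f \<Longrightarrow> AE x in ref_measure. rep_L2 (abs_L2 f) x = f x"
  using Quotient3_rel[OF Quotient3_L2, of "rep_L2 (abs_L2 f)" f] by (simp add: abs_rep_L2)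

lemma measurable_rep_L2 [measurable]: "rep_L2 f \<in> borel_measurable ref_measure"
  using square_integrable_rep[of f] unfolding square_integrable_def by blast

lemma integrable_rep_L2: "integrable ref_measure (\<lambda>x. (norm (rep_L2 f x))\<^sup>2)"
  using square_integrable_rep[of f] unfolding square_integrable_def by blast

lemma rep_plus_L2: "AE x in ref_measure. rep_L2 (f + g) x = rep_L2 f x + rep_L2 g x"
  unfolding plus_L2_def map_fun_def o_def id_def
  by (intro rep_abs_L2 square_integrable_add square_integrable_rep)

lemma rep_zero_L2: "AE x in ref_measure. rep_L2 0 x = 0"
  unfolding zero_L2_def by (intro rep_abs_L2 square_integrable_0)

lemma rep_scaleC: "AE x in ref_measure. rep_L2 (c *\<^sub>C f) x = c * rep_L2 f x"
  unfolding scaleC_def map_fun_def o_def id_def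
  by (intro rep_abs_L2 square_integrable_mult square_integrable_rep)

lemma rep_scaleR_L2: "AE x in ref_measure. rep_L2 (r *\<^sub>R f) x = of_real r * rep_L2 f x"
  unfolding scaleR_L2_def map_fun_def o_def id_def
  by (intro rep_abs_L2 square_integrable_mult square_integrable_rep)

lemma rep_minus_L2: "AE x in ref_measure. rep_L2 (f - g) x = rep_L2 f x - rep_L2 g x"
proof -
  have "f - g = f + (- 1) *\<^sub>R g" by simp
  then show ?thesis
    using rep_plus_L2[of f "(- 1) *\<^sub>R g"] rep_scaleR_L2[of "- 1" g] by (simp only:) auto
qed

lemma inner_L2: "f \<bullet> g = (\<integral>x. rep_L2 f x \<bullet> rep_L2 g x \<partial>ref_measure)"
  by (simp add: inner_L2_def)

lemma norm_L2: "(norm f)\<^sup>2 = (\<integral>x. (norm (rep_L2 f x))\<^sup>2 \<partial>ref_measure)"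
  by (simp add: power2_norm_eq_inner inner_L2)

lemma nn_norm_L2: "ennreal ((norm f)\<^sup>2) = (\<integral>\<^sup>+x. ennreal ((norm (rep_L2 f x))\<^sup>2) \<partial>ref_measure)"
  unfolding norm_L2 using integrable_rep_L2[of f] by (intro nn_integral_eq_integral[symmetric]) auto

lemma nn_norm_abs_L2:
  assumes "square_integrable f"
  shows "ennreal ((norm (abs_L2 f))\<^sup>2) = (\<integral>\<^sup>+x. ennreal ((norm (f x))\<^sup>2) \<partial>ref_measure)"
  unfolding nn_norm_L2 using rep_abs_L2[OF assms] by (intro nn_integral_cong_AE) auto

lemma square_integrableI:
  assumes f: "f \<in> borel_measurable ref_measure"
    and le: "(\<integral>\<^sup>+x. ennreal ((norm (f x))\<^sup>2) \<partial>ref_measure) \<le> ennreal (C\<^sup>2)" and C: "0 \<le> C"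
  shows "square_integrable f" "norm (abs_L2 f) \<le> C"
proof -
  have "(\<integral>\<^sup>+x. ennreal ((norm (f x))\<^sup>2) \<partial>ref_measure) < \<infinity>"
    using le by (rule le_less_trans) simp
  then show si: "square_integrable f"
    unfolding square_integrable_def using f by (auto intro!: integrableI_bounded)
  have "(norm (abs_L2 f))\<^sup>2 \<le> C\<^sup>2"
    using le unfolding nn_norm_abs_L2[OF si, symmetric] by simp
  then show "norm (abs_L2 f) \<le> C" using C by (rule power2_le_imp_le)
qed

lemma square_integrable_bounded_mult:
  assumes u: "u \<in> borel_measurable ref_measure" and K: "AE x in ref_measure. norm (u x) \<le> K"
    and f: "square_integrable f"
  shows "square_integrable (\<lambda>x. u x * f x)"
  unfolding square_integrable_def
proof (intro conjI)
  have m [measurable]: "f \<in> borel_measurable ref_measure" "u \<in> borel_measurable ref_measure"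
    using f u by (auto simp: square_integrable_def)
  show "(\<lambda>x. u x * f x) \<in> borel_measurable ref_measure" by measurable
  show "integrable ref_measure (\<lambda>x. (norm (u x * f x))\<^sup>2)"
  proof (rule Bochner_Integration.integrable_bound)
    show "integrable ref_measure (\<lambda>x. K\<^sup>2 * (norm (f x))\<^sup>2)"
      using f by (auto simp: square_integrable_def)
    show "AE x in ref_measure. norm ((norm (u x * f x))\<^sup>2) \<le> norm (K\<^sup>2 * (norm (f x))\<^sup>2)"
      using K by eventually_elim (auto simp: norm_mult power_mult_distrib intro!: mult_right_mono
          power_mono)
  qed measurable
qed

section \<open>Complex scalars\<close>

lemma scaleC_add_right: "c *\<^sub>C (f + g) = c *\<^sub>C f + c *\<^sub>C g"
  by transfer (auto simp: distrib_left intro: square_integrable_add square_integrable_mult)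

lemma scaleC_scaleC [simp]: "c *\<^sub>C (c' *\<^sub>C f) = (c * c') *\<^sub>C f"
  by transfer (auto simp: ac_simps intro: square_integrable_mult)

lemma scaleC_one [simp]: "1 *\<^sub>C f = f"
  by transfer auto

lemma scaleC_minus_left: "(- c) *\<^sub>C f = - (c *\<^sub>C f)"
  by transfer (auto intro: square_integrable_mult square_integrable_mult[where c
      = "-1", simplified])

lemma scaleC_of_real: "of_real r *\<^sub>C f = r *\<^sub>R f"
  by transfer (auto intro: square_integrable_mult)

lemma scaleC_scaleR: "c *\<^sub>C (r *\<^sub>R f) = r *\<^sub>R (c *\<^sub>C f)"
  by (simp add: mult.commute flip: scaleC_of_real)

lemma scaleC_Re_Im: "c *\<^sub>C f = Re c *\<^sub>R f + Im c *\<^sub>R (\<i> *\<^sub>C f)"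
proof -
  have "c *\<^sub>C f = (of_real (Re c) *\<^sub>C f) + (of_real (Im c) *\<^sub>C (\<i> *\<^sub>C f))"
  proof (rule L2_eqI)
    show "AE x in ref_measure. rep_L2 (c *\<^sub>C f) x = rep_L2 (of_real (Re c) *\<^sub>C f + of_real (Im c)
        *\<^sub>C (\<i> *\<^sub>C f)) x"
      using rep_scaleC[of c f] rep_scaleC[of "of_real (Re c)" f] rep_scaleC[of "of_real (Im c)" "\<i>
          *\<^sub>C f"]
        rep_scaleC[of \<i> f] rep_plus_L2[of "of_real (Re c) *\<^sub>C f" "of_real (Im c) *\<^sub>C (\<i> *\<^sub>C f)"]
      by eventually_elim (simp add: complex_eq_iff)
  qed
  then show ?thesis by (simp only: scaleC_of_real)
qed

lemma norm_scaleC [simp]: "norm (c *\<^sub>C f) = norm c * norm f"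
proof -
  have "(norm (c *\<^sub>C f))\<^sup>2 = (\<integral>x. (norm c)\<^sup>2 * (norm (rep_L2 f x))\<^sup>2 \<partial>ref_measure)"
    unfolding norm_L2 using rep_scaleC[of c f]
    by (intro integral_cong_AE) (auto simp: norm_mult power_mult_distrib)
  also have "\<dots> = (norm c * norm f)\<^sup>2" by (simp add: norm_L2 power_mult_distrib)
  finally show ?thesis by (simp add: power2_eq_imp_eq)
qed

lemma bounded_linear_scaleC: "bounded_linear ((*\<^sub>C) c)"
  by (rule bounded_linear_intro[where K = "norm c"]) (auto simp: scaleC_add_right scaleC_scaleR)

lemmas linear_scaleC = bounded_linear.linear[OF bounded_linear_scaleC]

section \<open>Completeness\<close>

text \<open>The Riesz-Fischer argument: a rapidly convergent subsequence converges almost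
  everywhere, and Fatou's lemma identifies the pointwise limit as the limit in norm.\<close>

instance L2 :: (ref_measure) banach
proof
  fix X :: "nat \<Rightarrow> 'a L2"
  assume X: "Cauchy X"
  have "\<exists>N. \<forall>i\<ge>N. \<forall>j\<ge>N. norm (X i - X j) < (1/2) ^ n" for n
    using X[unfolded Cauchy_iff, rule_format, of "(1/2) ^ n"] by auto
  then obtain N where N: "\<And>n i j. N n \<le> i \<Longrightarrow> N n \<le> j \<Longrightarrow> norm (X i - X j) < (1/2) ^ n"
    by metis
  define r where "r n = (\<Sum>k\<le>n. Suc (N k))" for n
  have r: "strict_mono r" unfolding strict_mono_Suc_iff by (simp add: r_def)
  have Nr: "N n \<le> r m" if "n \<le> m" for n m
  proof -
    have "N n \<le> Suc (N n)" by simp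
    also have "\<dots> \<le> r m" unfolding r_def using that by (intro member_le_sum) auto
    finally show ?thesis .
  qed
  define Y where "Y n = rep_L2 (X (r n))" for n
  have Y_m [measurable]: "Y n \<in> borel_measurable ref_measure" for n
    by (simp add: Y_def)
  have YY: "(\<integral>\<^sup>+x. ennreal ((norm (Y i x - Y j x))\<^sup>2) \<partial>ref_measure)
      = ennreal ((norm (X (r i) - X (r j)))\<^sup>2)" for i j
    unfolding nn_norm_L2 Y_def using rep_minus_L2[of "X (r i)" "X (r j)"]
    by (intro nn_integral_cong_AE) auto
  have YY_le: "(\<integral>\<^sup>+x. ennreal ((norm (Y i x - Y j x))\<^sup>2) \<partial>ref_measure) \<le> ennreal (((1/2) ^ k)\<^sup>2)"
    if "k \<le> i" "k \<le> j" for i j k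
    unfolding YY using N[OF Nr[OF that(1)] Nr[OF that(2)]]
    by (intro ennreal_leI power_mono) auto
  \<comment> \<open>The weight 2^n leaves the integrals summable, since 2^n 4^(-n) = 2^(-n). By g
    \<le> 2^(-n) + 2^n g^2, pointwise summability of the weighted squares gives that of the
    increments.\<close>
  let ?G = "\<lambda>n x. 2 ^ n * (norm (Y (Suc n) x - Y n x))\<^sup>2"
  have "(\<integral>\<^sup>+x. (\<Sum>n. ennreal (?G n x)) \<partial>ref_measure) = (\<Sum>n. \<integral>\<^sup>+x. ennreal (?G n x) \<partial>ref_measure)"
    by (rule nn_integral_suminf) measurable
  also have "\<dots> \<le> (\<Sum>n. ennreal ((1/2) ^ n))"
  proof (intro suminf_le allI)
    fix n
    have "(\<integral>\<^sup>+x. ennreal (?G n x) \<partial>ref_measure)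
        = ennreal (2 ^ n) * (\<integral>\<^sup>+x. ennreal ((norm (Y (Suc n) x - Y n x))\<^sup>2) \<partial>ref_measure)"
      by (subst nn_integral_cmult[symmetric]) (auto simp: ennreal_mult)
    also have "\<dots> \<le> ennreal (2 ^ n) * ennreal (((1/2) ^ n)\<^sup>2)"
      by (intro mult_left_mono YY_le) auto
    also have "\<dots> = ennreal ((1/2) ^ n)"
      by (subst ennreal_mult[symmetric]) (auto simp: power2_eq_square power_divide)
    finally show "(\<integral>\<^sup>+x. ennreal (?G n x) \<partial>ref_measure) \<le> ennreal ((1/2) ^ n)" .
  qed auto
  also have "\<dots> = ennreal (\<Sum>n. (1/2) ^ n)"
    by (rule suminf_ennreal2) auto
  also have "\<dots> < \<infinity>" by simp
  finally have "AE x in ref_measure. (\<Sum>n. ennreal (?G n x)) \<noteq> \<infinity>"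
    by (intro nn_integral_PInf_AE) auto
  then have conv: "AE x in ref_measure. convergent (\<lambda>n. Y n x)"
  proof eventually_elim
    fix x assume "(\<Sum>n. ennreal (?G n x)) \<noteq> \<infinity>"
    then have "summable (\<lambda>n. ?G n x)" by (intro summable_suminf_not_top) auto
    then have s: "summable (\<lambda>n. (1/2) ^ n + ?G n x)" by (intro summable_add) auto
    have le: "norm (Y (Suc n) x - Y n x) \<le> (1/2) ^ n + ?G n x" for n
    proof -
      define g where "g = norm (Y (Suc n) x - Y n x)"
      have "0 \<le> (2 ^ n * g - 1)\<^sup>2" by simp
      then have "2 * (2 ^ n * g) \<le> 1 + (2 ^ n * g)\<^sup>2" by (simp add: power2_diff)
      moreover have "0 \<le> 2 ^ n * g" by (simp add: g_def)
      ultimately have "2 ^ n * g \<le> 1 + (2 ^ n * g)\<^sup>2" by linarith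
      then have "(1/2) ^ n * (2 ^ n * g) \<le> (1/2) ^ n * (1 + (2 ^ n * g)\<^sup>2)"
        by (intro mult_left_mono) auto
      moreover have "(1/2) ^ n * (2 ^ n * g) = g" by (simp add: power_divide)
      moreover have "(1/2) ^ n * (1 + (2 ^ n * g)\<^sup>2) = (1/2) ^ n + 2 ^ n * g\<^sup>2"
        by (simp add: power_divide power2_eq_square distrib_left)
      ultimately have "g \<le> (1/2) ^ n + 2 ^ n * g\<^sup>2" by (simp only:)
      then show ?thesis by (simp only: g_def)
    qed
    have "summable (\<lambda>n. Y (Suc n) x - Y n x)"
      by (rule summable_comparison_test'[OF s, of 0]) (use le in auto)
    then have "convergent (\<lambda>n. \<Sum>i<n. Y (Suc i) x - Y i x)" by (simp add: summable_iff_convergent)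
    then have "convergent (\<lambda>n. Y n x - Y 0 x)" 
      unfolding sum_lessThan_telescope[of "\<lambda>n. Y n x"] .
    then show "convergent (\<lambda>n. Y n x)"
      using convergent_diff[of "\<lambda>n. Y n x - Y 0 x" "\<lambda>n. - Y 0 x"] by (simp add: convergent_const)
  qed
  define L where "L x = lim (\<lambda>n. Y n x)" for x
  have L_m [measurable]: "L \<in> borel_measurable ref_measure"
    unfolding L_def by (rule borel_measurable_lim_metric) measurable
  have L: "AE x in ref_measure. (\<lambda>n. Y n x) \<longlonglongrightarrow> L x"
    using conv unfolding L_def by eventually_elim (simp add: convergent_LIMSEQ_iff)
  \<comment> \<open>This precedes square integrability of \<open>L\<close>, which is deduced from it
    by adding \<open>Y 0\<close>.\<close>
  have fatou: "(\<integral>\<^sup>+x. ennreal ((norm (L x - Y k x))\<^sup>2) \<partial>ref_measure) \<le> ennreal (((1/2) ^ k)\<^sup>2)"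
      for k
  proof -
    have "(\<integral>\<^sup>+x. ennreal ((norm (L x - Y k x))\<^sup>2) \<partial>ref_measure)
        \<le> (\<integral>\<^sup>+x. liminf (\<lambda>n. ennreal ((norm (Y n x - Y k x))\<^sup>2)) \<partial>ref_measure)"
    proof (rule nn_integral_mono_AE)
      show "AE x in ref_measure. ennreal ((norm (L x - Y k x))\<^sup>2)
          \<le> liminf (\<lambda>n. ennreal ((norm (Y n x - Y k x))\<^sup>2))"
        using L
      proof eventually_elim
        fix x assume "(\<lambda>n. Y n x) \<longlonglongrightarrow> L x"
        then have "(\<lambda>n. ennreal ((norm (Y n x - Y k x))\<^sup>2)) \<longlonglongrightarrow> ennreal ((norm (L x - Y k x))\<^sup>2)"
          by (intro tendsto_intros) auto
        then show "ennreal ((norm (L x - Y k x))\<^sup>2) \<le> liminf (\<lambda>n. ennreal ((norm (Y n x - Y k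
            x))\<^sup>2))"
          by (simp only: lim_imp_Liminf[OF sequentially_bot] order_refl)
      qed
    qed
    also have "\<dots> \<le> liminf (\<lambda>n. \<integral>\<^sup>+x. ennreal ((norm (Y n x - Y k x))\<^sup>2) \<partial>ref_measure)"
      by (rule nn_integral_liminf) measurable
    also have "\<dots> \<le> liminf (\<lambda>n. ennreal (((1/2) ^ k)\<^sup>2))"
      by (rule Liminf_mono) (use YY_le[of k] in \<open>auto simp: eventually_sequentially intro!: exI[of
          _ k]\<close>)
    finally show ?thesis by (simp add: Liminf_const)
  qed
  have LY: "square_integrable (\<lambda>x. L x - Y k x)" "norm (abs_L2 (\<lambda>x. L x - Y k x)) \<le> (1/2) ^ k" for k
    by (rule square_integrableI[OF borel_measurable_diff[OF L_m Y_m] fatou], simp)+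
  have si: "square_integrable L"
    using square_integrable_add[OF LY(1)[of 0] square_integrable_rep[of "X (r 0)"]]
        by (simp add: Y_def)
  have "abs_L2 L - X (r k) = abs_L2 (\<lambda>x. L x - Y k x)" for k
  proof (rule L2_eqI)
    show "AE x in ref_measure. rep_L2 (abs_L2 L - X (r k)) x = rep_L2 (abs_L2 (\<lambda>x. L x - Y k x)) x"
      using rep_minus_L2[of "abs_L2 L" "X (r k)"] rep_abs_L2[OF si] rep_abs_L2[OF LY(1)[of k]]
      by eventually_elim (simp add: Y_def)
  qed
  then have le: "norm (X (r k) - abs_L2 L) \<le> (1/2) ^ k" for k
    unfolding norm_minus_commute[of "X (r k)"] using LY(2)[of k] by simp
  have "(\<lambda>k. X (r k) - abs_L2 L) \<longlonglongrightarrow> 0"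
  proof (rule Lim_null_comparison)
    show "\<forall>\<^sub>F k in sequentially. norm (X (r k) - abs_L2 L) \<le> (1/2) ^ k"
      by (intro always_eventually allI le)
    show "(\<lambda>k. (1/2) ^ k) \<longlonglongrightarrow> (0::real)" by (rule LIMSEQ_realpow_zero) auto
  qed
  then have "(X \<circ> r) \<longlonglongrightarrow> abs_L2 L" by (simp add: LIM_zero_iff o_def)
  then have "X \<longlonglongrightarrow> abs_L2 L" using X r Cauchy_converges_subseq by blast
  then show "convergent X" by (auto simp: convergent_def)
qed

section \<open>Multiplication operators\<close>

text \<open>Meaningful for essentially bounded \<open>u\<close> only; otherwise the product may fail
  to be square integrable and \<open>abs_L2\<close> is applied outside its intended range.\<close>

definition mul :: "('a::ref_measure \<Rightarrow> complex) \<Rightarrow> 'a L2 \<Rightarrow> 'a L2" where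
  "mul u f = abs_L2 (\<lambda>x. u x * rep_L2 f x)"

lemma rep_mul:
  assumes "u \<in> borel_measurable ref_measure" "AE x in ref_measure. norm (u x) \<le> K"
  shows "AE x in ref_measure. rep_L2 (mul u f) x = u x * rep_L2 f x"
  unfolding mul_def by (intro rep_abs_L2 square_integrable_bounded_mult[OF assms]
      square_integrable_rep)

lemma bounded_linear_mul:
  assumes "u \<in> borel_measurable ref_measure" "AE x in ref_measure. norm (u x) \<le> K"
  shows "bounded_linear (mul u)"
proof (rule bounded_linear_intro[where K = "\<bar>K\<bar>"])
  note r = rep_mul[OF assms]
  show "mul u (f + g) = mul u f + mul u g" for f g
    by (rule L2_eqI)
      (use r[of f] r[of g] r[of "f + g"] rep_plus_L2[of f g] rep_plus_L2[of "mul u f" "mul u g"]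
        in eventually_elim, simp add: distrib_left)
  show "mul u (a *\<^sub>R f) = a *\<^sub>R mul u f" for a f
    by (rule L2_eqI)
      (use r[of f] r[of "a *\<^sub>R f"] rep_scaleR_L2[of a f] rep_scaleR_L2[of a "mul u f"]
        in eventually_elim, simp)
  show "norm (mul u f) \<le> norm f * \<bar>K\<bar>" for f
  proof -
    have "(norm (mul u f))\<^sup>2 \<le> (\<integral>x. K\<^sup>2 * (norm (rep_L2 f x))\<^sup>2 \<partial>ref_measure)"
      unfolding norm_L2
    proof (rule integral_mono_AE)
      show "AE x in ref_measure. (norm (rep_L2 (mul u f) x))\<^sup>2 \<le> K\<^sup>2 * (norm (rep_L2 f x))\<^sup>2"
        using r[of f] assms(2)
        by eventually_elim (auto simp: norm_mult power_mult_distrib intro!: mult_right_mono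
            power_mono)
    qed (auto intro: integrable_rep_L2)
    also have "\<dots> = (norm f * \<bar>K\<bar>)\<^sup>2" by (simp add: norm_L2 power_mult_distrib)
    finally show ?thesis by (rule power2_le_imp_le) simp
  qed
qed

lemma mul_scaleC:
  assumes "u \<in> borel_measurable ref_measure" "AE x in ref_measure. norm (u x) \<le> K"
  shows "mul u (c *\<^sub>C f) = c *\<^sub>C mul u f"
  by (rule L2_eqI)
    (use rep_mul[OF assms, of f] rep_mul[OF assms, of "c *\<^sub>C f"] rep_scaleC[of c f] rep_scaleC[of
        c "mul u f"]
      in eventually_elim, simp)

lemma mult_op_unique: "(f, g) \<in> mult_op m \<Longrightarrow> (f, g') \<in> mult_op m \<Longrightarrow> g = g'"
  unfolding mult_op_def by (intro L2_eqI) (auto elim: AE_mp)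

lemma app_mult_op: "(f, g) \<in> mult_op m \<Longrightarrow> app (mult_op m) f = g"
  unfolding app_def by (blast intro: mult_op_unique)

lemma mult_op_bounded:
  assumes "ess_bounded V"
  shows "mult_op V = {(f, mul (\<lambda>x. of_real (V x)) f) |f. True}"
proof -
  obtain C where C: "V \<in> borel_measurable ref_measure" "AE x in ref_measure. \<bar>V x\<bar> \<le> C"
    using assms by (auto simp: ess_bounded_def)
  have *: "(f, mul (\<lambda>x. of_real (V x)) f) \<in> mult_op V" for f
    using rep_mul[of "\<lambda>x. of_real (V x)" C f] C by (simp add: mult_op_def)
  show ?thesis
  proof safe
    fix f g assume "(f, g) \<in> mult_op V"
    then have "g = mul (\<lambda>x. of_real (V x)) f" using * by (rule mult_op_unique)
    then show "\<exists>f'. (f, g) = (f', mul (\<lambda>x. of_real (V x)) f') \<and> True" by simp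
  qed (rule *)
qed

lemma ess_boundedD:
  assumes "ess_bounded V"
  obtains K where "(\<lambda>x. complex_of_real (V x)) \<in> borel_measurable ref_measure"
    "AE x in ref_measure. norm (complex_of_real (V x)) \<le> K"
  using assms by (auto simp: ess_bounded_def)

section \<open>Strong continuity and dominated convergence in L2\<close>

lemma ortho_groupI:
  assumes linear: "\<And>t. linear (U t)" and norm: "\<And>t f. norm (U t f) = norm f"
    and zero: "\<And>f. U 0 f = f" and add: "\<And>s t f. U (s + t) f = U s (U t f)"
    and cont: "\<And>f. ((\<lambda>t. U t f) \<longlongrightarrow> f) (at 0)"
  shows "ortho_group U"
proof (rule ortho_group.intro)
  show "continuous_on UNIV (\<lambda>t. U t f)" for f
    unfolding continuous_on_eq_continuous_at[OF open_UNIV] isCont_def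
  proof
    fix t
    have "((\<lambda>h. norm (U h f - f)) \<longlongrightarrow> 0) (at 0)"
      using cont[of f] by (simp add: tendsto_norm_zero LIM_zero)
    moreover have "norm (U (t + h) f - U t f) = norm (U h f - f)" for h
      by (simp add: add norm flip: linear_diff[OF linear])
    ultimately have "((\<lambda>h. norm (U (t + h) f - U t f)) \<longlongrightarrow> 0) (at 0)" by simp
    then have "((\<lambda>h. U (t + h) f) \<longlongrightarrow> U t f) (at 0)"
      by (simp add: tendsto_norm_zero_iff LIM_zero_iff)
    then show "((\<lambda>t. U t f) \<longlongrightarrow> U t f) (at t)"
      by (simp add: LIM_offset_zero_iff)
  qed
qed (fact assms)+

lemma L2_dominated_convergence:
  fixes F :: "nat \<Rightarrow> 'a::ref_measure L2"
  assumes lim: "AE x in ref_measure. (\<lambda>n. rep_L2 (F n) x) \<longlonglongrightarrow> rep_L2 f x"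
    and le: "\<And>n. AE x in ref_measure. norm (rep_L2 (F n) x) \<le> norm (rep_L2 w x)"
  shows "F \<longlonglongrightarrow> f"
proof -
  have all: "AE x in ref_measure. \<forall>n. norm (rep_L2 (F n) x) \<le> norm (rep_L2 w x)"
    using le by (simp add: AE_all_countable)
  have f_le: "AE x in ref_measure. norm (rep_L2 f x) \<le> norm (rep_L2 w x)"
    using lim all
  proof eventually_elim
    fix x assume "(\<lambda>n. rep_L2 (F n) x) \<longlonglongrightarrow> rep_L2 f x" "\<forall>n. norm (rep_L2 (F n) x) \<le> norm (rep_L2 w x)"
    then show "norm (rep_L2 f x) \<le> norm (rep_L2 w x)"
      by (intro LIMSEQ_le_const2[OF tendsto_norm]) auto
  qed
  have "(\<lambda>n. \<integral>x. (norm (rep_L2 (F n) x - rep_L2 f x))\<^sup>2 \<partial>ref_measure) \<longlonglongrightarrow> (\<integral>x. 0 \<partial>(ref_measure :: 'a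
      measure))"
  proof (rule integral_dominated_convergence[where w = "\<lambda>x. 4 * (norm (rep_L2 w x))\<^sup>2"])
    show "AE x in ref_measure. (\<lambda>n. (norm (rep_L2 (F n) x - rep_L2 f x))\<^sup>2) \<longlonglongrightarrow> 0"
      using lim
    proof eventually_elim
      fix x assume "(\<lambda>n. rep_L2 (F n) x) \<longlonglongrightarrow> rep_L2 f x"
      then have "(\<lambda>n. (norm (rep_L2 (F n) x - rep_L2 f x))\<^sup>2) \<longlonglongrightarrow> (norm (rep_L2 f x - rep_L2 f x))\<^sup>2"
        by (intro tendsto_intros)
      then show "(\<lambda>n. (norm (rep_L2 (F n) x - rep_L2 f x))\<^sup>2) \<longlonglongrightarrow> 0" by simp
    qed
    show "AE x in ref_measure. norm ((norm (rep_L2 (F n) x - rep_L2 f x))\<^sup>2)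
        \<le> 4 * (norm (rep_L2 w x))\<^sup>2" for n
      using le[of n] f_le
    proof eventually_elim
      fix x assume "norm (rep_L2 (F n) x) \<le> norm (rep_L2 w x)" "norm (rep_L2 f x)
          \<le> norm (rep_L2 w x)"
      then have "norm (rep_L2 (F n) x - rep_L2 f x) \<le> 2 * norm (rep_L2 w x)"
        using norm_triangle_ineq4[of "rep_L2 (F n) x" "rep_L2 f x"] by linarith
      from power_mono[OF this norm_ge_zero, of 2]
      show "norm ((norm (rep_L2 (F n) x - rep_L2 f x))\<^sup>2) \<le> 4 * (norm (rep_L2 w x))\<^sup>2"
        by (simp add: power_mult_distrib)
    qed
  qed (auto intro: integrable_rep_L2)
  moreover have "(\<integral>x. (norm (rep_L2 (F n) x - rep_L2 f x))\<^sup>2 \<partial>ref_measure) = (norm (F n - f))\<^sup>2"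
      for n
    unfolding norm_L2 using rep_minus_L2[of "F n" f] by (intro integral_cong_AE) auto
  ultimately have "(\<lambda>n. (norm (F n - f))\<^sup>2) \<longlonglongrightarrow> 0" by simp
  from tendsto_real_sqrt[OF this] have "(\<lambda>n. norm (F n - f)) \<longlonglongrightarrow> 0" by simp
  then show ?thesis by (simp add: tendsto_norm_zero_iff LIM_zero_iff)
qed

section \<open>The unitary group of a multiplication operator\<close>

text \<open>The group exp(i a Q) with Q the multiplication by \<open>m\<close>. Taking
  \<open>m\<close> to be a coordinate function gives the position phases on both spaces.\<close>

definition phase :: "('a::ref_measure \<Rightarrow> real) \<Rightarrow> real \<Rightarrow> 'a L2 \<Rightarrow> 'a L2" where
  "phase m a = mul (\<lambda>x. cis (a * m x))"

lemma norm_cis_diff_le: "norm (cis t - 1) \<le> \<bar>t\<bar>"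
proof -
  have d: "(cis has_vector_derivative \<i> * cis x) (at x)" for x
  proof -
    have "((\<lambda>z. exp (\<i> * z)) has_field_derivative \<i> * cis x) (at (of_real x))"
      by (auto intro!: derivative_eq_intros simp: cis_conv_exp)
    from has_vector_derivative_real_field[OF this, of UNIV] show ?thesis
      by (simp add: cis_conv_exp[abs_def])
  qed
  have "norm (cis t - cis 0 - (t - 0) *\<^sub>R 0) \<le> \<bar>t - 0\<bar> * 1"
    by (rule vector_derivative_bound[OF d]) (simp add: norm_mult)
  then show ?thesis by simp
qed

lemma cis_quotient_tendsto: "((\<lambda>a. (cis (a * y) - 1) /\<^sub>R a) \<longlongrightarrow> \<i> * of_real y) (at 0)"
proof -
  have "((\<lambda>z. exp (\<i> * of_real y * z)) has_field_derivative \<i> * of_real y) (at (of_real 0))"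
    by (auto intro!: derivative_eq_intros)
  from has_vector_derivative_real_field[OF this, of UNIV]
  have "((\<lambda>a. cis (a * y)) has_vector_derivative \<i> * of_real y) (at 0)"
    by (simp add: cis_conv_exp mult_ac)
  then show ?thesis by (simp add: has_vector_derivative_iff_quotient)
qed

context
  fixes m :: "'a::ref_measure \<Rightarrow> real"
  assumes m [measurable]: "m \<in> borel_measurable ref_measure"
begin

lemma measurable_cis: "(\<lambda>x. cis (a * m x)) \<in> borel_measurable ref_measure"
  unfolding cis_conv_exp by measurable

lemma rep_phase: "AE x in ref_measure. rep_L2 (phase m a f) x = cis (a * m x) * rep_L2 f x"
  unfolding phase_def by (rule rep_mul[OF measurable_cis, where K = 1]) simp

lemma rep_phase_quotient:
  "AE x in ref_measure. rep_L2 ((phase m a f - f) /\<^sub>R r) x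
      = ((cis (a * m x) - 1) /\<^sub>R r) * rep_L2 f x"
  using rep_phase[of a f] rep_minus_L2[of "phase m a f" f] rep_scaleR_L2[of "inverse r" "phase m a
      f - f"]
  by eventually_elim (simp only: scaleR_conv_of_real left_diff_distrib mult_1_left mult.assoc)

lemma phase_scaleC: "phase m a (c *\<^sub>C f) = c *\<^sub>C phase m a f"
  unfolding phase_def by (rule mul_scaleC[OF measurable_cis, where K = 1]) simp

lemma ortho_group_phase: "ortho_group (phase m)"
proof (rule ortho_groupI)
  show "linear (phase m t)" for t
    unfolding phase_def by (rule bounded_linear.linear, rule bounded_linear_mul[OF measurable_cis,
        where K = 1]) simp
  show "norm (phase m t f) = norm f" for t f
  proof -
    have "(norm (phase m t f))\<^sup>2 = (norm f)\<^sup>2"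
      unfolding norm_L2 using rep_phase[of t f] by (intro integral_cong_AE) (auto simp: norm_mult)
    then show ?thesis by (simp add: power2_eq_imp_eq)
  qed
  show "phase m 0 f = f" for f
    by (rule L2_eqI) (use rep_phase[of 0 f] in eventually_elim, simp)
  show "phase m (s + t) f = phase m s (phase m t f)" for s t f
    by (rule L2_eqI) (use rep_phase[of "s + t" f] rep_phase[of s "phase m t f"] rep_phase[of t f]
      in eventually_elim, simp add: cis_mult distrib_right)
  show "((\<lambda>t. phase m t f) \<longlongrightarrow> f) (at 0)" for f
    unfolding tendsto_at_iff_sequentially
  proof (intro allI impI)
    fix X :: "nat \<Rightarrow> real" assume X: "X \<longlonglongrightarrow> 0"
    have all: "AE x in ref_measure. \<forall>n. rep_L2 (phase m (X n) f) x = cis (X n * m x) * rep_L2 f x"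
      unfolding AE_all_countable by (intro allI rep_phase)
    show "((\<lambda>t. phase m t f) \<circ> X) \<longlonglongrightarrow> f"
      unfolding o_def
    proof (rule L2_dominated_convergence[where w = f])
      show "AE x in ref_measure. (\<lambda>n. rep_L2 (phase m (X n) f) x) \<longlonglongrightarrow> rep_L2 f x"
        using all
      proof eventually_elim
        fix x assume *: "\<forall>n. rep_L2 (phase m (X n) f) x = cis (X n * m x) * rep_L2 f x"
        have "(\<lambda>n. cis (X n * m x) * rep_L2 f x) \<longlonglongrightarrow> cis (0 * m x) * rep_L2 f x"
          by (intro tendsto_intros X)
        then show "(\<lambda>n. rep_L2 (phase m (X n) f) x) \<longlonglongrightarrow> rep_L2 f x" by (simp add: *)
      qed
      show "AE x in ref_measure. norm (rep_L2 (phase m (X n) f) x) \<le> norm (rep_L2 f x)" for n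
        using rep_phase[of "X n" f] by eventually_elim (simp add: norm_mult)
    qed
  qed
qed

text \<open>Dominated convergence with the majorant |m f| = |g|, which bounds all difference
  quotients because |cis t - 1| \<le> |t|.\<close>

lemma generator_phaseI:
  assumes g: "(f, g) \<in> mult_op m"
  shows "(f, \<i> *\<^sub>C g) \<in> generator (phase m)"
  unfolding generator_def has_vector_derivative_iff_quotient mem_Collect_eq prod.case
    tendsto_at_iff_sequentially
proof (intro allI impI)
  interpret E: ortho_group "phase m" by (rule ortho_group_phase)
  fix X :: "nat \<Rightarrow> real" assume X0: "\<forall>i. X i \<in> UNIV - {0}" and X: "X \<longlonglongrightarrow> 0"
  let ?F = "\<lambda>n. (phase m (X n) f - f) /\<^sub>R X n"
  have F: "AE x in ref_measure. rep_L2 (?F n) x = ((cis (X n * m x) - 1) /\<^sub>R X n) * rep_L2 f x"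
      for n
    by (rule rep_phase_quotient)
  have G: "AE x in ref_measure. rep_L2 g x = of_real (m x) * rep_L2 f x"
    using g by (simp add: mult_op_def)
  have "?F \<longlonglongrightarrow> \<i> *\<^sub>C g"
  proof (rule L2_dominated_convergence[where w = g])
    have all: "AE x in ref_measure. \<forall>n. rep_L2 (?F n) x = ((cis (X n * m x) - 1) /\<^sub>R X n) * rep_L2
        f x"
      unfolding AE_all_countable by (intro allI F)
    show "AE x in ref_measure. (\<lambda>n. rep_L2 (?F n) x) \<longlonglongrightarrow> rep_L2 (\<i> *\<^sub>C g) x"
      using all G rep_scaleC[of \<i> g]
    proof eventually_elim
      fix x
      assume *: "\<forall>n. rep_L2 (?F n) x = ((cis (X n * m x) - 1) /\<^sub>R X n) * rep_L2 f x"
        and g: "rep_L2 g x = of_real (m x) * rep_L2 f x" "rep_L2 (\<i> *\<^sub>C g) x = \<i> * rep_L2 g x"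
      have "(\<lambda>n. (cis (X n * m x) - 1) /\<^sub>R X n) \<longlonglongrightarrow> \<i> * of_real (m x)"
        using cis_quotient_tendsto[of "m x"] X X0 unfolding tendsto_at_iff_sequentially o_def
            by blast
      then have "(\<lambda>n. ((cis (X n * m x) - 1) /\<^sub>R X n) * rep_L2 f x) \<longlonglongrightarrow> (\<i> * of_real (m x)) * rep_L2
          f x"
        by (rule tendsto_mult_right)
      then show "(\<lambda>n. rep_L2 (?F n) x) \<longlonglongrightarrow> rep_L2 (\<i> *\<^sub>C g) x"
        by (simp only: * g mult.assoc)
    qed
    show "AE x in ref_measure. norm (rep_L2 (?F n) x) \<le> norm (rep_L2 g x)" for n
      using F[of n] G
    proof eventually_elim
      fix x assume *: "rep_L2 (?F n) x = ((cis (X n * m x) - 1) /\<^sub>R X n) * rep_L2 f x"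
        and g: "rep_L2 g x = of_real (m x) * rep_L2 f x"
      have "norm ((cis (X n * m x) - 1) /\<^sub>R X n) \<le> \<bar>m x\<bar>"
      proof -
        have "norm ((cis (X n * m x) - 1) /\<^sub>R X n) = norm (cis (X n * m x) - 1) / \<bar>X n\<bar>"
          by (simp only: norm_scaleR abs_inverse divide_inverse_commute)
        also have "\<dots> \<le> \<bar>X n * m x\<bar> / \<bar>X n\<bar>"
          by (intro divide_right_mono norm_cis_diff_le) simp
        also have "\<dots> \<le> \<bar>m x\<bar>" by (simp add: abs_mult)
        finally show ?thesis .
      qed
      from mult_right_mono[OF this, of "norm (rep_L2 f x)"]
      show "norm (rep_L2 (?F n) x) \<le> norm (rep_L2 g x)"
        unfolding * g norm_mult by simp
    qed
  qed
  then show "((\<lambda>s. (phase m s f - phase m 0 f) /\<^sub>R (s - 0)) \<circ> X) \<longlonglongrightarrow> \<i> *\<^sub>C g"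
    by (simp add: o_def)
qed

text \<open>Fatou's lemma along a = 1/(n+1): the quotients (cis (a m) - 1) f / a have norm at most C
  and converge pointwise to i m f, whose square is therefore integrable with the same bound.\<close>

lemma mult_op_domainI:
  assumes le: "\<And>a. 0 < a \<Longrightarrow> a \<le> 1 \<Longrightarrow> norm (phase m a f - f) \<le> C * a"
  shows "\<exists>g. (f, g) \<in> mult_op m \<and> norm g \<le> C"
proof -
  have C: "0 \<le> C" using order_trans[OF norm_ge_zero le[of 1]] by simp
  define X where "X n = inverse (real (Suc n))" for n
  have X: "0 < X n" "X n \<le> 1" for n by (auto simp: X_def field_simps)
  have Xlim: "X \<longlonglongrightarrow> 0" unfolding X_def by (rule LIMSEQ_inverse_real_of_nat)
  let ?q = "\<lambda>n x. ((cis (X n * m x) - 1) /\<^sub>R X n) * rep_L2 f x"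
  have q_m: "?q n \<in> borel_measurable ref_measure" for n
    using measurable_cis[of "X n"] by measurable
  have q: "(\<integral>\<^sup>+x. ennreal ((norm (?q n x))\<^sup>2) \<partial>ref_measure) \<le> ennreal (C\<^sup>2)" for n
  proof -
    have "(\<integral>\<^sup>+x. ennreal ((norm (?q n x))\<^sup>2) \<partial>ref_measure)
        = ennreal ((norm ((phase m (X n) f - f) /\<^sub>R X n))\<^sup>2)"
      unfolding nn_norm_L2
    proof (rule nn_integral_cong_AE)
      show "AE x in ref_measure. ennreal ((norm (?q n x))\<^sup>2)
          = ennreal ((norm (rep_L2 ((phase m (X n) f - f) /\<^sub>R X n) x))\<^sup>2)"
        using rep_phase_quotient[where a = "X n" and f = f and r = "X n"] by eventually_elim simp
    qed
    also have "\<dots> \<le> ennreal (C\<^sup>2)"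
    proof (intro ennreal_leI power_mono norm_ge_zero)
      have "norm ((phase m (X n) f - f) /\<^sub>R X n) = norm (phase m (X n) f - f) / X n"
        using X(1)[of n] by (simp only: norm_scaleR abs_inverse divide_inverse_commute abs_of_pos)
      also have "\<dots> \<le> C" using le[OF X, of n] X(1)[of n] by (simp add: pos_divide_le_eq)
      finally show "norm ((phase m (X n) f - f) /\<^sub>R X n) \<le> C" .
    qed
    finally show ?thesis .
  qed
  have mf [measurable]: "(\<lambda>x. of_real (m x) * rep_L2 f x) \<in> borel_measurable ref_measure"
      by measurable
  have "(\<integral>\<^sup>+x. ennreal ((norm (of_real (m x) * rep_L2 f x))\<^sup>2) \<partial>ref_measure)
      \<le> (\<integral>\<^sup>+x. liminf (\<lambda>n. ennreal ((norm (?q n x))\<^sup>2)) \<partial>ref_measure)"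
  proof (rule nn_integral_mono)
    fix x
    have "(\<lambda>n. (cis (X n * m x) - 1) /\<^sub>R X n) \<longlonglongrightarrow> \<i> * of_real (m x)"
    proof -
      have "\<forall>n. X n \<in> UNIV - {0}" using X(1)[THEN less_imp_neq] by auto
      then show ?thesis
        using cis_quotient_tendsto[of "m x"] Xlim unfolding tendsto_at_iff_sequentially o_def
            by blast
    qed
    then have "(\<lambda>n. ennreal ((norm (?q n x))\<^sup>2)) \<longlonglongrightarrow> ennreal ((norm (\<i> * of_real (m x) * rep_L2 f
        x))\<^sup>2)"
      by (intro tendsto_ennrealI tendsto_power tendsto_norm tendsto_mult_right)
    then have "liminf (\<lambda>n. ennreal ((norm (?q n x))\<^sup>2)) = ennreal ((norm (\<i> * of_real (m x) *
        rep_L2 f x))\<^sup>2)"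
      by (rule lim_imp_Liminf[OF sequentially_bot])
    then show "ennreal ((norm (of_real (m x) * rep_L2 f x))\<^sup>2)
        \<le> liminf (\<lambda>n. ennreal ((norm (?q n x))\<^sup>2))"
      by (simp add: norm_mult)
  qed
  also have "\<dots> \<le> liminf (\<lambda>n. \<integral>\<^sup>+x. ennreal ((norm (?q n x))\<^sup>2) \<partial>ref_measure)"
    by (intro nn_integral_liminf measurable_compose[OF q_m]) measurable
  also have "\<dots> \<le> liminf (\<lambda>n. ennreal (C\<^sup>2))"
    by (intro Liminf_mono always_eventually allI q)
  also have "\<dots> = ennreal (C\<^sup>2)" by (simp add: Liminf_const)
  finally have si: "square_integrable (\<lambda>x. of_real (m x) * rep_L2 f x)"
    "norm (abs_L2 (\<lambda>x. of_real (m x) * rep_L2 f x)) \<le> C"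
    using square_integrableI[OF mf _ C] by auto
  then show ?thesis
    using rep_abs_L2[OF si(1)] by (intro exI[of _ "abs_L2 (\<lambda>x. of_real (m x) * rep_L2 f x)"])
        (simp add: mult_op_def)
qed

text \<open>A vector in the domain of the generator has a Lipschitz orbit, so the preceding
  criterion puts it in the domain of the multiplication; uniqueness of the generator identifies the
  value.\<close>

lemma generator_phaseD:
  assumes g: "(f, g) \<in> generator (phase m)"
  shows "(f, (- \<i>) *\<^sub>C g) \<in> mult_op m"
proof -
  interpret E: ortho_group "phase m" by (rule ortho_group_phase)
  have "norm (phase m a f - f) \<le> norm g * a" if "0 < a" for a
    using vector_derivative_bound[OF E.has_vector_derivative_orbit[OF g], of 0 a 0 "norm g"] that
    by (simp add: mult.commute)
  then obtain h where h: "(f, h) \<in> mult_op m" using mult_op_domainI by blast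
  have "\<i> *\<^sub>C h = g" by (rule generator_unique[OF generator_phaseI[OF h] g])
  then have "(- \<i>) *\<^sub>C g = h" by auto
  with h show ?thesis by simp
qed

end

section \<open>Unitary groups of self-adjoint operators\<close>

lemma unitary_groupD:
  assumes "unitary_group U"
  shows "ortho_group U"
proof (rule ortho_group.intro)
  show "linear (U t)" for t
    using assms unfolding unitary_group_def by (intro linearI) (metis, metis scaleC_of_real)
qed (use assms in \<open>auto simp: unitary_group_def\<close>)

definition skew_graph :: "'a::ref_measure L2 operator \<Rightarrow> 'a L2 operator" where
  "skew_graph H = {(f, (- \<i>) *\<^sub>C g) |f g. (f, g) \<in> H}"

text \<open>Self-adjointness expressed through the real theory: skew-adjointness of -iH over the
  reals, together with invariance of the graph under i, which restores complex linearity.\<close>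

definition self_adjoint :: "'a::ref_measure L2 operator \<Rightarrow> bool" where
  "self_adjoint H \<longleftrightarrow> (\<exists>c. skew_adjoint (skew_graph H) c) \<and> (\<forall>f g. (f, g) \<in> H \<longrightarrow> (\<i> *\<^sub>C f, \<i> *\<^sub>C g) \<in>
      H)"

lemma skew_graph_iff: "(f, h) \<in> skew_graph H \<longleftrightarrow> (f, \<i> *\<^sub>C h) \<in> H"
  by (force simp: skew_graph_def)

lemma self_adjoint_dense: "self_adjoint H \<Longrightarrow> closure (Domain (skew_graph H)) = UNIV"
  unfolding self_adjoint_def using skew_adjoint.dense by blast

text \<open>Stone's theorem gives existence and the generator determines the group, so the definite
  description defining \<open>exp_mi\<close> denotes; from then on the group is used only through
  these three facts.\<close>

lemma exp_mi:
  assumes H: "self_adjoint H"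
  shows ortho_group_exp_mi: "ortho_group (exp_mi H)"
    and generator_exp_mi: "generator (exp_mi H) = skew_graph H"
    and exp_mi_scaleC: "exp_mi H t (c *\<^sub>C f) = c *\<^sub>C exp_mi H t f"
proof -
  let ?P = "\<lambda>U. unitary_group U \<and> H = {(f, g). ((\<lambda>t. U t f)
      has_vector_derivative (- \<i>) *\<^sub>C g) (at 0)}"
  note dense = self_adjoint_dense[OF H]
  have gen: "generator U = skew_graph H" if "?P U" for U
  proof -
    have "(f, h) \<in> generator U \<longleftrightarrow> (f, \<i> *\<^sub>C h) \<in> H" for f h
      by (subst conjunct2[OF that]) (simp add: generator_def)
    then show ?thesis by (auto simp: skew_graph_iff)
  qed
  obtain U where U: "ortho_group U" "generator U = skew_graph H"
    using H skew_adjoint.stone unfolding self_adjoint_def by metis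
  interpret U: ortho_group U by (rule U)
  \<comment> \<open>U conjugated by i has the same generator because H commutes with i. Uniqueness
    makes it equal to U, and this is complex linearity.\<close>
  let ?V = "\<lambda>t f. (- \<i>) *\<^sub>C U t (\<i> *\<^sub>C f)"
  have "ortho_group ?V"
  proof (rule ortho_group.intro)
    show "linear (?V t)" for t
      by (intro bounded_linear.linear bounded_linear_compose[OF bounded_linear_scaleC]
          bounded_linear_compose[OF U.bounded_linear] bounded_linear_scaleC)
    show "continuous_on UNIV (\<lambda>t. ?V t f)" for f
      by (intro bounded_linear.continuous_on[OF bounded_linear_scaleC] U.continuous)
  qed (simp_all add: U.add)
  moreover have "generator U \<subseteq> generator ?V"
  proof safe
    fix f h assume "(f, h) \<in> generator U"
    then have "(f, \<i> *\<^sub>C h) \<in> H" by (simp add: U skew_graph_iff)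
    then have "(\<i> *\<^sub>C f, \<i> *\<^sub>C (\<i> *\<^sub>C h)) \<in> H" using H unfolding self_adjoint_def by blast
    then have "(\<i> *\<^sub>C f, \<i> *\<^sub>C h) \<in> generator U" by (simp only: U skew_graph_iff)
    from bounded_linear.has_vector_derivative[OF bounded_linear_scaleC generatorD[OF this], of "-
        \<i>"]
    show "(f, h) \<in> generator ?V" by (simp add: generator_def)
  qed
  ultimately have "U t f = ?V t f" for t f
    using dense by (intro ortho_group_eqI[OF U(1)]) (simp_all add: U(2))
  then have "\<i> *\<^sub>C U t f = \<i> *\<^sub>C ?V t f" for t f by metis
  then have U_i: "U t (\<i> *\<^sub>C f) = \<i> *\<^sub>C U t f" for t f by simp
  have U_C: "U t (c *\<^sub>C f) = c *\<^sub>C U t f" for t c f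
    unfolding scaleC_Re_Im[of c] by (simp add: U.bl_simps U_i)
  have P: "?P U"
  proof
    have "surj (U t)" for t by (metis U.inverse(2) surj_def)
    then show "unitary_group U"
      unfolding unitary_group_def using U.add U.continuous
      by (auto simp: U.bl_simps U_C fun_eq_iff)
    have "(f, g) \<in> H \<longleftrightarrow> (f, (- \<i>) *\<^sub>C g) \<in> skew_graph H" for f g by (simp add: skew_graph_iff)
    then show "H = {(f, g). ((\<lambda>t. U t f) has_vector_derivative (- \<i>) *\<^sub>C g) (at 0)}"
      by (auto simp: generator_def simp flip: U(2))
  qed
  have eq: "exp_mi H = U"
    unfolding exp_mi_def
  proof (rule the_equality, rule P)
    fix W assume W: "?P W"
    show "W = U"
      using dense gen[OF W] U(2) unitary_groupD W
      by (intro ext ortho_group_eqI[OF _ U(1)]) auto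
  qed
  show "ortho_group (exp_mi H)" "generator (exp_mi H) = skew_graph H"
    "exp_mi H t (c *\<^sub>C f) = c *\<^sub>C exp_mi H t f"
    by (simp_all add: eq U U_C)
qed

lemma op_add_mult_op:
  assumes "ess_bounded V"
  shows "op_add H (mult_op V) = {(f, g + mul (\<lambda>x. of_real (V x)) f) |f g. (f, g) \<in> H}"
  unfolding op_add_def mult_op_bounded[OF assms] by auto

lemma mul_real_skew:
  assumes "(\<lambda>x. complex_of_real (V x)) \<in> borel_measurable ref_measure"
    "AE x in ref_measure. norm (complex_of_real (V x)) \<le> K"
  shows "f \<bullet> ((- \<i>) *\<^sub>C mul (\<lambda>x. of_real (V x)) f) = 0"
proof -
  show ?thesis
    unfolding inner_L2
  proof (rule integral_eq_zero_AE)
    show "AE x in ref_measure. rep_L2 f x \<bullet> rep_L2 ((- \<i>) *\<^sub>C mul (\<lambda>x. of_real (V x)) f) x = 0"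
      using rep_scaleC[of "- \<i>" "mul (\<lambda>x. of_real (V x)) f"] rep_mul[OF assms, of f]
      by eventually_elim (simp add: inner_complex_def algebra_simps)
  qed
qed

lemma self_adjoint_add_mult_op:
  assumes H: "self_adjoint H" and V: "ess_bounded V"
  shows "self_adjoint (op_add H (mult_op V))"
    and "skew_graph (op_add H (mult_op V)) =
      {(f, g + (- \<i>) *\<^sub>C mul (\<lambda>x. of_real (V x)) f) |f g. (f, g) \<in> skew_graph H}"
proof -
  obtain K where K: "(\<lambda>x. complex_of_real (V x)) \<in> borel_measurable ref_measure"
    "AE x in ref_measure. norm (complex_of_real (V x)) \<le> K" using V by (rule ess_boundedD)
  let ?B = "\<lambda>f. (- \<i>) *\<^sub>C mul (\<lambda>x. of_real (V x)) f"
  show eq: "skew_graph (op_add H (mult_op V)) = {(f, g + ?B f) |f g. (f, g) \<in> skew_graph H}"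
    unfolding skew_graph_def op_add_mult_op[OF V] by (force simp: scaleC_add_right)
  obtain c where "skew_adjoint (skew_graph H) c" using H by (auto simp: self_adjoint_def)
  then interpret skew_adjoint "skew_graph H" c .
  have "\<exists>c'. skew_adjoint {(f, g + ?B f) |f g. (f, g) \<in> skew_graph H} c'"
    by (rule bounded_perturbation[OF bounded_linear_compose[OF bounded_linear_scaleC
        bounded_linear_mul[OF K]] mul_real_skew[OF K]])
  moreover have "(\<i> *\<^sub>C f, \<i> *\<^sub>C g) \<in> op_add H (mult_op V)" if fg: "(f, g) \<in> op_add H (mult_op V)"
      for f g
  proof -
    obtain h where h: "(f, h) \<in> H" "g = h + mul (\<lambda>x. of_real (V x)) f"
      using fg by (auto simp: op_add_mult_op[OF V])
    then have "(\<i> *\<^sub>C f, \<i> *\<^sub>C h) \<in> H" using H by (auto simp: self_adjoint_def)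
    moreover have "\<i> *\<^sub>C g = \<i> *\<^sub>C h + mul (\<lambda>x. of_real (V x)) (\<i> *\<^sub>C f)"
      by (simp add: h(2) scaleC_add_right mul_scaleC[OF K])
    ultimately show ?thesis by (auto simp: op_add_mult_op[OF V])
  qed
  ultimately show "self_adjoint (op_add H (mult_op V))" unfolding self_adjoint_def eq by blast
qed

section \<open>Heisenberg observables and the transfer to self-adjoint operators\<close>

lemma app_heisenberg:
  assumes Q: "\<And>f g g'. (f, g) \<in> Q \<Longrightarrow> (f, g') \<in> Q \<Longrightarrow> g = g'" and g: "(exp_mi H t f, g) \<in> Q"
  shows "f \<in> Domain (heisenberg H Q t)" "app (heisenberg H Q t) f = exp_mi H (- t) g"
proof -
  have "(f, exp_mi H (- t) g) \<in> heisenberg H Q t" using g by (auto simp: heisenberg_def)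
  then show "f \<in> Domain (heisenberg H Q t)" by blast
  show "app (heisenberg H Q t) f = exp_mi H (- t) g"
    unfolding app_def heisenberg_def using g by (intro the_equality) (auto dest: Q)
qed

text \<open>\<open>S\<close> stands for the S-norm and \<open>k\<close> for the ratio of velocity to
  momentum, 2 in the continuum and 1 on the lattice. The norm identity for
  \<open>Omega H H0 p\<close> holds because each \<open>wave\<close> is isometric; in the continuum
  it excludes zero velocity.\<close>

theorem scattering_velocity:
  fixes H0 :: "'a::ref_measure L2 operator" and V m :: "'a \<Rightarrow> real" and S :: "'a L2 \<Rightarrow> ennreal"
  defines "H \<equiv> op_add H0 (mult_op V)"
  assumes H0: "self_adjoint H0" and V: "ess_bounded V" and m: "m \<in> borel_measurable ref_measure"
    and S_norm: "\<And>g. ennreal (norm g) \<le> S g"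
    and S: "\<And>g r a. 0 < a \<Longrightarrow> a \<le> 1 \<Longrightarrow>
      ennreal (norm (phase m a (exp_mi H r g) - exp_mi H r g)) \<le> ennreal (C * a * (1 + \<bar>r\<bar>)) * S g"
    and C: "0 < C"
    and fin: "(\<integral>\<^sup>+t\<in>{0..}. ennreal (1 + t) * S (app (mult_op V) (exp_mi H0 t f)) \<partial>lborel) < \<infinity>"
    and fin': "(\<integral>\<^sup>+t\<in>{0..}. ennreal (1 + t) *
      ennreal (norm (app (mult_op V) (exp_mi H0 t p))) \<partial>lborel) < \<infinity>"
    and free: "\<And>t. 0 \<le> t \<Longrightarrow> (exp_mi H0 t f, exp_mi H0 t q + (t * k) *\<^sub>R exp_mi H0 t p) \<in> mult_op m"
  shows "Omega_exists H H0 f \<and> Omega_exists H H0 p \<and> Omega H H0 f \<in> Domain (mult_op m) \<and>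
    asymptotic_velocity H (mult_op m) (Omega H H0 f) (k *\<^sub>R Omega H H0 p) \<and>
    norm (Omega H H0 p) = norm p"
proof -
  obtain K where K: "(\<lambda>x. complex_of_real (V x)) \<in> borel_measurable ref_measure"
    "AE x in ref_measure. norm (complex_of_real (V x)) \<le> K" using V by (rule ess_boundedD)
  let ?U = "exp_mi H" and ?W = "exp_mi H0"
  let ?V = "mul (\<lambda>x. of_real (V x))"
  let ?B = "\<lambda>f. (- \<i>) *\<^sub>C ?V f"
  have H: "self_adjoint H" unfolding H_def by (rule self_adjoint_add_mult_op[OF H0 V])
  have V_app: "app (mult_op V) g = ?V g" for g
    by (rule app_mult_op) (auto simp: mult_op_bounded[OF V])
  interpret wave_pair ?U ?W ?B
  proof (rule wave_pair.intro)
    show "bounded_linear ?B"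
      by (rule bounded_linear_compose[OF bounded_linear_scaleC bounded_linear_mul[OF K]])
    show "(f, g + ?B f) \<in> generator ?U" if "(f, g) \<in> generator ?W" for f g
      using that unfolding generator_exp_mi[OF H] generator_exp_mi[OF H0]
      unfolding H_def self_adjoint_add_mult_op(2)[OF H0 V] by blast
    show "closure (Domain (generator ?W)) = UNIV"
      unfolding generator_exp_mi[OF H0] by (rule self_adjoint_dense[OF H0])
  qed (rule ortho_group_exp_mi[OF H] ortho_group_exp_mi[OF H0])+
  interpret E: ortho_group "phase m" by (rule ortho_group_phase[OF m])
  have weight: "x \<le> ennreal (1 + t) * x" if "0 \<le> t" for t x
  proof -
    have "1 * x \<le> ennreal (1 + t) * x" using that by (intro mult_right_mono) auto
    then show ?thesis by simp
  qed
  have wave: "wave H H0 t g = ?U (- t) (?W t g)" for t g by (simp add: wave_def)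
  have "\<exists>g. ((\<lambda>t. ?U (- t) (?W t f)) \<longlongrightarrow> g) at_top"
  proof (rule cook)
    show "(\<integral>\<^sup>+t\<in>{0..}. ennreal (norm (?B (?W t f))) \<partial>lborel) < \<infinity>"
    proof (rule le_less_trans[OF nn_integral_mono fin])
      fix t
      show "ennreal (norm (?B (?W t f))) * indicator {0..} t
          \<le> ennreal (1 + t) * S (app (mult_op V) (?W t f)) * indicator {0..} t"
        using order_trans[OF S_norm weight, of t "?V (?W t f)"] by (auto simp: V_app indicator_def)
    qed
  qed
  then obtain f' where f': "((\<lambda>t. ?U (- t) (?W t f)) \<longlongrightarrow> f') at_top" by blast
  have "\<exists>g. ((\<lambda>t. ?U (- t) (?W t p)) \<longlongrightarrow> g) at_top"
  proof (rule cook)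
    show "(\<integral>\<^sup>+t\<in>{0..}. ennreal (norm (?B (?W t p))) \<partial>lborel) < \<infinity>"
    proof (rule le_less_trans[OF nn_integral_mono fin'])
      fix t
      show "ennreal (norm (?B (?W t p))) * indicator {0..} t
          \<le> ennreal (1 + t) * ennreal (norm (app (mult_op V) (?W t p))) * indicator {0..} t"
        using weight[of t "ennreal (norm (?V (?W t p)))"] by (auto simp: V_app indicator_def)
    qed
  qed
  then obtain p' where p': "((\<lambda>t. ?U (- t) (?W t p)) \<longlongrightarrow> p') at_top" by blast
  have Om: "Omega H H0 f = f'" "Omega H H0 p = p'"
    unfolding Omega_def wave using f' p' by (auto intro: tendsto_Lim)
  have "\<exists>v. (\<forall>t\<ge>0. (?U t f', v t) \<in> generator (phase m)) \<and>
      ((\<lambda>t. (1 / t) *\<^sub>R ?U (- t) (v t)) \<longlongrightarrow> \<i> *\<^sub>C (k *\<^sub>R p')) at_top"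
  \<comment> \<open>The phase group is generated by i times the multiplication by \<open>m\<close>,
    hence the factors i on \<open>q\<close> and \<open>p\<close>. The perturbation is -i times V, so
    evaluating \<open>S\<close> after multiplication by i recovers \<open>S\<close> of V
    itself.\<close>
  proof (rule asymptotic_velocity[where C = C and S = "\<lambda>g. S (\<i> *\<^sub>C g)" and q = "\<i> *\<^sub>C q"
        and p = "\<i> *\<^sub>C (k *\<^sub>R p)", OF ortho_group_phase[OF m]])
    show "\<exists>g. (h, g) \<in> generator (phase m) \<and> norm g \<le> C'"
      if le: "\<And>a. 0 < a \<Longrightarrow> a \<le> 1 \<Longrightarrow> norm (phase m a h - h) \<le> C' * a" for h C'
    proof -
      obtain g where "(h, g) \<in> mult_op m" "norm g \<le> C'"
        using mult_op_domainI[OF m le] by blast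
      then show ?thesis using generator_phaseI[OF m] by (intro exI[of _ "\<i> *\<^sub>C g"]) simp
    qed
    show "ennreal (norm (phase m a (?U r g) - ?U r g)) \<le> ennreal (C * a * (1 + \<bar>r\<bar>)) * S (\<i> *\<^sub>C g)"
      if "0 < a" "a \<le> 1" for g r a
    proof -
      have "phase m a (?U r (\<i> *\<^sub>C g)) - ?U r (\<i> *\<^sub>C g) = \<i> *\<^sub>C (phase m a (?U r g) - ?U r g)"
        by (simp add: exp_mi_scaleC[OF H] phase_scaleC[OF m] linear_diff[OF linear_scaleC])
      then show ?thesis using S[OF that, of r "\<i> *\<^sub>C g"] by simp
    qed
    show "(\<integral>\<^sup>+t\<in>{0..}. ennreal (1 + t) * S (\<i> *\<^sub>C ?B (?W t f)) \<partial>lborel) < \<infinity>"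
      using fin by (simp add: V_app)
    show "(?W t f, ?W t (\<i> *\<^sub>C q) + t *\<^sub>R ?W t (\<i> *\<^sub>C (k *\<^sub>R p))) \<in> generator (phase m)" if "0
        \<le> t" for t
      using generator_phaseI[OF m free[OF that]]
      by (simp add: exp_mi_scaleC[OF H0] scaleC_add_right scaleC_scaleR W.bl_simps)
    show "((\<lambda>t. ?U (- t) (?W t (\<i> *\<^sub>C (k *\<^sub>R p)))) \<longlongrightarrow> \<i> *\<^sub>C (k *\<^sub>R p')) at_top"
      unfolding exp_mi_scaleC[OF H0] exp_mi_scaleC[OF H] W.bl_simps U.bl_simps
      by (intro bounded_linear.tendsto[OF bounded_linear_scaleC] tendsto_scaleR tendsto_const p')
  qed (rule C f')+
  then obtain v where v: "\<And>t. 0 \<le> t \<Longrightarrow> (?U t f', v t) \<in> generator (phase m)"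
    and lim: "((\<lambda>t. (1 / t) *\<^sub>R ?U (- t) (v t)) \<longlongrightarrow> \<i> *\<^sub>C (k *\<^sub>R p')) at_top" by blast
  have mv: "(?U t f', (- \<i>) *\<^sub>C v t) \<in> mult_op m" if "0 \<le> t" for t
    by (rule generator_phaseD[OF m v[OF that]])
  have heis: "f' \<in> Domain (heisenberg H (mult_op m) t)"
    "app (heisenberg H (mult_op m) t) f' = ?U (- t) ((- \<i>) *\<^sub>C v t)" if "0 \<le> t" for t
    by (rule app_heisenberg[OF _ mv[OF that]], erule (1) mult_op_unique)+
  have "((\<lambda>t. (- \<i>) *\<^sub>C ((1 / t) *\<^sub>R ?U (- t) (v t))) \<longlongrightarrow> (- \<i>) *\<^sub>C (\<i> *\<^sub>C (k *\<^sub>R p'))) at_top"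
    by (rule bounded_linear.tendsto[OF bounded_linear_scaleC lim])
  moreover have "\<forall>\<^sub>F t in at_top. (- \<i>) *\<^sub>C ((1 / t) *\<^sub>R ?U (- t) (v t))
      = (1 / t) *\<^sub>R app (heisenberg H (mult_op m) t) f'"
    unfolding eventually_at_top_linorder
    by (intro exI[of _ 0] allI impI) (simp add: heis exp_mi_scaleC[OF H] scaleC_scaleR)
  ultimately have "((\<lambda>t. (1 / t) *\<^sub>R app (heisenberg H (mult_op m) t) f')
      \<longlongrightarrow> (- \<i>) *\<^sub>C (\<i> *\<^sub>C (k *\<^sub>R p'))) at_top"
    by (rule Lim_transform_eventually)
  then have "((\<lambda>t. (1 / t) *\<^sub>R app (heisenberg H (mult_op m) t) f') \<longlongrightarrow> k *\<^sub>R p') at_top"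
    by simp
  then have "asymptotic_velocity H (mult_op m) f' (k *\<^sub>R p')"
    using heis(1) by (simp add: asymptotic_velocity_def)
  moreover have "f' \<in> Domain (mult_op m)" using mv[of 0] by auto
  moreover have "Omega_exists H H0 f" "Omega_exists H H0 p"
    unfolding Omega_exists_def wave using f' p' by blast+
  moreover have "norm p' = norm p"
    using tendsto_norm[OF p'] by (simp add: tendsto_const_iff)
  ultimately show ?thesis by (simp add: Om)
qed

section \<open>Commutators with a one-parameter group\<close>

text \<open>Commutation with the generator makes \<open>U (- s) (C (U s f))\<close> constant on the
  domain. It is applied to shifts and translations against the free evolution.\<close>

lemma (in ortho_group) commute_bounded:
  assumes C: "bounded_linear C" and dense: "closure (Domain (generator U)) = UNIV"
    and gen: "\<And>f g. (f, g) \<in> generator U \<Longrightarrow> (C f, C g) \<in> generator U"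
  shows "C (U t f) = U t (C f)"
proof (rule bounded_linear_eq_on_dense[OF _ _ dense, where f = "\<lambda>f. C (U t f)" and g
    = "\<lambda>f. U t (C f)"])
  show "bounded_linear (\<lambda>f. C (U t f))" "bounded_linear (\<lambda>f. U t (C f))"
    by (rule bounded_linear_compose[OF C bounded_linear] bounded_linear_compose[OF bounded_linear
        C])+
  fix f assume "f \<in> Domain (generator U)"
  then obtain g where g: "(f, g) \<in> generator U" by (rule DomainE)
  have "((\<lambda>s. U (- 1 * s) (C (U s f))) has_vector_derivative 0) (at s)" for s
  proof -
    have "((\<lambda>s. U (- 1 * s) (C (U s f))) has_vector_derivative
        ((- 1) *\<^sub>R U (- 1 * s) (C (U s g)) + U (- 1 * s) (C (U s g)))) (at s)"
      by (rule has_vector_derivative[OF bounded_linear.has_vector_derivative[OF C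
          has_vector_derivative_orbit[OF g]]])
        (rule gen[OF generator_orbit[OF g]])
    then show ?thesis by simp
  qed
  from vector_derivative_bound[OF this, where c = 0 and B = 0 and a = 0 and b = t]
  have "U (- t) (C (U t f)) = C f" by simp
  then show "C (U t f) = U t (C f)" by (metis inverse(2))
qed

text \<open>The vector \<open>k s\<close> is the commutator of the generator with E on the orbit,
  and \<open>U (- s) (E (U s f))\<close> has derivative \<open>- U (- s) (k s)\<close>. With
  \<open>c = 0\<close> the estimate measures the size of the commutator effect; a nonzero
  \<open>c\<close> extracts its leading term.\<close>

lemma (in ortho_group) commutator_bound:
  assumes E: "bounded_linear E"
    and f: "\<And>s. ((\<lambda>s. U s f) has_vector_derivative h s) (at s)"
    and gen: "\<And>s. (E (U s f), E (h s) + k s) \<in> generator U"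
    and K: "\<And>s. s \<in> closed_segment 0 t \<Longrightarrow> norm (U (- s) (k s) + c) \<le> K"
  shows "norm (E (U t f) - U t (E f) - t *\<^sub>R U t c) \<le> \<bar>t\<bar> * K"
proof -
  have "norm (U (- 1 * t) (E (U t f)) - U (- 1 * 0) (E (U 0 f)) - (t - 0) *\<^sub>R c) \<le> \<bar>t - 0\<bar> * K"
  proof (rule vector_derivative_bound[OF has_vector_derivative[OF
        bounded_linear.has_vector_derivative[OF E f] gen]])
    fix s assume "s \<in> closed_segment 0 t"
    from K[OF this] show "norm ((- 1) *\<^sub>R U (- 1 * s) (E (h s) + k s) + U (- 1 * s) (E (h s)) - c)
        \<le> K"
      by (simp add: bl_simps) (metis minus_add_distrib norm_minus_cancel uminus_add_conv_diff
          add.commute)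
  qed
  moreover have "U (- t) (E (U t f)) - E f - t *\<^sub>R c = U (- t) (E (U t f) - U t (E f) - t *\<^sub>R U t
      c)"
    by (simp add: bl_simps)
  ultimately show ?thesis by simp
qed

lemma scaleC_i_i: "\<i> *\<^sub>C (\<i> *\<^sub>C f) = - f"
  by (simp add: scaleC_minus_left)

lemma inner_scaleC_i_i: "(\<i> *\<^sub>C f) \<bullet> (\<i> *\<^sub>C g) = f \<bullet> g"
  unfolding dot_norm scaleC_add_right[symmetric] norm_scaleC by simp

lemma inner_scaleC_i: "f \<bullet> (\<i> *\<^sub>C g) = - ((\<i> *\<^sub>C f) \<bullet> g)"
  by (rule inner_scaleC_i_i[of f "\<i> *\<^sub>C g", unfolded scaleC_i_i inner_minus_right, symmetric])

lemma tendsto_scaleC: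
  assumes c: "(c \<longlongrightarrow> c0) F" shows "((\<lambda>x. c x *\<^sub>C f) \<longlongrightarrow> c0 *\<^sub>C f) F"
proof -
  have "((\<lambda>x. Re (c x) *\<^sub>R f + Im (c x) *\<^sub>R (\<i> *\<^sub>C f)) \<longlongrightarrow> Re c0 *\<^sub>R f + Im c0 *\<^sub>R (\<i> *\<^sub>C f)) F"
    by (intro tendsto_intros c)
  then show ?thesis by (simp only: scaleC_Re_Im[of "c _"] scaleC_Re_Im[of c0])
qed

lemma scaleR_scaleC_left: "(r *\<^sub>R c) *\<^sub>C f = r *\<^sub>R (c *\<^sub>C f)"
  by (simp add: scaleR_conv_of_real flip: scaleC_of_real)

lemma norm_phase_diff_le:
  assumes m: "m \<in> borel_measurable ref_measure" and g: "(f, g) \<in> mult_op m"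
  shows "norm (phase m a f - f) \<le> \<bar>a\<bar> * norm g"
proof -
  interpret E: ortho_group "phase m" by (rule ortho_group_phase[OF m])
  show ?thesis
    using vector_derivative_bound[OF E.has_vector_derivative_orbit[OF generator_phaseI[OF m g]],
        of 0 a 0 "norm g"]
    by simp
qed

section \<open>The lattice\<close>

lemma AE_lattice [simp]: "(AE n in (ref_measure :: ('n::finite \<Rightarrow> int) measure). P n) \<longleftrightarrow> (\<forall>n. P n)"
  unfolding ref_measure_fun_def AE_count_space by simp

lemma measurable_lattice [simp]: "f \<in> borel_measurable (ref_measure :: ('n::finite \<Rightarrow> int) measure)"
  unfolding ref_measure_fun_def by simp

definition shift :: "'n::finite \<Rightarrow> int \<Rightarrow> ('n \<Rightarrow> int) L2 \<Rightarrow> ('n \<Rightarrow> int) L2" where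
  "shift l k f = abs_L2 (\<lambda>n. rep_L2 f (n(l := n l + k)))"

lemma shift_bounds:
  "square_integrable (\<lambda>n. rep_L2 f (n(l := n l + k)))" "norm (shift l k f) \<le> norm f"
proof -
  have "bij (\<lambda>n. n(l := n l + k))"
    by (rule bij_betw_byWitness[where f' = "\<lambda>n. n(l := n l - k)"]) auto
  from nn_integral_bij_count_space[OF this, of "\<lambda>n. ennreal ((norm (rep_L2 f n))\<^sup>2)"]
  have "(\<integral>\<^sup>+n. ennreal ((norm (rep_L2 f (n(l := n l + k))))\<^sup>2) \<partial>ref_measure) = ennreal ((norm f)\<^sup>2)"
    unfolding nn_norm_L2 ref_measure_fun_def by simp
  then show "square_integrable (\<lambda>n. rep_L2 f (n(l := n l + k)))" "norm (shift l k f) \<le> norm f"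
    unfolding shift_def
    using square_integrableI[of "\<lambda>n. rep_L2 f (n(l := n l + k))" "norm f"] by simp_all
qed

lemma rep_shift [simp]: "rep_L2 (shift l k f) n = rep_L2 f (n(l := n l + k))"
  using rep_abs_L2[OF shift_bounds(1)[where f = f and l = l and k
      = k]] unfolding AE_lattice shift_def by (rule spec)

lemma rep_lattice_simps [simp]:
  fixes f g :: "('n::finite \<Rightarrow> int) L2"
  shows "rep_L2 (f + g) n = rep_L2 f n + rep_L2 g n" "rep_L2 (f - g) n = rep_L2 f n - rep_L2 g n"
    "rep_L2 (c *\<^sub>C f) n = c * rep_L2 f n" "rep_L2 (r *\<^sub>R f) n
        = of_real r * rep_L2 f n" "rep_L2 0 n = 0"
  using rep_plus_L2[of f g] rep_minus_L2[of f g] rep_scaleC[of c f] rep_scaleR_L2[of r f]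
    rep_zero_L2[where 'a = "'n \<Rightarrow> int"]
  by auto

lemma rep_lattice_sum [simp]:
  fixes F :: "'b \<Rightarrow> ('n::finite \<Rightarrow> int) L2"
  shows "rep_L2 (\<Sum>i\<in>I. F i) n = (\<Sum>i\<in>I. rep_L2 (F i) n)"
  by (induction I rule: infinite_finite_induct) auto

lemma L2_lattice_eqI: "(\<And>n. rep_L2 f n = rep_L2 g n) \<Longrightarrow> f = (g :: ('n::finite \<Rightarrow> int) L2)"
  by (rule L2_eqI) simp

lemma shift_shift [simp]: "shift l k (shift l k' f) = shift l (k + k') f"
  by (rule L2_lattice_eqI) (simp add: algebra_simps)

lemma shift_0 [simp]: "shift l 0 f = f"
  by (rule L2_lattice_eqI) simp

lemma shift_commute: "shift l k (shift l' k' f) = shift l' k' (shift l k f)"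
  by (rule L2_lattice_eqI) (cases "l = l'"; simp add: fun_upd_twist algebra_simps)

lemma bounded_linear_shift: "bounded_linear (shift l k)"
  by (rule bounded_linear_intro[where K = 1]) (auto intro!: L2_lattice_eqI shift_bounds(2))

lemmas linear_shift = bounded_linear.linear[OF bounded_linear_shift]

lemma shift_scaleC: "shift l k (c *\<^sub>C f) = c *\<^sub>C shift l k f"
  by (rule L2_lattice_eqI) simp

lemma norm_shift [simp]: "norm (shift l k f) = norm f"
  using shift_bounds(2)[of l k f] shift_bounds(2)[of l "- k" "shift l k f"] by simp

lemma inner_shift: "shift l k f \<bullet> g = f \<bullet> shift l (- k) g"
proof -
  have "shift l k f \<bullet> shift l k h = f \<bullet> h" for h
    by (simp add: dot_norm flip: linear_add[OF linear_shift])
  from this[of "shift l (- k) g"] show ?thesis by simp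
qed

definition lattice_laplace :: "('n::finite \<Rightarrow> int) L2 \<Rightarrow> ('n \<Rightarrow> int) L2" where
  "lattice_laplace f = (\<Sum>l\<in>UNIV. shift l 1 f + shift l (- 1) f)"

lemma H0_lat_eq: "H0_lat = {(f :: ('n::finite \<Rightarrow> int) L2, lattice_laplace f) |f. True}"
proof -
  have "(f, g) \<in> H0_lat \<longleftrightarrow> g = lattice_laplace f" for f g :: "('n \<Rightarrow> int) L2"
    unfolding H0_lat_def lattice_laplace_def by (auto intro!: L2_lattice_eqI)
  then show ?thesis by auto
qed

lemma bounded_linear_lattice_laplace: "bounded_linear lattice_laplace"
  unfolding lattice_laplace_def[abs_def]
  by (intro bounded_linear_sum bounded_linear_add bounded_linear_shift)

lemma lattice_laplace_scaleC: "lattice_laplace (c *\<^sub>C f) = c *\<^sub>C lattice_laplace f"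
  unfolding lattice_laplace_def by (rule L2_lattice_eqI) (simp add: sum_distrib_left distrib_left)

lemma lattice_laplace_symmetric: "lattice_laplace f \<bullet> g = f \<bullet> lattice_laplace g"
  unfolding lattice_laplace_def inner_sum_left inner_sum_right
  by (rule sum.cong) (simp_all add: inner_add_left inner_add_right inner_shift)

text \<open>The lattice Laplacian is bounded and symmetric, so it is treated as a perturbation of
  the zero operator.\<close>

lemma self_adjoint_H0_lat: "self_adjoint (H0_lat :: ('n::finite \<Rightarrow> int) L2 operator)"
proof -
  let ?Z = "{(f, 0) |f. True} :: ('n \<Rightarrow> int) L2 operator"
  interpret Z: skew_adjoint ?Z 1
  proof (rule skew_adjoint.intro)
    show "subspace ?Z" by (auto simp: subspace_def zero_prod_def)
  qed auto
  have "f \<bullet> ((- \<i>) *\<^sub>C lattice_laplace f) = 0" for f :: "('n \<Rightarrow> int) L2"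
  proof -
    have "(\<i> *\<^sub>C f) \<bullet> lattice_laplace f = f \<bullet> (\<i> *\<^sub>C lattice_laplace f)"
      by (metis inner_commute lattice_laplace_symmetric lattice_laplace_scaleC)
    then show ?thesis using inner_scaleC_i[of f "lattice_laplace f"]
        by (simp add: scaleC_minus_left)
  qed
  from Z.bounded_perturbation[OF bounded_linear_compose[OF bounded_linear_scaleC
      bounded_linear_lattice_laplace] this]
  obtain c where c: "skew_adjoint {(f, g + (- \<i>) *\<^sub>C lattice_laplace f) |f g. (f, g) \<in> ?Z} c"
      by blast
  have eq: "{(f, g + (- \<i>) *\<^sub>C lattice_laplace f) |f g. (f, g) \<in> ?Z} = skew_graph H0_lat"
    by (auto simp: skew_graph_def H0_lat_eq)
  from c have "\<exists>c. skew_adjoint (skew_graph (H0_lat :: ('n \<Rightarrow> int) L2 operator)) c"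
    unfolding eq by blast
  then show ?thesis
    unfolding self_adjoint_def by (auto simp: H0_lat_eq lattice_laplace_scaleC)
qed

section \<open>Phases and propagation of the position on the lattice\<close>

abbreviation coord :: "'n \<Rightarrow> ('n \<Rightarrow> int) \<Rightarrow> real" where
  "coord j n \<equiv> real_of_int (n j)"

lemma rep_phase_lattice [simp]:
  "rep_L2 (phase m a f) n = cis (a * m n) * rep_L2 f (n :: 'n::finite \<Rightarrow> int)"
  using rep_phase[of m a f] by simp

text \<open>The difference between H_0 conjugated by the phase, phase(-a) H_0 phase(a), and H_0:
  only hops along direction j notice the phase.\<close>

definition phase_commutator :: "'n::finite \<Rightarrow> real \<Rightarrow> ('n \<Rightarrow> int) L2 \<Rightarrow> ('n \<Rightarrow> int) L2" where
  "phase_commutator j a f = (cis a - 1) *\<^sub>C shift j 1 f + (cis (- a) - 1) *\<^sub>C shift j (- 1) f"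

lemma lattice_laplace_phase:
  fixes f :: "('n::finite \<Rightarrow> int) L2"
  shows
  "lattice_laplace (phase (coord j) a f) =
    phase (coord j) a (lattice_laplace f) + phase (coord j) a (phase_commutator j a f)"
proof (rule L2_lattice_eqI)
  fix n :: "'n \<Rightarrow> int"
  have "(\<Sum>l\<in>UNIV. cis (a * coord j (n(l := n l + 1))) * rep_L2 f (n(l := n l + 1)) +
          cis (a * coord j (n(l := n l + - 1))) * rep_L2 f (n(l := n l + - 1))) =
      (\<Sum>l\<in>UNIV. cis (a * coord j n) * (rep_L2 f (n(l := n l + 1)) + rep_L2 f (n(l := n l + - 1))) +
        (if l = j then cis (a * coord j n) * ((cis a - 1) * rep_L2 f (n(l := n l + 1)) +
           (cis (- a) - 1) * rep_L2 f (n(l := n l + - 1))) else 0))"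
  proof (rule sum.cong)
    have c: "cis (a * real_of_int (n j + k)) = cis (a * real_of_int k) * cis (a * real_of_int (n
        j))" for k
      by (simp add: cis_mult algebra_simps)
    show "cis (a * coord j (n(l := n l + 1))) * rep_L2 f (n(l := n l + 1)) +
          cis (a * coord j (n(l := n l + - 1))) * rep_L2 f (n(l := n l + - 1)) =
        cis (a * coord j n) * (rep_L2 f (n(l := n l + 1)) + rep_L2 f (n(l := n l + - 1))) +
        (if l = j then cis (a * coord j n) * ((cis a - 1) * rep_L2 f (n(l := n l + 1)) +
           (cis (- a) - 1) * rep_L2 f (n(l := n l + - 1))) else 0)" for l
    proof (cases "l = j")
      case True
      show ?thesis
        unfolding True fun_upd_same c if_True refl by (simp add: algebra_simps)
    qed (simp add: algebra_simps)
  qed simp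
  also have "\<dots> = cis (a * coord j n) * (\<Sum>l\<in>UNIV. rep_L2 f (n(l := n l + 1)) + rep_L2 f (n(l := n l
      + - 1))) +
      cis (a * coord j n) * ((cis a - 1) * rep_L2 f (n(j := n j + 1)) + (cis (- a) - 1) * rep_L2 f
          (n(j := n j + - 1)))"
    by (simp add: sum.distrib distrib_left sum_distrib_left)
  finally show "rep_L2 (lattice_laplace (phase (coord j) a f)) n =
      rep_L2 (phase (coord j) a (lattice_laplace f) + phase (coord j) a (phase_commutator j a f)) n"
    by (simp add: lattice_laplace_def phase_commutator_def)
qed

lemma norm_phase_commutator_le: "norm (phase_commutator j a f) \<le> 2 * \<bar>a\<bar> * norm f"
proof -
  have "norm ((cis a - 1) *\<^sub>C shift j 1 f) \<le> \<bar>a\<bar> * norm f"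
    using norm_cis_diff_le[of a] by (simp add: mult_right_mono)
  moreover have "norm ((cis (- a) - 1) *\<^sub>C shift j (- 1) f) \<le> \<bar>a\<bar> * norm f"
    using norm_cis_diff_le[of "- a"] by (simp add: mult_right_mono)
  ultimately show ?thesis
    unfolding phase_commutator_def
    using norm_triangle_ineq[of "(cis a - 1) *\<^sub>C shift j 1 f" "(cis (- a) - 1) *\<^sub>C shift j (- 1) f"]
    by linarith
qed

text \<open>The limit is the momentum \<open>P_lat j\<close> applied to f, so the conjugated
  Laplacian has derivative P_j at a = 0.\<close>

lemma phase_commutator_tendsto:
  "((\<lambda>a. phase_commutator j a f /\<^sub>R a) \<longlongrightarrow> \<i> *\<^sub>C (shift j 1 f - shift j (- 1) f)) (at 0)"
proof -
  have eq: "phase_commutator j a f /\<^sub>R a =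
      ((cis (a * 1) - 1) /\<^sub>R a) *\<^sub>C shift j 1 f + ((cis (a * (- 1)) - 1) /\<^sub>R a) *\<^sub>C shift j (- 1)
          f" for a
    by (simp only: phase_commutator_def scaleR_scaleC_left scaleR_add_right mult_1_right
        mult_minus_right)
  have "((\<lambda>a. phase_commutator j a f /\<^sub>R a) \<longlongrightarrow>
      (\<i> * of_real 1) *\<^sub>C shift j 1 f + (\<i> * of_real (- 1)) *\<^sub>C shift j (- 1) f) (at 0)"
    unfolding eq by (intro tendsto_add tendsto_scaleC cis_quotient_tendsto)
  then show ?thesis
    by (simp add: scaleC_minus_left linear_diff[OF linear_scaleC])
qed

lemma generator_exp_lat:
  assumes V: "ess_bounded V"
  shows "(f, (- \<i>) *\<^sub>C (lattice_laplace f + mul (\<lambda>n. of_real (V n)) f))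
    \<in> generator (exp_mi (op_add H0_lat (mult_op V)))"
  unfolding generator_exp_mi[OF self_adjoint_add_mult_op(1)[OF self_adjoint_H0_lat V]]
  by (auto simp: skew_graph_iff op_add_mult_op[OF V] H0_lat_eq)

lemma mul_phase:
  fixes f :: "('n::finite \<Rightarrow> int) L2"
  assumes V: "ess_bounded V"
  shows "mul (\<lambda>n. of_real (V n)) (phase m a f) = phase m a (mul (\<lambda>n. of_real (V n)) f)"
proof -
  obtain K where K: "(\<lambda>x. complex_of_real (V x)) \<in> borel_measurable ref_measure"
    "AE x in ref_measure. norm (complex_of_real (V x)) \<le> K" using V by (rule ess_boundedD)
  show ?thesis
    using rep_mul[OF K, of f] rep_mul[OF K, of "phase m a f"] by (intro L2_lattice_eqI) simp
qed

text \<open>The potential commutes with the phases, so only the hopping term contributes; its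
  commutator is bounded by \<open>2 * \<bar>a\<bar>\<close> along the whole orbit.\<close>

lemma exp_lat_phase_bound:
  assumes V: "ess_bounded V"
  defines "U \<equiv> exp_mi (op_add H0_lat (mult_op V))"
  shows "norm (phase (coord j) a (U t f) - U t (phase (coord j) a f)) \<le> \<bar>t\<bar> * (2 * \<bar>a\<bar> * norm f)"
proof -
  note sa = self_adjoint_add_mult_op(1)[OF self_adjoint_H0_lat V]
  interpret U: ortho_group U unfolding U_def by (rule ortho_group_exp_mi[OF sa])
  interpret E: ortho_group "phase (coord j)" by (rule ortho_group_phase) simp
  let ?E = "phase (coord j) a"
  let ?A = "\<lambda>f. (- \<i>) *\<^sub>C (lattice_laplace f + mul (\<lambda>n. of_real (V n)) f)"
  have gen: "(f, ?A f) \<in> generator U" for f unfolding U_def by (rule generator_exp_lat[OF V])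
  have "norm (?E (U t f) - U t (?E f) - t *\<^sub>R U t 0) \<le> \<bar>t\<bar> * (2 * \<bar>a\<bar> * norm f)"
  proof (rule U.commutator_bound[OF E.bounded_linear])
    show "((\<lambda>s. U s f) has_vector_derivative ?A (U s f)) (at s)" for s
      using U.has_vector_derivative_orbit[OF gen[of f], of s]
        generator_unique[OF U.generator_orbit[OF gen[of f], of s] gen] by simp
    have "?A (?E g) = ?E (?A g) + (- \<i>) *\<^sub>C ?E (phase_commutator j a g)" for g
      by (simp add: lattice_laplace_phase mul_phase[OF V] phase_scaleC scaleC_add_right E.bl_simps)
    then show "(?E (U s f), ?E (?A (U s f)) + (- \<i>) *\<^sub>C ?E (phase_commutator j a (U s f))) \<in>
        generator U" for s
      using gen[of "?E (U s f)"] by simp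
    show "norm (U (- s) ((- \<i>) *\<^sub>C ?E (phase_commutator j a (U s f))) + 0) \<le> 2 * \<bar>a\<bar> * norm f" for s
      using norm_phase_commutator_le[of j a "U s f"] by simp
  qed
  then show ?thesis by (simp add: U.bl_simps)
qed

lemma Q_lat_unique: "(f, g) \<in> Q_lat j \<Longrightarrow> app (Q_lat j) f = g"
  unfolding Q_lat_def by (rule app_mult_op)

lemma P_lat_eq: "app (P_lat j) f = \<i> *\<^sub>C (shift j 1 f - shift j (- 1) f)"
proof -
  have "(f, g) \<in> P_lat j \<longleftrightarrow> g = \<i> *\<^sub>C (shift j 1 f - shift j (- 1) f)" for g
    unfolding P_lat_def by (auto intro!: L2_lattice_eqI)
  then show ?thesis unfolding app_def by blast
qed

lemma exp_lat_S_norm_bound: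
  assumes V: "ess_bounded V" and a: "0 < a"
  defines "U \<equiv> exp_mi (op_add H0_lat (mult_op V))"
  shows "ennreal (norm (phase (coord j) a (U r g) - U r g))
      \<le> ennreal (3 * a * (1 + \<bar>r\<bar>)) * S_norm_lat j g"
proof (cases "g \<in> Domain (Q_lat j)")
  case True
  then obtain q where q: "(g, q) \<in> Q_lat j" by blast
  define s where "s = sqrt ((norm g)\<^sup>2 + (norm q)\<^sup>2)"
  have s: "norm g \<le> s" "norm q \<le> s" by (auto simp: s_def intro!: real_le_rsqrt)
  have S: "S_norm_lat j g = ennreal s" using True q by (simp add: S_norm_lat_def s_def Q_lat_unique)
  interpret U: ortho_group U
    unfolding U_def by (rule ortho_group_exp_mi self_adjoint_add_mult_op self_adjoint_H0_lat V)+
  let ?E = "phase (coord j) a"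
  have "?E (U r g) - U r g = (?E (U r g) - U r (?E g)) + U r (?E g - g)" by (simp add: U.bl_simps)
  then have "norm (?E (U r g) - U r g) \<le> norm (?E (U r g) - U r (?E g)) + norm (?E g - g)"
    by (metis norm_triangle_ineq U.norm)
  also have "\<dots> \<le> \<bar>r\<bar> * (2 * \<bar>a\<bar> * norm g) + \<bar>a\<bar> * norm q"
    using exp_lat_phase_bound[OF V, of j a r g] norm_phase_diff_le[OF _ q[unfolded Q_lat_def], of a]
    by (intro add_mono) (simp_all add: U_def)
  also have "\<dots> \<le> \<bar>r\<bar> * (2 * \<bar>a\<bar> * s) + \<bar>a\<bar> * s"
    using s by (intro add_mono mult_left_mono) auto
  \<comment> \<open>Two from the commutator along the evolution and one from the phase increment of
    \<open>g\<close> itself.\<close>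
  also have "\<dots> \<le> 3 * a * (1 + \<bar>r\<bar>) * s"
  proof -
    have "0 \<le> s" using s(1) norm_ge_zero[of g] by linarith
    then have "0 \<le> a * s" "0 \<le> a * (s * \<bar>r\<bar>)" using a by simp_all
    then show ?thesis using a by (simp add: algebra_simps)
  qed
  finally show ?thesis using a by (simp add: S ennreal_leI flip: ennreal_mult')
next
  case False
  then show ?thesis using a by (simp add: S_norm_lat_def ennreal_mult_top)
qed

text \<open>The phase commutator is built from shifts and so commutes with the free evolution. What
  remains is to compare the phase conjugated by \<open>W s\<close> with the identity as a tends to
  0, uniformly for s between 0 and t.\<close>

lemma exp_lat_free:
  assumes q: "(f, q) \<in> Q_lat j"
  defines "W \<equiv> exp_mi H0_lat"
  shows "(W t f, W t q + t *\<^sub>R W t (app (P_lat j) f)) \<in> Q_lat j"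
proof -
  note sa = self_adjoint_H0_lat
  interpret W: ortho_group W unfolding W_def by (rule ortho_group_exp_mi[OF sa])
  have gW: "generator W = skew_graph H0_lat" unfolding W_def by (rule generator_exp_mi[OF sa])
  have W_C: "W t (c *\<^sub>C f) = c *\<^sub>C W t f" for t c f unfolding W_def by (rule exp_mi_scaleC[OF sa])
  interpret E: ortho_group "phase (coord j)" by (rule ortho_group_phase) simp
  define p where "p = \<i> *\<^sub>C app (P_lat j) f"
  have gen: "(g, (- \<i>) *\<^sub>C lattice_laplace g) \<in> generator W" for g
    by (auto simp: gW skew_graph_def H0_lat_eq)
  have W_shift: "shift l k (W t g) = W t (shift l k g)" for l k t g
  proof (rule W.commute_bounded[OF bounded_linear_shift])
    show "closure (Domain (generator W)) = UNIV" unfolding gW by (rule self_adjoint_dense[OF sa])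
    fix g h assume "(g, h) \<in> generator W"
    then have "h = (- \<i>) *\<^sub>C lattice_laplace g" using gen by (rule generator_unique)
    moreover have "shift l k (lattice_laplace g) = lattice_laplace (shift l k g)"
      unfolding lattice_laplace_def
      by (simp add: linear_sum[OF linear_shift]
          linear_add[OF linear_shift] shift_commute[of l])
    ultimately show "(shift l k g, shift l k h) \<in> generator W"
      using gen[of "shift l k g"] by (simp add: shift_scaleC)
  qed
  have W_com: "phase_commutator j a (W t g) = W t (phase_commutator j a g)" for a t g
    by (simp add: phase_commutator_def W_shift W_C W.bl_simps)
  have dev: "norm (W (- s) (phase (coord j) a (W s g)) - g)
      \<le> norm (phase (coord j) a g - g) + \<bar>s\<bar> * (2 * \<bar>a\<bar> * norm g)"
    for a s g
  proof -
    \<comment> \<open>The propagation bound with zero potential covers the free group.\<close>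
    have V0: "ess_bounded (\<lambda>n :: 'a \<Rightarrow> int. 0)" by (auto simp: ess_bounded_def)
    have z: "mul (\<lambda>n. 0) h = 0" for h :: "('a \<Rightarrow> int) L2"
      by (rule L2_lattice_eqI) (use rep_mul[of "\<lambda>n. 0" 0 h] in simp)
    have "op_add H0_lat (mult_op (\<lambda>n :: 'a \<Rightarrow> int. 0)) = H0_lat"
      unfolding op_add_mult_op[OF V0] by (simp add: z)
    with exp_lat_phase_bound[OF V0, of j a s g]
    have 1: "norm (phase (coord j) a (W s g) - W s (phase (coord j) a g))
        \<le> \<bar>s\<bar> * (2 * \<bar>a\<bar> * norm g)"
      by (simp add: W_def)
    have "W (- s) (phase (coord j) a (W s g)) - g =
        W (- s) (phase (coord j) a (W s g) - W s (phase (coord j) a g)) + (phase (coord j) a g - g)"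
      by (simp add: W.bl_simps)
    then have "norm (W (- s) (phase (coord j) a (W s g)) - g) \<le>
        norm (phase (coord j) a (W s g) - W s (phase (coord j) a g)) + norm (phase (coord j) a g -
            g)"
      by (metis norm_triangle_ineq W.norm)
    with 1 show ?thesis by simp
  qed
  have gE: "(f, \<i> *\<^sub>C q) \<in> generator (phase (coord j))"
    using q unfolding Q_lat_def by (intro generator_phaseI) simp_all
  \<comment> \<open>The first summand compares the commutator quotient with its limit
    \<open>p\<close>; the other two bound how far the conjugated phase moves \<open>p\<close>, by
    \<open>dev\<close> and |s| \<le> |t|.\<close>
  define r where "r a = norm (\<i> *\<^sub>C (phase_commutator j a f /\<^sub>R a) - p) + (norm (phase (coord j) a
      p - p) + \<bar>t\<bar> * (2 * \<bar>a\<bar> * norm p))" for a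
  have bound: "norm (phase (coord j) a (W t f) - W t (phase (coord j) a f) - (t * a) *\<^sub>R W t p)
      \<le> \<bar>t\<bar> * (\<bar>a\<bar> * r a)"
    if a: "a \<noteq> 0" for a
  proof -
    let ?E = "phase (coord j) a"
    have "norm (?E (W t f) - W t (?E f) - t *\<^sub>R W t (a *\<^sub>R p)) \<le> \<bar>t\<bar> * (\<bar>a\<bar> * r a)"
    proof (rule W.commutator_bound[OF E.bounded_linear])
      show "((\<lambda>s. W s f) has_vector_derivative (- \<i>) *\<^sub>C lattice_laplace (W s f)) (at s)" for s
        using W.has_vector_derivative_orbit[OF gen[of f], of s]
          generator_unique[OF W.generator_orbit[OF gen[of f], of s] gen] by simp
      have "(- \<i>) *\<^sub>C lattice_laplace (?E g) = ?E ((- \<i>) *\<^sub>C lattice_laplace g) + (- \<i>) *\<^sub>C ?E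
          (phase_commutator j a g)" for g
        by (simp add: lattice_laplace_phase phase_scaleC scaleC_add_right E.bl_simps)
      then show "(?E (W s f), ?E ((- \<i>) *\<^sub>C lattice_laplace (W s f)) + (- \<i>) *\<^sub>C ?E
          (phase_commutator j a (W s f))) \<in> generator W" for s
        using gen[of "?E (W s f)"] by simp
      fix s assume "s \<in> closed_segment 0 t"
      then have s: "\<bar>s\<bar> \<le> \<bar>t\<bar>" by (auto simp: closed_segment_eq_real_ivl split: if_splits)
      let ?T = "\<lambda>x. W (- s) (?E (W s x))"
      have T: "?T (x - y) = ?T x - ?T y" "?T (b *\<^sub>R x) = b *\<^sub>R ?T x" "norm (?T x) = norm x"
          for x y and b :: real
        by (simp_all add: W.bl_simps E.bl_simps)
      let ?k = "\<i> *\<^sub>C (phase_commutator j a f /\<^sub>R a)"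
      have ak: "a *\<^sub>R ?k = \<i> *\<^sub>C phase_commutator j a f"
        using a by (simp add: scaleC_scaleR)
      have "W (- s) ((- \<i>) *\<^sub>C ?E (phase_commutator j a (W s f))) = - ?T (a *\<^sub>R ?k)"
        unfolding ak by (simp add: W_com W_C phase_scaleC scaleC_minus_left W.bl_simps)
      then have "W (- s) ((- \<i>) *\<^sub>C ?E (phase_commutator j a (W s f))) + a *\<^sub>R p
          = - (a *\<^sub>R (?T (?k - p) + (?T p - p)))"
        unfolding T by (simp add: algebra_simps)
      then have "norm (W (- s) ((- \<i>) *\<^sub>C ?E (phase_commutator j a (W s f))) + a *\<^sub>R p)
          = \<bar>a\<bar> * norm (?T (?k - p) + (?T p - p))" by (simp only: norm_minus_cancel norm_scaleR)
      also have "\<dots> \<le> \<bar>a\<bar> * (norm (?k - p) + norm (?T p - p))"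
        using norm_triangle_ineq[of "?T (?k - p)" "?T p - p"] unfolding T(3)
            by (intro mult_left_mono) auto
      also have "\<dots> \<le> \<bar>a\<bar> * r a"
      proof (rule mult_left_mono)
        have "norm (?T p - p) \<le> norm (?E p - p) + \<bar>s\<bar> * (2 * \<bar>a\<bar> * norm p)" by (rule dev)
        also have "\<dots> \<le> norm (?E p - p) + \<bar>t\<bar> * (2 * \<bar>a\<bar> * norm p)"
          using s by (intro add_left_mono mult_right_mono) auto
        finally show "norm (?k - p) + norm (?T p - p) \<le> r a" by (simp add: r_def)
      qed simp
      finally show "norm (W (- s) ((- \<i>) *\<^sub>C ?E (phase_commutator j a (W s f))) + a *\<^sub>R p)
          \<le> \<bar>a\<bar> * r a" .
    qed
    then show ?thesis by (simp add: W.bl_simps)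
  qed
  have "(r \<longlongrightarrow> norm (\<i> *\<^sub>C (\<i> *\<^sub>C (shift j 1 f - shift j (- 1) f)) - p) + (norm (phase (coord j) 0 p
      - p) + \<bar>t\<bar> * (2 * \<bar>0\<bar> * norm p))) (at 0)"
    unfolding r_def
    by (intro tendsto_intros bounded_linear.tendsto[OF bounded_linear_scaleC]
        phase_commutator_tendsto E.tendsto)
  then have r0: "((\<lambda>a. \<bar>t\<bar> * r a) \<longlongrightarrow> 0) (at 0)"
    by (intro tendsto_mult_right_zero) (simp add: p_def P_lat_eq)
  have "((\<lambda>a. (phase (coord j) a (W t f) - W t f) /\<^sub>R a - (W t ((phase (coord j) a f - f) /\<^sub>R a) +
      t *\<^sub>R W t p)) \<longlongrightarrow> 0) (at 0)"
  proof (rule Lim_null_comparison[OF _ r0])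
    have "norm ((phase (coord j) a (W t f) - W t f) /\<^sub>R a - (W t ((phase (coord j) a f - f) /\<^sub>R a)
        + t *\<^sub>R W t p)) \<le> \<bar>t\<bar> * r a"
      if a: "a \<noteq> 0" for a
    proof -
      have "(phase (coord j) a (W t f) - W t f) /\<^sub>R a - (W t ((phase (coord j) a f - f) /\<^sub>R a) + t
          *\<^sub>R W t p)
          = (phase (coord j) a (W t f) - W t (phase (coord j) a f) - (t * a) *\<^sub>R W t p) /\<^sub>R a"
        using a by (simp add: W.bl_simps algebra_simps)
      then have "norm ((phase (coord j) a (W t f) - W t f) /\<^sub>R a - (W t ((phase (coord j) a f - f)
          /\<^sub>R a) + t *\<^sub>R W t p))
          = norm (phase (coord j) a (W t f) - W t (phase (coord j) a f) - (t * a) *\<^sub>R W t p) / \<bar>a\<bar>"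
        by (simp only: norm_scaleR abs_inverse divide_inverse_commute)
      also have "\<dots> \<le> \<bar>t\<bar> * r a"
        using bound[OF a] a by (simp add: pos_divide_le_eq mult_ac)
      finally show ?thesis .
    qed
    then show "\<forall>\<^sub>F a in at 0. norm ((phase (coord j) a (W t f) - W t f) /\<^sub>R a - (W t ((phase
        (coord j) a f - f) /\<^sub>R a) + t *\<^sub>R W t p)) \<le> \<bar>t\<bar> * r a"
      by (auto simp: eventually_at_filter)
  qed
  moreover have "((\<lambda>a. W t ((phase (coord j) a f - f) /\<^sub>R a) + t *\<^sub>R W t p)
      \<longlongrightarrow> W t (\<i> *\<^sub>C q) + t *\<^sub>R W t p) (at 0)"
    using generatorD[OF gE, unfolded has_vector_derivative_iff_quotient]
    by (intro tendsto_intros bounded_linear.tendsto[OF W.bounded_linear]) simp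
  ultimately have "((\<lambda>a. (phase (coord j) a (W t f) - W t f) /\<^sub>R a)
      \<longlongrightarrow> W t (\<i> *\<^sub>C q) + t *\<^sub>R W t p) (at 0)"
    using tendsto_add by fastforce
  then have "(W t f, W t (\<i> *\<^sub>C q) + t *\<^sub>R W t p) \<in> generator (phase (coord j))"
    by (simp add: generator_def has_vector_derivative_iff_quotient)
  from generator_phaseD[OF _ this]
  show ?thesis
    by (simp add: Q_lat_def p_def W_C scaleC_add_right scaleC_scaleR flip: scaleC_scaleR)
qed

theorem lattice_case:
  fixes V :: "('n::finite \<Rightarrow> int) \<Rightarrow> real" and \<psi> :: "('n \<Rightarrow> int) L2" and j :: 'n
  defines "H \<equiv> op_add H0_lat (mult_op V)"
  assumes V: "ess_bounded V" and \<psi>: "\<psi> \<in> Domain (Q_lat j)"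
    and fin: "(\<integral>\<^sup>+t\<in>{0..}. ennreal (1 + t) * S_norm_lat j (app (mult_op V) (exp_mi H0_lat t \<psi>))
        \<partial>lborel) < \<infinity>"
    and fin': "(\<integral>\<^sup>+t\<in>{0..}. ennreal (1 + t) *
      ennreal (norm (app (mult_op V) (exp_mi H0_lat t (app (P_lat j) \<psi>)))) \<partial>lborel) < \<infinity>"
  shows "Omega_exists H H0_lat \<psi> \<and> Omega_exists H H0_lat (app (P_lat j) \<psi>) \<and>
    Omega H H0_lat \<psi> \<in> Domain (Q_lat j) \<and>
    asymptotic_velocity H (Q_lat j) (Omega H H0_lat \<psi>) (Omega H H0_lat (app (P_lat j) \<psi>))"
proof -
  obtain q where q: "(\<psi>, q) \<in> Q_lat j" using \<psi> by blast
  have "Omega_exists H H0_lat \<psi> \<and> Omega_exists H H0_lat (app (P_lat j) \<psi>) \<and>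
    Omega H H0_lat \<psi> \<in> Domain (mult_op (coord j)) \<and>
    asymptotic_velocity H (mult_op (coord j)) (Omega H H0_lat \<psi>) (1 *\<^sub>R Omega H H0_lat (app (P_lat
        j) \<psi>)) \<and>
    norm (Omega H H0_lat (app (P_lat j) \<psi>)) = norm (app (P_lat j) \<psi>)"
    unfolding H_def
  proof (rule scattering_velocity[OF self_adjoint_H0_lat V, where S = "S_norm_lat j" and C = 3
      and q = q])
    show "ennreal (norm g) \<le> S_norm_lat j g" for g
      by (auto simp: S_norm_lat_def intro!: ennreal_leI real_le_rsqrt)
    show "(exp_mi H0_lat t \<psi>, exp_mi H0_lat t q + (t * 1) *\<^sub>R exp_mi H0_lat t (app (P_lat j) \<psi>)) \<in>
        mult_op (coord j)" for t
      using exp_lat_free[OF q, of t] by (simp add: Q_lat_def)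
  qed (use fin fin' in \<open>simp_all add: exp_lat_S_norm_bound[OF V]\<close>)
  then show ?thesis by (simp add: Q_lat_def)
qed

section \<open>Test functions\<close>

text \<open>Continuous differentiability with an arbitrary family of differentials as witness, so
  that products, compositions and translates need no computation of
  \<open>frechet_derivative\<close>.\<close>

definition smooth1 :: "(real ^ 'n::finite \<Rightarrow> real) \<Rightarrow> bool" where
  "smooth1 u \<longleftrightarrow> (\<exists>D. (\<forall>x. (u has_derivative D x) (at x)) \<and> (\<forall>v. continuous_on UNIV (\<lambda>x. D x v)))"

lemma smooth1I:
  "(\<And>x. (u has_derivative D x) (at x)) \<Longrightarrow> (\<And>v. continuous_on UNIV (\<lambda>x. D x v)) \<Longrightarrow> smooth1 u"
  unfolding smooth1_def by blast

lemma C1_iff_smooth1: "C1 u \<longleftrightarrow> smooth1 u"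
proof
  assume u: "C1 u"
  then have D: "(u has_derivative frechet_derivative u (at x)) (at x)" for x
    by (simp add: C1_def flip: frechet_derivative_works)
  have "frechet_derivative u (at x) v = (\<Sum>l\<in>UNIV. (v $ l) * partial l u x)" for x v
  proof -
    have lin: "linear (frechet_derivative u (at x))" using D by (rule has_derivative_linear)
    have "v = (\<Sum>l\<in>UNIV. (v $ l) *\<^sub>R axis l 1)"
      using basis_expansion[of v] by (simp add: scalar_mult_eq_scaleR)
    then have "frechet_derivative u (at x) v = frechet_derivative u (at x) (\<Sum>l\<in>UNIV. (v $ l) *\<^sub>R
        axis l 1)"
      by simp
    also have "\<dots> = (\<Sum>l\<in>UNIV. (v $ l) * partial l u x)"
      by (simp add: linear_sum[OF lin] linear_scale[OF lin] partial_def)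
    finally show ?thesis .
  qed
  then have "continuous_on UNIV (\<lambda>x. frechet_derivative u (at x) v)" for v
    using u by (auto simp: C1_def intro!: continuous_intros)
  with D show "smooth1 u" by (rule smooth1I)
next
  assume "smooth1 u"
  then obtain D where D: "\<And>x. (u has_derivative D x) (at x)" "\<And>v. continuous_on UNIV (\<lambda>x. D x v)"
    unfolding smooth1_def by blast
  have "partial l u = (\<lambda>x. D x (axis l 1))" for l
    unfolding partial_def using frechet_derivative_at[OF D(1)] by metis
  then show "C1 u" using D unfolding C1_def differentiable_def by auto
qed

lemma smooth1_const: "smooth1 (\<lambda>x. c)"
  unfolding smooth1_def by (intro exI[of _ "\<lambda>x v. 0"]) auto

lemma smooth1_nth: "smooth1 (\<lambda>x. x $ l)"
  unfolding smooth1_def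
  by (intro exI[of _ "\<lambda>x v. v $ l"]) (auto intro: bounded_linear_imp_has_derivative
      bounded_linear_vec_nth)

lemma smooth1_add:
  assumes "smooth1 u" "smooth1 w" shows "smooth1 (\<lambda>x. u x + w x)"
proof -
  obtain D E where D: "\<And>x. (u has_derivative D x) (at x)" "\<And>v. continuous_on UNIV (\<lambda>x. D x v)"
    and E: "\<And>x. (w has_derivative E x) (at x)" "\<And>v. continuous_on UNIV (\<lambda>x. E x v)"
    using assms unfolding smooth1_def by blast
  show ?thesis
    by (rule smooth1I[where D = "\<lambda>x v. D x v + E x v"])
      (rule has_derivative_add[OF D(1) E(1)] continuous_on_add[OF D(2) E(2)])+
qed

lemma smooth1_continuous:
  assumes "smooth1 u" shows "continuous_on UNIV u"
proof -
  obtain D where D: "\<And>x. (u has_derivative D x) (at x)" using assms unfolding smooth1_def by blast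
  show ?thesis
    by (rule continuous_at_imp_continuous_on) (intro ballI has_derivative_continuous[OF D])
qed

lemma smooth1_mult:
  assumes "smooth1 u" "smooth1 w" shows "smooth1 (\<lambda>x. u x * w x)"
proof -
  obtain D E where D: "\<And>x. (u has_derivative D x) (at x)" "\<And>v. continuous_on UNIV (\<lambda>x. D x v)"
    and E: "\<And>x. (w has_derivative E x) (at x)" "\<And>v. continuous_on UNIV (\<lambda>x. E x v)"
    using assms unfolding smooth1_def by blast
  show ?thesis
  proof (rule smooth1I[where D = "\<lambda>x v. u x * E x v + D x v * w x"])
    show "((\<lambda>x. u x * w x) has_derivative (\<lambda>v. u x * E x v + D x v * w x)) (at x)" for x
      by (rule has_derivative_mult[OF D(1) E(1)])
    show "continuous_on UNIV (\<lambda>x. u x * E x v + D x v * w x)" for v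
      by (intro continuous_on_add continuous_on_mult smooth1_continuous assms D E)
  qed
qed

lemma smooth1_prod: "(\<And>i. i \<in> I \<Longrightarrow> smooth1 (u i)) \<Longrightarrow> smooth1 (\<lambda>x. \<Prod>i\<in>I. u i x)"
  by (induction I rule: infinite_finite_induct) (auto intro: smooth1_const smooth1_mult)

lemma smooth1_compose:
  assumes u: "smooth1 u" and p: "\<And>t. (p has_real_derivative p' t) (at t)" "continuous_on UNIV p'"
  shows "smooth1 (\<lambda>x. p (u x))"
proof -
  obtain D where D: "\<And>x. (u has_derivative D x) (at x)" "\<And>v. continuous_on UNIV (\<lambda>x. D x v)"
    using u unfolding smooth1_def by blast
  have c: "continuous_on UNIV u" by (rule smooth1_continuous[OF u])
  have "((\<lambda>x. p (u x)) has_derivative (\<lambda>v. D x v * p' (u x))) (at x)" for x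
    using has_derivative_compose[OF D(1) p(1)[unfolded has_field_derivative_def], of x]
    by (simp add: mult.commute)
  moreover have "continuous_on UNIV (\<lambda>x. D x v * p' (u x))" for v
    by (intro continuous_on_mult D continuous_on_compose2[OF p(2) c]) auto
  ultimately show ?thesis by (rule smooth1I[where D = "\<lambda>x v. D x v * p' (u x)"])
qed

lemma smooth1_translate:
  assumes "smooth1 u" shows "smooth1 (\<lambda>x. u (c + x))"
proof -
  obtain D where D: "\<And>x. (u has_derivative D x) (at x)" "\<And>v. continuous_on UNIV (\<lambda>x. D x v)"
    using assms unfolding smooth1_def by blast
  have "((\<lambda>x. u (c + x)) has_derivative (\<lambda>v. D (c + x) v)) (at x)" for x
    by (rule has_derivative_compose[OF _ D(1)]) (auto intro!: derivative_eq_intros)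
  moreover have "continuous_on UNIV (\<lambda>x. D (c + x) v)" for v
    by (rule continuous_on_compose2[OF D(2)]) (auto intro!: continuous_intros)
  ultimately show ?thesis by (rule smooth1I[where D = "\<lambda>x v. D (c + x) v"])
qed

definition test :: "(real ^ 'n::finite \<Rightarrow> real) \<Rightarrow> bool" where
  "test u \<longleftrightarrow> C1 u \<and> compact (closure {x. u x \<noteq> 0})"

lemma test_iff: "test u \<longleftrightarrow> smooth1 u \<and> bounded {x. u x \<noteq> 0}"
  by (simp add: test_def C1_iff_smooth1 compact_closure)

lemma test_add:
  assumes "test u" "test w" shows "test (\<lambda>x. u x + w x)"
proof -
  have "bounded ({x. u x \<noteq> 0} \<union> {x. w x \<noteq> 0})" using assms by (simp add: test_iff)
  then have "bounded {x. u x + w x \<noteq> 0}" by (rule bounded_subset) auto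
  then show ?thesis using assms smooth1_add[of u w] by (simp add: test_iff)
qed

lemma test_scale:
  assumes "test u" shows "test (\<lambda>x. r * u x)"
proof -
  have "bounded {x. u x \<noteq> 0}" using assms by (simp add: test_iff)
  then have "bounded {x. r * u x \<noteq> 0}" by (rule bounded_subset) auto
  then show ?thesis using assms smooth1_mult[OF smooth1_const, of u r] by (simp add: test_iff)
qed

lemma test_translate:
  assumes u: "test u" shows "test (\<lambda>x. u (c + x))"
proof -
  obtain R where R: "\<And>x. u x \<noteq> 0 \<Longrightarrow> norm x \<le> R"
    using u by (auto simp: test_iff bounded_iff)
  have "bounded {x. u (c + x) \<noteq> 0}"
  proof (rule boundedI[of _ "R + norm c"])
    fix x assume "x \<in> {x. u (c + x) \<noteq> 0}"
    then have "norm (c + x) \<le> R" by (simp add: R)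
    then show "norm x \<le> R + norm c" using norm_triangle_ineq4[of "c + x" c] by simp
  qed
  then show ?thesis using u smooth1_translate[of u c] by (simp add: test_iff)
qed

lemma test_continuous: "test u \<Longrightarrow> continuous_on UNIV u"
  unfolding test_iff by (blast intro: smooth1_continuous)

lemma test_line_derivative:
  assumes "test u"
  shows "((\<lambda>s. u (s *\<^sub>R axis l 1 + x)) has_vector_derivative partial l u (s *\<^sub>R axis l 1 + x)) (at
      s)"
proof -
  have "(u has_derivative frechet_derivative u (at y)) (at y)" for y
    using assms by (simp add: test_def C1_def flip: frechet_derivative_works)
  moreover have "((\<lambda>s. s *\<^sub>R axis l 1 + x) has_derivative (\<lambda>h. h *\<^sub>R axis l 1)) (at s)"
    by (auto intro!: derivative_eq_intros)
  ultimately have "((\<lambda>s. u (s *\<^sub>R axis l 1 + x)) has_derivative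
      (\<lambda>h. frechet_derivative u (at (s *\<^sub>R axis l 1 + x)) (h *\<^sub>R axis l 1))) (at s)"
    by (rule has_derivative_compose[rotated])
  moreover have "linear (frechet_derivative u (at (s *\<^sub>R axis l 1 + x)))"
    using \<open>\<And>y. (u has_derivative frechet_derivative u (at y)) (at y)\<close> has_derivative_linear by blast
  ultimately show ?thesis
    by (simp add: has_vector_derivative_def partial_def linear_scale)
qed

lemma partial_zero:
  assumes "x \<notin> closure {x. u x \<noteq> 0}" shows "partial l u x = 0"
proof -
  have "(u has_derivative (\<lambda>v. 0)) (at x)"
  proof (rule has_derivative_transform_within_open[of "\<lambda>x. 0"])
    show "open (- closure {x. u x \<noteq> 0})" "x \<in> - closure {x. u x \<noteq> 0}" using assms by auto
    show "0 = u y" if "y \<in> - closure {x. u x \<noteq> 0}" for y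
      using that closure_subset[of "{x. u x \<noteq> 0}"] by auto
  qed auto
  then have "frechet_derivative u (at x) = (\<lambda>v. 0)" using frechet_derivative_at by metis
  then show ?thesis by (simp add: partial_def)
qed

lemma partial_bounded:
  assumes u: "test u"
  obtains B where "0 \<le> B" "\<And>x. \<bar>partial l u x\<bar> \<le> B"
proof -
  have "continuous_on (closure {x. u x \<noteq> 0}) (partial l u)"
    using u by (auto simp: test_def C1_def intro: continuous_on_subset)
  then have "bounded (partial l u ` closure {x. u x \<noteq> 0})"
    using u by (intro compact_imp_bounded compact_continuous_image) (auto simp: test_def)
  then obtain B where B: "0 < B" "\<And>x. x \<in> closure {x. u x \<noteq> 0} \<Longrightarrow> \<bar>partial l u x\<bar> \<le> B"
    unfolding bounded_pos by auto
  have "\<bar>partial l u x\<bar> \<le> B" for x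
    using B partial_zero[of x u l] by (cases "x \<in> closure {x. u x \<noteq> 0}") auto
  then show ?thesis using B(1) by (intro that[of B]) auto
qed

lemma ref_measure_lborel: "(ref_measure :: (real ^ 'n::finite) measure) = lborel"
  by (rule ref_measure_vec_def)

lemma square_integrable_bounded_support:
  fixes f :: "real ^ 'n::finite \<Rightarrow> complex"
  assumes f: "f \<in> borel_measurable borel" and B: "\<And>x. norm (f x) \<le> B" and S: "bounded {x. f x \<noteq> 0}"
  shows "square_integrable f"
proof -
  obtain R where R: "\<And>x. f x \<noteq> 0 \<Longrightarrow> norm x \<le> R" using S unfolding bounded_iff by auto
  have "integrable lborel (\<lambda>x. (norm (f x))\<^sup>2)"
  proof (rule Bochner_Integration.integrable_bound)
    show "integrable lborel (\<lambda>x :: real ^ 'n. indicator (cball 0 R) x *\<^sub>R B\<^sup>2 :: real)"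
      using emeasure_lborel_cball_finite[of "0 :: real ^ 'n" R]
      by (intro integrable_scaleR_left integrable_real_indicator) auto
    show "(\<lambda>x. (norm (f x))\<^sup>2) \<in> borel_measurable lborel" using f by measurable
    show "AE x in lborel. norm ((norm (f x))\<^sup>2) \<le> norm (indicator (cball 0 R) x *\<^sub>R B\<^sup>2 :: real)"
    proof (intro AE_I2)
      fix x
      show "norm ((norm (f x))\<^sup>2) \<le> norm (indicator (cball 0 R) x *\<^sub>R B\<^sup>2 :: real)"
      proof (cases "f x = 0")
        case False
        then have "indicator (cball 0 R) x = (1::real)" using R by simp
        then show ?thesis using power_mono[OF B[of x] norm_ge_zero, of 2] by simp
      qed simp
    qed
  qed
  then show ?thesis using f by (simp add: square_integrable_def ref_measure_lborel)
qed

definition test_L2 :: "(real ^ 'n::finite \<Rightarrow> real) \<Rightarrow> (real ^ 'n) L2" where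
  "test_L2 u = abs_L2 (\<lambda>x. of_real (u x))"

lemma square_integrable_test: "test u \<Longrightarrow> square_integrable (\<lambda>x. of_real (u x))"
proof -
  assume u: "test u"
  have c: "continuous_on UNIV u" by (rule test_continuous[OF u])
  have "bounded (u ` closure {x. u x \<noteq> 0})"
    using u continuous_on_subset[OF c] by (intro compact_imp_bounded compact_continuous_image)
        (auto simp: test_def)
  then obtain B where B: "0 < B" "\<And>x. x \<in> closure {x. u x \<noteq> 0} \<Longrightarrow> \<bar>u x\<bar> \<le> B"
    unfolding bounded_pos by auto
  have "\<bar>u x\<bar> \<le> B" for x
    using B closure_subset[of "{x. u x \<noteq> 0}"] by (cases "u x = 0") auto
  then show ?thesis
    using u borel_measurable_continuous_onI[OF c]
    by (intro square_integrable_bounded_support[of _ B]) (auto simp: test_iff)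
qed

lemma square_integrable_partial: "test u \<Longrightarrow> square_integrable (\<lambda>x. of_real (partial l u x))"
proof -
  assume u: "test u"
  obtain B where "0 \<le> B" and B: "\<And>x. \<bar>partial l u x\<bar> \<le> B"
    by (rule partial_bounded[OF u, of l]) blast
  have c: "continuous_on UNIV (partial l u)" using u by (simp add: test_def C1_def)
  have "bounded {x. partial l u x \<noteq> 0}"
    by (rule bounded_subset[of "closure {x. u x \<noteq> 0}"])
      (use u partial_zero[of _ u l] in \<open>auto simp: test_def compact_imp_bounded\<close>)
  then show ?thesis
    using B borel_measurable_continuous_onI[OF c]
    by (intro square_integrable_bounded_support[of _ B]) auto
qed

lemma rep_test: "test u \<Longrightarrow> AE x in lborel. rep_L2 (test_L2 u) x = of_real (u x)"
  using rep_abs_L2[OF square_integrable_test, of u] unfolding test_L2_def ref_measure_lborel by simp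

lemma rep_test_partial: "test u \<Longrightarrow> AE x in lborel. rep_L2 (test_L2 (partial l u)) x
    = of_real (partial l u x)"
  using rep_abs_L2[OF square_integrable_partial, of u l] unfolding test_L2_def ref_measure_lborel
      by simp

text \<open>The imaginary part of the complex pairing is again a real inner product, with i times
  the test function. This is how conditions on complex integrals are read in the real Hilbert
  space.\<close>

lemma integral_pairing:
  fixes f :: "(real ^ 'n::finite) L2"
  assumes u: "square_integrable (\<lambda>x. complex_of_real (u x))"
  shows "integral\<^sup>L lborel (\<lambda>x. u x *\<^sub>R rep_L2 f x) = Complex (test_L2 u \<bullet> f) ((\<i> *\<^sub>C test_L2 u) \<bullet>
      f)"
    and "integrable lborel (\<lambda>x. u x *\<^sub>R rep_L2 f x)"
proof -
  have r: "AE x in lborel. rep_L2 (test_L2 u) x = of_real (u x)"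
    using rep_abs_L2[OF u] unfolding test_L2_def ref_measure_lborel .
  have ri: "AE x in lborel. rep_L2 (\<i> *\<^sub>C test_L2 u) x = \<i> * rep_L2 (test_L2 u) x"
    using rep_scaleC[of \<i> "test_L2 u"] unfolding ref_measure_lborel .
  have m [measurable]: "rep_L2 h \<in> borel_measurable borel" for h :: "(real ^ 'n) L2"
    using measurable_rep_L2[of h] by (simp add: ref_measure_lborel)
  have mu: "(\<lambda>x. complex_of_real (u x)) \<in> borel_measurable borel"
    using u by (simp add: square_integrable_def ref_measure_lborel)
  have mu' [measurable]: "u \<in> borel_measurable borel"
    using measurable_compose[OF mu borel_measurable_Re] by simp
  have mf: "(\<lambda>x. u x *\<^sub>R rep_L2 f x) \<in> borel_measurable borel"
    by measurable
  show int: "integrable lborel (\<lambda>x. u x *\<^sub>R rep_L2 f x)"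
  proof (rule Bochner_Integration.integrable_bound)
    show "integrable lborel (\<lambda>x. (norm (complex_of_real (u x)))\<^sup>2 + (norm (rep_L2 f x))\<^sup>2)"
      using u integrable_rep_L2[of f] by (auto simp: square_integrable_def ref_measure_lborel)
    show "AE x in lborel. norm (u x *\<^sub>R rep_L2 f x) \<le> norm ((norm (complex_of_real (u x)))\<^sup>2 +
        (norm (rep_L2 f x))\<^sup>2)"
    proof (intro AE_I2)
      fix x
      have "2 * \<bar>u x\<bar> * norm (rep_L2 f x) \<le> \<bar>u x\<bar>\<^sup>2 + (norm (rep_L2 f x))\<^sup>2"
        by (rule sum_squares_bound)
      moreover have "0 \<le> \<bar>u x\<bar> * norm (rep_L2 f x)" by simp
      ultimately have "\<bar>u x\<bar> * norm (rep_L2 f x) \<le> \<bar>u x\<bar>\<^sup>2 + (norm (rep_L2 f x))\<^sup>2" by linarith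
      then show "norm (u x *\<^sub>R rep_L2 f x) \<le> norm ((norm (complex_of_real (u x)))\<^sup>2 + (norm
          (rep_L2 f x))\<^sup>2)"
        by simp
    qed
  qed (use mf in simp)
  have "Re (integral\<^sup>L lborel (\<lambda>x. u x *\<^sub>R rep_L2 f x)) = test_L2 u \<bullet> f"
    unfolding inner_L2 ref_measure_lborel integral_Re[OF int, symmetric]
  proof (rule Bochner_Integration.integral_cong_AE)
    show "AE x in lborel. Re (u x *\<^sub>R rep_L2 f x) = rep_L2 (test_L2 u) x \<bullet> rep_L2 f x"
      using r by eventually_elim (simp add: inner_complex_def)
  qed measurable
  moreover have "Im (integral\<^sup>L lborel (\<lambda>x. u x *\<^sub>R rep_L2 f x)) = (\<i> *\<^sub>C test_L2 u) \<bullet> f"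
    unfolding inner_L2 ref_measure_lborel integral_Im[OF int, symmetric]
  proof (rule Bochner_Integration.integral_cong_AE)
    show "AE x in lborel. Im (u x *\<^sub>R rep_L2 f x) = rep_L2 (\<i> *\<^sub>C test_L2 u) x \<bullet> rep_L2 f x"
      using r ri by eventually_elim (simp add: inner_complex_def)
  qed measurable
  ultimately show "integral\<^sup>L lborel (\<lambda>x. u x *\<^sub>R rep_L2 f x)
      = Complex (test_L2 u \<bullet> f) ((\<i> *\<^sub>C test_L2 u) \<bullet> f)"
    by (simp add: complex_eq_iff)
qed

lemma weak_partial_iff:
  "(f, g) \<in> weak_partial l \<longleftrightarrow> (\<forall>u. test u \<longrightarrow>
    test_L2 (partial l u) \<bullet> f = - (test_L2 u \<bullet> g) \<and>
    (\<i> *\<^sub>C test_L2 (partial l u)) \<bullet> f = - ((\<i> *\<^sub>C test_L2 u) \<bullet> g))"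
  unfolding weak_partial_def mem_Collect_eq prod.case test_def[symmetric]
  by (auto simp: integral_pairing(1)[OF square_integrable_test] integral_pairing(1)[OF
      square_integrable_partial]
      complex_eq_iff)

section \<open>The fundamental lemma of the calculus of variations\<close>

text \<open>The square makes the positive part continuously differentiable at 0; the product of the
  two linear factors is positive exactly between a and b when a < b.\<close>

lemma smooth1_bump: "smooth1 (\<lambda>x. (max 0 ((x $ l - a) * (b - x $ l)))\<^sup>2)"
proof (rule smooth1_compose[where p = "\<lambda>t. (max 0 t)\<^sup>2" and p' = "\<lambda>t. 2 * max 0 t"])
  have "smooth1 (\<lambda>x. (x $ l + - a) * (b + (- 1) * x $ l))"
    by (intro smooth1_mult smooth1_add smooth1_nth smooth1_const)
  then show "smooth1 (\<lambda>x. (x $ l - a) * (b - x $ l))" by simp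
  show "((\<lambda>t. (max 0 t)\<^sup>2) has_real_derivative 2 * max 0 t) (at t)" for t :: real
  proof (cases t "0 :: real" rule: linorder_cases)
    case less
    have "((\<lambda>t. (max 0 t)\<^sup>2) has_real_derivative 0) (at t)"
      by (rule has_field_derivative_transform_within_open[of "\<lambda>t. 0" _ _ "{..<0}"]) (use less in
          auto)
    then show ?thesis using less by simp
  next
    case equal
    have "((\<lambda>h. (max 0 h)\<^sup>2 / h) \<longlongrightarrow> 0) (at (0::real))"
    proof (rule Lim_null_comparison)
      show "\<forall>\<^sub>F h in at (0::real). norm ((max 0 h)\<^sup>2 / h) \<le> \<bar>h\<bar>"
        by (rule always_eventually) (auto simp: max_def power2_eq_square)
      show "((\<lambda>h. \<bar>h\<bar>) \<longlongrightarrow> 0) (at (0::real))" by (intro tendsto_rabs_zero tendsto_ident_at)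
    qed
    then show ?thesis using equal by (simp add: has_field_derivative_iff)
  next
    case greater
    have "((\<lambda>t. (max 0 t)\<^sup>2) has_real_derivative 2 * t) (at t)"
      by (rule has_field_derivative_transform_within_open[of "\<lambda>t. t\<^sup>2" _ _ "{0<..}"])
        (use greater in \<open>auto intro!: derivative_eq_intros\<close>)
    then show ?thesis using greater by simp
  qed
  show "continuous_on UNIV (\<lambda>t::real. 2 * max 0 t)" by (intro continuous_intros)
qed

lemma box_test_approximation:
  fixes a b :: "real ^ 'n::finite"
  obtains u where "\<And>k. test (u k)" "\<And>k x. 0 \<le> u k x \<and> u k x \<le> (indicator (box a b) x :: real)"
    "\<And>x. (\<lambda>k. u k x) \<longlonglongrightarrow> indicator (box a b) x"
proof (cases "\<forall>l. a $ l < b $ l")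
  case False
  then obtain l where l: "\<not> a $ l < b $ l" by blast
  have "x \<notin> box a b" for x
  proof
    assume "x \<in> box a b"
    then have "a $ l < x $ l" "x $ l < b $ l" by (simp_all add: mem_box_cart)
    with l show False by simp
  qed
  then have "box a b = {}" by blast
  then show ?thesis
    by (intro that[of "\<lambda>k x. 0"]) (auto simp: test_iff smooth1_const)
next
  case True
  define h where "h x = (\<Prod>l\<in>UNIV. (max 0 ((x $ l - a $ l) * (b $ l - x $ l)))\<^sup>2)" for x
  have h: "smooth1 h" unfolding h_def by (intro smooth1_prod smooth1_bump)
  have h_iff: "h x \<noteq> 0 \<longleftrightarrow> x \<in> box a b" for x
  proof -
    have *: "max 0 t \<noteq> 0 \<longleftrightarrow> 0 < t" for t :: real by (auto simp: max_def)
    have "max 0 ((x $ l - a $ l) * (b $ l - x $ l)) \<noteq> 0 \<longleftrightarrow> a $ l < x $ l \<and> x $ l < b $ l" for l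
      unfolding * zero_less_mult_iff using True[rule_format, of l] by linarith
    then show ?thesis by (simp add: h_def mem_box_cart)
  qed
  \<comment> \<open>As \<open>h\<close> is nonzero exactly on the box, k h^2 / (1 + k h^2) lies
    between 0 and the indicator and tends to it pointwise.\<close>
  define u where "u k x = real k * (h x)\<^sup>2 / (1 + real k * (h x)\<^sup>2)" for k x
  have pos: "0 < 1 + real k * t\<^sup>2" for k and t :: real by (simp add: add_pos_nonneg)
  show ?thesis
  proof
    have u0: "u k x = 0" if "x \<notin> box a b" for k x using h_iff that by (auto simp: u_def)
    show "test (u k)" for k
      unfolding test_iff
    proof
      show "smooth1 (u k)"
        unfolding u_def
      proof (rule smooth1_compose[OF h, where p = "\<lambda>t. real k * t\<^sup>2 / (1 + real k * t\<^sup>2)"])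
        show "((\<lambda>t. real k * t\<^sup>2 / (1 + real k * t\<^sup>2)) has_real_derivative
            2 * real k * t / (1 + real k * t\<^sup>2)\<^sup>2) (at t)" for t
          using pos[of k t] by (auto intro!: derivative_eq_intros simp: power2_eq_square
              field_simps)
        show "continuous_on UNIV (\<lambda>t. 2 * real k * t / (1 + real k * t\<^sup>2)\<^sup>2)"
          using pos[of k] by (intro continuous_intros) (metis less_irrefl zero_eq_power2)
      qed
      show "bounded {x. u k x \<noteq> 0}"
        by (rule bounded_subset[OF bounded_box]) (use u0 in blast)
    qed
    show "0 \<le> u k x \<and> u k x \<le> indicator (box a b) x" for k x
    proof (cases "x \<in> box a b")
      case True
      then show ?thesis using pos[of k "h x"] by (simp add: u_def)
    qed (simp add: u0)
    show "(\<lambda>k. u k x) \<longlonglongrightarrow> indicator (box a b) x" for x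
    proof (cases "x \<in> box a b")
      case True
      then have c: "0 < (h x)\<^sup>2" using h_iff[of x] by simp
      have "(\<lambda>k. inverse (1 + real k * (h x)\<^sup>2)) \<longlonglongrightarrow> 0"
        by (intro tendsto_inverse_0_at_top filterlim_tendsto_add_at_top[OF tendsto_const]
            filterlim_at_top_mult_tendsto_pos[OF tendsto_const c filterlim_real_sequentially])
      from tendsto_diff[OF tendsto_const[of 1] this]
      have "(\<lambda>k. 1 - inverse (1 + real k * (h x)\<^sup>2)) \<longlonglongrightarrow> 1" by simp
      moreover have "u k x = 1 - inverse (1 + real k * (h x)\<^sup>2)" for k
        using pos[of k "h x"] by (simp add: u_def field_simps)
      ultimately show ?thesis using True by simp
    qed (simp add: u0)
  qed
qed

text \<open>Boxes are stable under intersection and generate the Borel sets, so Dynkin's argument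
  reaches all of them; the total integral enters with complements. The sets where g is positive or
  negative then give the conclusion.\<close>

lemma integrable_zero_on_boxes_imp_AE_zero:
  fixes g :: "real ^ 'n::finite \<Rightarrow> real"
  assumes g: "integrable lborel g"
    and box: "\<And>a b. (\<integral>x. indicator (box a b) x *\<^sub>R g x \<partial>lborel) = 0"
    and total: "(\<integral>x. g x \<partial>lborel) = 0"
  shows "AE x in lborel. g x = 0"
proof -
  have int: "integrable lborel (\<lambda>x. indicator A x *\<^sub>R g x)" if "A \<in> sets borel" for A
    using that g by (intro integrable_mult_indicator) auto
  have *: "(\<integral>x. indicator A x *\<^sub>R g x \<partial>lborel) = 0" if "A \<in> sets borel" for A
  proof -
    have "Int_stable (range (\<lambda>(a, b). box a b :: (real ^ 'n) set))"
      by (force simp: Int_stable_def box_Int_box)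
    moreover have "range (\<lambda>(a, b). box a b :: (real ^ 'n) set) \<subseteq> Pow UNIV" by auto
    moreover have "A \<in> sigma_sets UNIV (range (\<lambda>(a, b). box a b :: (real ^ 'n) set))"
      using that by (simp add: borel_eq_box)
    ultimately show ?thesis
    proof (induction rule: sigma_sets_induct_disjoint)
      case (basic A)
      then show ?case using box by auto
    next
      case (compl A)
      then have A: "A \<in> sets borel" by (simp add: borel_eq_box)
      have "(\<integral>x. indicator (UNIV - A) x *\<^sub>R g x \<partial>lborel)
          = (\<integral>x. g x - indicator A x *\<^sub>R g x \<partial>lborel)"
        by (intro Bochner_Integration.integral_cong) (auto simp: indicator_def)
      also have "\<dots> = 0" using compl g int[OF A] total by simp
      finally show ?case .
    next
      case (union A)
      then have A: "A i \<in> sets borel" for i by (auto simp: borel_eq_box)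
      have "(\<integral>x\<in>(\<Union>i. A i). g x \<partial>lborel) = (\<Sum>i. \<integral>x\<in>A i. g x \<partial>lborel)"
        using A union(1) int[of "\<Union>i. A i"]
        by (intro lebesgue_integral_countable_add) (auto simp: disjoint_family_on_def
            set_integrable_def)
      then show ?case using union by (simp add: set_lebesgue_integral_def)
    qed simp
  qed
  have m: "g \<in> borel_measurable borel" using g by auto
  have "AE x in lborel. indicator {x. 0 < g x} x *\<^sub>R g x = 0"
    using *[of "{x. 0 < g x}"] int[of "{x. 0 < g x}"] m
    by (subst integral_nonneg_eq_0_iff_AE[symmetric]) (auto simp: indicator_def)
  moreover have "AE x in lborel. - (indicator {x. g x < 0} x *\<^sub>R g x) = 0"
    using *[of "{x. g x < 0}"] int[of "{x. g x < 0}"] m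
    by (subst integral_nonneg_eq_0_iff_AE[symmetric]) (auto simp: indicator_def)
  ultimately show ?thesis by eventually_elim (auto simp: indicator_def split: if_splits)
qed

text \<open>A square integrable function need not be integrable, so the argument is localised to a
  box. Its integrals over smaller boxes vanish because boxes intersect in boxes, and countably many
  boxes cover the space.\<close>

lemma test_orthogonal_imp_zero:
  fixes f :: "(real ^ 'n::finite) L2"
  assumes u: "\<And>u. test u \<Longrightarrow> test_L2 u \<bullet> f = 0" "\<And>u. test u \<Longrightarrow> (\<i> *\<^sub>C test_L2 u) \<bullet> f = 0"
  shows "f = 0"
proof -
  let ?f = "rep_L2 f"
  have m [measurable]: "?f \<in> borel_measurable borel"
    using measurable_rep_L2[of f] by (simp add: ref_measure_lborel)
  have int: "integrable lborel (\<lambda>x. indicator (box a b) x *\<^sub>R ?f x)" for a b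
    by (rule integral_pairing(2), rule square_integrable_bounded_support[where B = 1])
      (auto simp: indicator_def intro: bounded_subset[OF bounded_box])
  have box: "(\<integral>x. indicator (box a b) x *\<^sub>R ?f x \<partial>lborel) = 0" for a b
  proof -
    obtain v where v: "\<And>k. test (v k)" "\<And>k x. 0 \<le> v k x \<and> v k x \<le> (indicator (box a b) x :: real)"
      "\<And>x. (\<lambda>k. v k x) \<longlonglongrightarrow> indicator (box a b) x" by (rule box_test_approximation[of a b]) blast
    have "(\<lambda>k. \<integral>x. v k x *\<^sub>R ?f x \<partial>lborel) \<longlonglongrightarrow> (\<integral>x. indicator (box a b) x *\<^sub>R ?f x \<partial>lborel)"
    proof (rule Bochner_Integration.integral_dominated_convergence[where w
        = "\<lambda>x. norm (indicator (box a b) x *\<^sub>R ?f x)"])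
      show "(\<lambda>x. indicator (box a b) x *\<^sub>R ?f x) \<in> borel_measurable lborel" using int
          by (rule borel_measurable_integrable)
      show "(\<lambda>x. v k x *\<^sub>R ?f x) \<in> borel_measurable lborel" for k
        by (rule borel_measurable_integrable[OF integral_pairing(2)[OF square_integrable_test[OF
            v(1)]]])
      show "integrable lborel (\<lambda>x. norm (indicator (box a b) x *\<^sub>R ?f x))" using int
          by (rule integrable_norm)
      show "AE x in lborel. (\<lambda>k. v k x *\<^sub>R ?f x) \<longlonglongrightarrow> indicator (box a b) x *\<^sub>R ?f x"
        by (intro AE_I2 tendsto_scaleR v(3) tendsto_const)
      show "AE x in lborel. norm (v k x *\<^sub>R ?f x) \<le> norm (indicator (box a b) x *\<^sub>R ?f x)" for k
        using v(2)[of k] by (auto intro!: AE_I2 mult_right_mono simp: abs_le_iff)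
    qed
    moreover have "(\<integral>x. v k x *\<^sub>R ?f x \<partial>lborel) = 0" for k
      using integral_pairing(1)[OF square_integrable_test[OF v(1)], of k f] u[OF v(1)]
          by (simp add: complex_eq_iff)
    ultimately show ?thesis by (simp add: LIMSEQ_const_iff)
  qed
  have local_zero: "AE x in lborel. indicator (box a b) x *\<^sub>R ?f x = 0" for a b
  proof -
    let ?g = "\<lambda>x. indicator (box a b) x *\<^sub>R ?f x"
    have I: "(\<integral>x. indicator (box c d) x *\<^sub>R ?g x \<partial>lborel)
        = 0" "integrable lborel (\<lambda>x. indicator (box c d) x *\<^sub>R ?g x)" for c d
    proof -
      have "\<exists>p q. box c d \<inter> box a b = box p q" unfolding box_Int_box by blast
      then obtain p q where pq: "box c d \<inter> box a b = box p q" by (elim exE)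
      have "(\<lambda>x. indicator (box c d) x *\<^sub>R ?g x) = (\<lambda>x. indicator (box p q) x *\<^sub>R ?f x)"
        unfolding pq[symmetric] indicator_inter_arith by simp
      then show "(\<integral>x. indicator (box c d) x *\<^sub>R ?g x \<partial>lborel)
          = 0" "integrable lborel (\<lambda>x. indicator (box c d) x *\<^sub>R ?g x)"
        using box int by simp_all
    qed
    have "AE x in lborel. Re (?g x) = 0"
    proof (rule integrable_zero_on_boxes_imp_AE_zero)
      show "integrable lborel (\<lambda>x. Re (?g x))" using int by (rule integrable_Re)
      show "(\<integral>x. Re (?g x) \<partial>lborel) = 0" using integral_Re[OF int] box by simp
      show "(\<integral>x. indicator (box c d) x *\<^sub>R Re (?g x) \<partial>lborel) = 0" for c d
        using integral_Re[OF I(2)[of c d]] unfolding I(1)[of c d]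
        by (simp only: scaleR_complex.sel real_scaleR_def zero_complex.sel)
    qed
    moreover have "AE x in lborel. Im (?g x) = 0"
    proof (rule integrable_zero_on_boxes_imp_AE_zero)
      show "integrable lborel (\<lambda>x. Im (?g x))" using int by (rule integrable_Im)
      show "(\<integral>x. Im (?g x) \<partial>lborel) = 0" using integral_Im[OF int] box by simp
      show "(\<integral>x. indicator (box c d) x *\<^sub>R Im (?g x) \<partial>lborel) = 0" for c d
        using integral_Im[OF I(2)[of c d]] unfolding I(1)[of c d]
        by (simp only: scaleR_complex.sel real_scaleR_def zero_complex.sel)
    qed
    ultimately show ?thesis by eventually_elim (simp add: complex_eq_iff)
  qed
  have "AE x in lborel. \<forall>n::nat. indicator (box (- vec (real n)) (vec (real n))) x *\<^sub>R ?f x = 0"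
    unfolding AE_all_countable by (intro allI local_zero)
  then have "AE x in lborel. ?f x = 0"
  proof eventually_elim
    fix x assume *: "\<forall>n::nat. indicator (box (- vec (real n)) (vec (real n))) x *\<^sub>R ?f x = 0"
    obtain n :: nat where n: "norm x < real n" using reals_Archimedean2 by blast
    have "x \<in> box (- vec (real n)) (vec (real n))"
    proof -
      have "- real n < x $ i \<and> x $ i < real n" for i using component_le_norm_cart[of x i] n
          by linarith
      then show ?thesis by (simp add: mem_box_cart)
    qed
    then show "?f x = 0" using *[rule_format, of n] by simp
  qed
  then have "AE x in ref_measure. rep_L2 f x = rep_L2 0 x"
    using rep_zero_L2[where 'a = "real ^ 'n"] unfolding ref_measure_lborel by eventually_elim simp
  then show ?thesis by (rule L2_eqI)
qed

section \<open>Translations\<close>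

text \<open>The sign of the shift makes the generator the partial derivative itself rather than its
  negative.\<close>

definition translation :: "'n::finite \<Rightarrow> real \<Rightarrow> (real ^ 'n) L2 \<Rightarrow> (real ^ 'n) L2" where
  "translation l s f = abs_L2 (\<lambda>x. rep_L2 f (s *\<^sub>R axis l 1 + x))"

lemma AE_translate:
  fixes c :: "real ^ 'n::finite"
  assumes "AE x in lborel. P x" shows "AE x in lborel. P (c + x)"
proof -
  have "AE x in distr lborel borel ((+) c). P x" unfolding lborel_distr_plus by (rule assms)
  from AE_distrD[OF _ this] show ?thesis by simp
qed

lemma AE_translate':
  fixes f g :: "(real ^ 'n::finite) L2"
  assumes "AE x in ref_measure. rep_L2 f x = h x"
  shows "AE x in lborel. rep_L2 f (c + x) = h (c + x)"
  using AE_translate[of "\<lambda>x. rep_L2 f x = h x" c] assms unfolding ref_measure_lborel by blast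

lemma translation_bounds:
  fixes f :: "(real ^ 'n::finite) L2"
  shows "square_integrable (\<lambda>x. rep_L2 f (s *\<^sub>R axis l 1 + x))" "norm (translation l s f) \<le> norm f"
proof -
  have m [measurable]: "rep_L2 f \<in> borel_measurable borel"
    using measurable_rep_L2[of f] by (simp add: ref_measure_lborel)
  let ?c = "s *\<^sub>R axis l 1 :: real ^ 'n"
  have "(\<integral>\<^sup>+x. ennreal ((norm (rep_L2 f (?c + x)))\<^sup>2) \<partial>lborel)
      = (\<integral>\<^sup>+x. ennreal ((norm (rep_L2 f x))\<^sup>2) \<partial>distr lborel borel ((+) ?c))"
    by (subst nn_integral_distr) auto
  also have "\<dots> = ennreal ((norm f)\<^sup>2)"
    unfolding nn_norm_L2 ref_measure_lborel lborel_distr_plus ..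
  finally have "(\<integral>\<^sup>+x. ennreal ((norm (rep_L2 f (?c + x)))\<^sup>2) \<partial>ref_measure) \<le> ennreal ((norm f)\<^sup>2)"
    unfolding ref_measure_lborel by simp
  moreover have "(\<lambda>x. rep_L2 f (?c + x)) \<in> borel_measurable ref_measure"
    unfolding ref_measure_lborel by measurable
  ultimately show "square_integrable (\<lambda>x. rep_L2 f (?c + x))" "norm (translation l s f) \<le> norm f"
    unfolding translation_def using square_integrableI[of "\<lambda>x. rep_L2 f (?c + x)" "norm f"]
        by simp_all
qed

lemma rep_translation: "AE x in lborel. rep_L2 (translation l s f) x
    = rep_L2 f (s *\<^sub>R axis l 1 + x)"
  using rep_abs_L2[OF translation_bounds(1), of f s l] unfolding translation_def
      ref_measure_lborel .

lemma L2_lborel_eqI: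
  fixes f g :: "(real ^ 'n::finite) L2"
  shows "AE x in lborel. rep_L2 f x = rep_L2 g x \<Longrightarrow> f = g"
  by (rule L2_eqI) (simp only: ref_measure_lborel)

lemmas rep_plus_lborel = rep_plus_L2[where 'a = "real ^ 'n::finite", unfolded ref_measure_lborel]
lemmas rep_minus_lborel = rep_minus_L2[where 'a = "real ^ 'n::finite", unfolded ref_measure_lborel]
lemmas rep_scaleR_lborel = rep_scaleR_L2[where 'a = "real ^ 'n::finite", unfolded
    ref_measure_lborel]
lemmas rep_scaleC_lborel = rep_scaleC[where 'a = "real ^ 'n::finite", unfolded ref_measure_lborel]

lemma translation_plus: "translation l s (f + g) = translation l s f + translation l s g"
proof (rule L2_lborel_eqI)
  show "AE x in lborel. rep_L2 (translation l s (f + g)) x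
      = rep_L2 (translation l s f + translation l s g) x"
    using rep_translation[of l s "f + g"] rep_translation[of l s f] rep_translation[of l s g]
      rep_plus_lborel[of "translation l s f" "translation l s g"] AE_translate'[OF rep_plus_L2[of
          f g], of "s *\<^sub>R axis l 1"]
    by eventually_elim simp
qed

lemma translation_scaleC: "translation l s (c *\<^sub>C f) = c *\<^sub>C translation l s f"
proof (rule L2_lborel_eqI)
  show "AE x in lborel. rep_L2 (translation l s (c *\<^sub>C f)) x = rep_L2 (c *\<^sub>C translation l s f) x"
    using rep_translation[of l s "c *\<^sub>C f"] rep_translation[of l s f]
      rep_scaleC_lborel[of c "translation l s f"] AE_translate'[OF rep_scaleC[of c f], of "s *\<^sub>R
          axis l 1"]
    by eventually_elim simp
qed

lemma linear_translation: "linear (translation l s)"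
  by (rule linearI) (simp_all add: translation_plus translation_scaleC flip: scaleC_of_real)

lemma rep_translation_translation:
  "AE x in lborel. rep_L2 (translation l s (translation k t f)) x
      = rep_L2 f (t *\<^sub>R axis k 1 + (s *\<^sub>R axis l 1 + x))"
  using rep_translation[of l s "translation k t f"] AE_translate[OF rep_translation[of k t f], of
      "s *\<^sub>R axis l 1"]
  by eventually_elim simp

lemma translation_add: "translation l (s + t) f = translation l s (translation l t f)"
proof (rule L2_lborel_eqI)
  show "AE x in lborel. rep_L2 (translation l (s + t) f) x
      = rep_L2 (translation l s (translation l t f)) x"
    using rep_translation[of l "s + t" f] rep_translation_translation[of l s l t f]
    by eventually_elim (simp add: algebra_simps)
qed

lemma translation_commute: "translation l s (translation k t f)
    = translation k t (translation l s f)"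
proof (rule L2_lborel_eqI)
  show "AE x in lborel. rep_L2 (translation l s (translation k t f)) x
      = rep_L2 (translation k t (translation l s f)) x"
    using rep_translation_translation[of l s k t f] rep_translation_translation[of k t l s f]
    by eventually_elim (simp add: algebra_simps)
qed

lemma translation_0: "translation l 0 f = f"
  by (rule L2_lborel_eqI) (use rep_translation[of l 0 f] in simp)

lemma norm_translation: "norm (translation l s f) = norm f"
  using translation_bounds(2)[of l s f] translation_bounds(2)[of l "- s" "translation l s f"]
      translation_add[of l "- s" s f]
  by (simp add: translation_0)

lemma translation_test: "test u \<Longrightarrow> translation l s (test_L2 u)
    = test_L2 (\<lambda>x. u (s *\<^sub>R axis l 1 + x))"
proof (rule L2_lborel_eqI)
  assume u: "test u"
  show "AE x in lborel. rep_L2 (translation l s (test_L2 u)) x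
      = rep_L2 (test_L2 (\<lambda>x. u (s *\<^sub>R axis l 1 + x))) x"
    using rep_translation[of l s "test_L2 u"] AE_translate[OF rep_test[OF u], of "s *\<^sub>R axis l 1"]
      rep_test[OF test_translate[OF u], of "s *\<^sub>R axis l 1"]
    by eventually_elim simp
qed

lemma test_L2_add: "test u \<Longrightarrow> test w \<Longrightarrow> test_L2 (\<lambda>x. u x + w x) = test_L2 u + test_L2 w"
proof (rule L2_lborel_eqI)
  assume u: "test u" and w: "test w"
  show "AE x in lborel. rep_L2 (test_L2 (\<lambda>x. u x + w x)) x = rep_L2 (test_L2 u + test_L2 w) x"
    using rep_test[OF u] rep_test[OF w] rep_test[OF test_add[OF u w]] rep_plus_lborel[of "test_L2
        u" "test_L2 w"]
    by eventually_elim simp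
qed

lemma test_L2_scale: "test u \<Longrightarrow> test_L2 (\<lambda>x. r * u x) = r *\<^sub>R test_L2 u"
proof (rule L2_lborel_eqI)
  assume u: "test u"
  show "AE x in lborel. rep_L2 (test_L2 (\<lambda>x. r * u x)) x = rep_L2 (r *\<^sub>R test_L2 u) x"
    using rep_test[OF u] rep_test[OF test_scale[OF u, of r]] rep_scaleR_lborel[of r "test_L2 u"]
    by eventually_elim simp
qed

definition test_space :: "(real ^ 'n::finite) L2 set" where
  "test_space = {test_L2 u + \<i> *\<^sub>C test_L2 w |u w. test u \<and> test w}"

lemma test_zero: "test (\<lambda>x. 0)"
  by (simp add: test_iff smooth1_const)

lemma test_L2_zero: "test_L2 (\<lambda>x. 0) = 0"
  using test_L2_scale[OF test_zero, of 0] by simp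

lemma test_spaceI: "test u \<Longrightarrow> test_L2 u \<in> test_space" "test u \<Longrightarrow> \<i> *\<^sub>C test_L2 u \<in> test_space"
proof -
  assume u: "test u"
  have z: "\<i> *\<^sub>C test_L2 (\<lambda>x. 0) = 0" by (simp add: test_L2_zero linear_0[OF linear_scaleC])
  show "test_L2 u \<in> test_space"
    unfolding test_space_def using u test_zero z by (intro CollectI exI[of _ u] exI[of _ "\<lambda>x. 0"])
        simp
  show "\<i> *\<^sub>C test_L2 u \<in> test_space"
    unfolding test_space_def using u test_zero
    by (intro CollectI exI[of _ "\<lambda>x. 0"] exI[of _ u]) (simp add: test_L2_zero)
qed

lemma dense_test_space: "closure (test_space :: (real ^ 'n::finite) L2 set) = UNIV"
proof (rule dense_subspaceI)
  show "subspace (test_space :: (real ^ 'n) L2 set)"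
  proof (rule subspaceI)
    show "0 \<in> (test_space :: (real ^ 'n) L2 set)" using test_spaceI(1)[OF test_zero]
        by (simp add: test_L2_zero)
    show "x + y \<in> test_space" if xy: "x \<in> test_space" "y \<in> test_space" for x y :: "(real ^ 'n) L2"
    proof -
      obtain u w u' w' where t: "test u" "test w" "test u'" "test w'"
        and x: "x = test_L2 u + \<i> *\<^sub>C test_L2 w" and y: "y = test_L2 u' + \<i> *\<^sub>C test_L2 w'"
        using xy unfolding test_space_def by blast
      have "x + y = test_L2 (\<lambda>x. u x + u' x) + \<i> *\<^sub>C test_L2 (\<lambda>x. w x + w' x)"
        by (simp add: x y test_L2_add t scaleC_add_right)
      then show ?thesis
        unfolding test_space_def using test_add[OF t(1,3)] test_add[OF t(2,4)] by blast
    qed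
    show "r *\<^sub>R x \<in> test_space" if "x \<in> test_space" for r and x :: "(real ^ 'n) L2"
    proof -
      obtain u w where t: "test u" "test w" and x: "x = test_L2 u + \<i> *\<^sub>C test_L2 w"
        using \<open>x \<in> test_space\<close> unfolding test_space_def by blast
      have "r *\<^sub>R x = test_L2 (\<lambda>x. r * u x) + \<i> *\<^sub>C test_L2 (\<lambda>x. r * w x)"
        by (simp add: x test_L2_scale t scaleC_scaleR scaleR_add_right)
      then show ?thesis
        unfolding test_space_def using test_scale[OF t(1)] test_scale[OF t(2)] by blast
    qed
  qed
  fix v :: "(real ^ 'n) L2" assume v: "\<And>s. s \<in> test_space \<Longrightarrow> v \<bullet> s = 0"
  show "v = 0"
    by (rule test_orthogonal_imp_zero) (simp_all add: inner_commute[of _ v] v test_spaceI)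
qed

lemma test_generator: "test u \<Longrightarrow> (test_L2 u, test_L2 (partial l u)) \<in> generator (translation l)"
  unfolding generator_def has_vector_derivative_iff_quotient mem_Collect_eq prod.case
    tendsto_at_iff_sequentially
proof (intro allI impI)
  assume u: "test u"
  fix X :: "nat \<Rightarrow> real" assume X0: "\<forall>i. X i \<in> UNIV - {0}" and X: "X \<longlonglongrightarrow> 0"
  let ?e = "axis l 1 :: real ^ 'a"
  let ?F = "\<lambda>n. (translation l (X n) (test_L2 u) - test_L2 u) /\<^sub>R X n"
  obtain B where "0 \<le> B" and B: "\<And>x. \<bar>partial l u x\<bar> \<le> B"
    by (rule partial_bounded[OF u, of l]) blast
  obtain R where R: "\<And>x. u x \<noteq> 0 \<Longrightarrow> norm x \<le> R"
    using u by (auto simp: test_iff bounded_iff)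
  obtain M where M: "\<And>n. \<bar>X n\<bar> \<le> M" using convergent_imp_Bseq[OF convergentI[OF X]]
      by (auto simp: Bseq_def)
  \<comment> \<open>A common majorant of the difference quotients: the mean value inequality bounds
    them by \<open>B\<close>, and a shift of length at most \<open>M\<close> keeps their support in
    the ball of radius \<open>R + M\<close>.\<close>
  define w where "w = (\<lambda>x :: real ^ 'a. complex_of_real (B * indicator (cball 0 (R + M)) x))"
  have w: "square_integrable w"
  proof (rule square_integrable_bounded_support[where B = B])
    have [measurable]: "cball (0 :: real ^ 'a) (R + M) \<in> sets borel" by simp
    show "w \<in> borel_measurable borel" unfolding w_def by measurable
    show "norm (w x) \<le> B" for x using \<open>0 \<le> B\<close> by (simp add: w_def indicator_def)
    show "bounded {x. w x \<noteq> 0}"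
      by (rule bounded_subset[OF bounded_cball[of 0 "R + M"]]) (auto simp: w_def indicator_def
          split: if_splits)
  qed
  have F: "AE x in lborel. rep_L2 (?F n) x = of_real ((u (X n *\<^sub>R ?e + x) - u x) / X n)" for n
    using rep_test[OF u] rep_test[OF test_translate[OF u], of "X n *\<^sub>R ?e"]
      rep_minus_lborel[of "translation l (X n) (test_L2 u)" "test_L2 u"]
      rep_scaleR_lborel[of "inverse (X n)" "translation l (X n) (test_L2 u) - test_L2 u"]
    unfolding translation_test[OF u, symmetric]
    by eventually_elim (simp only: of_real_divide of_real_diff divide_inverse mult.commute
        of_real_inverse of_real_mult)
  have "?F \<longlonglongrightarrow> test_L2 (partial l u)"
  proof (rule L2_dominated_convergence[where w = "abs_L2 w"], unfold ref_measure_lborel)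
    have all: "AE x in lborel. \<forall>n. rep_L2 (?F n) x = of_real ((u (X n *\<^sub>R ?e + x) - u x) / X n)"
      unfolding AE_all_countable by (intro allI F)
    show "AE x in lborel. (\<lambda>n. rep_L2 (?F n) x) \<longlonglongrightarrow> rep_L2 (test_L2 (partial l u)) x"
      using all rep_test_partial[OF u, of l]
    proof eventually_elim
      fix x
      assume *: "\<forall>n. rep_L2 (?F n) x = of_real ((u (X n *\<^sub>R ?e + x) - u x) / X n)"
        and p: "rep_L2 (test_L2 (partial l u)) x = of_real (partial l u x)"
      have "((\<lambda>s. (u (s *\<^sub>R ?e + x) - u x) /\<^sub>R s) \<longlongrightarrow> partial l u x) (at 0)"
        using test_line_derivative[OF u, of l x 0] by (simp add: has_vector_derivative_iff_quotient)
      then have "(\<lambda>n. (u (X n *\<^sub>R ?e + x) - u x) /\<^sub>R X n) \<longlonglongrightarrow> partial l u x"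
        using X X0 unfolding tendsto_at_iff_sequentially o_def by blast
      then have "(\<lambda>n. complex_of_real ((u (X n *\<^sub>R ?e + x) - u x) / X n)) \<longlonglongrightarrow> of_real (partial l u x)"
        by (intro tendsto_of_real) (simp add: divide_inverse_commute)
      then show "(\<lambda>n. rep_L2 (?F n) x) \<longlonglongrightarrow> rep_L2 (test_L2 (partial l u)) x" by (simp only: * p)
    qed
    have rw: "AE x in lborel. rep_L2 (abs_L2 w) x = w x"
      using rep_abs_L2[OF w] unfolding ref_measure_lborel .
    show "AE x in lborel. norm (rep_L2 (?F n) x) \<le> norm (rep_L2 (abs_L2 w) x)" for n
      using F[of n] rw
    proof eventually_elim
      fix x
      assume *: "rep_L2 (?F n) x = of_real ((u (X n *\<^sub>R ?e + x) - u x) / X n)"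
          and wx: "rep_L2 (abs_L2 w) x = w x"
      have n0: "X n \<noteq> 0" using X0 by auto
      have "\<bar>(u (X n *\<^sub>R ?e + x) - u x) / X n\<bar> \<le> B * indicator (cball 0 (R + M)) x"
      proof (cases "norm x \<le> R + M")
        case True
        have "norm (u (X n *\<^sub>R ?e + x) - u (0 *\<^sub>R ?e + x) - (X n - 0) *\<^sub>R 0) \<le> \<bar>X n - 0\<bar> * B"
          by (rule vector_derivative_bound[OF test_line_derivative[OF u, of l x]]) (use B in simp)
        then have "\<bar>u (X n *\<^sub>R ?e + x) - u x\<bar> / \<bar>X n\<bar> \<le> B" using n0
            by (simp add: pos_divide_le_eq mult.commute)
        then show ?thesis using True by simp
      next
        case False
        have "0 \<le> M" using M[of n] by linarith
        then have "u x = 0" using False R[of x] by fastforce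
        moreover have "u (X n *\<^sub>R ?e + x) = 0"
        proof (rule ccontr)
          assume "u (X n *\<^sub>R ?e + x) \<noteq> 0"
          then have "norm (X n *\<^sub>R ?e + x) \<le> R" by (rule R)
          moreover have "norm (X n *\<^sub>R ?e) \<le> M" using M[of n] by simp
          ultimately show False
            using False norm_triangle_ineq4[of "X n *\<^sub>R ?e + x" "X n *\<^sub>R ?e"] by simp
        qed
        ultimately show ?thesis using \<open>0 \<le> B\<close> by simp
      qed
      then show "norm (rep_L2 (?F n) x) \<le> norm (rep_L2 (abs_L2 w) x)"
        unfolding * wx unfolding w_def norm_of_real by linarith
    qed
  qed
  then show "((\<lambda>s. (translation l s (test_L2 u) - translation l 0 (test_L2 u)) /\<^sub>R (s - 0)) \<circ> X) \<longlonglongrightarrow>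
      test_L2 (partial l u)"
    by (simp add: o_def translation_0)
qed

lemma test_space_generator:
  assumes u: "test u" and w: "test w"
  shows "(test_L2 u + \<i> *\<^sub>C test_L2 w, test_L2 (partial l u) + \<i> *\<^sub>C test_L2 (partial l w)) \<in>
      generator (translation l)"
proof -
  have "((\<lambda>s. translation l s (test_L2 u) + \<i> *\<^sub>C translation l s (test_L2 w)) has_vector_derivative
      test_L2 (partial l u) + \<i> *\<^sub>C test_L2 (partial l w)) (at 0)"
    by (intro has_vector_derivative_add bounded_linear.has_vector_derivative[OF
        bounded_linear_scaleC]
        generatorD test_generator u w)
  then show ?thesis by (simp add: generator_def translation_plus translation_scaleC)
qed

lemma ortho_group_translation: "ortho_group (translation (l :: 'n::finite))"
proof (rule ortho_groupI)
  show "((\<lambda>t. translation l t f) \<longlongrightarrow> f) (at 0)" for f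
  proof (rule tendstoI)
    fix e :: real assume e: "0 < e"
    have "f \<in> closure test_space" unfolding dense_test_space by simp
    then obtain f' where f': "f' \<in> test_space" "dist f' f < e / 4"
      using e unfolding closure_approachable by (meson divide_pos_pos zero_less_numeral)
    then obtain u w where t: "test u" "test w" "f' = test_L2 u + \<i> *\<^sub>C test_L2 w"
      unfolding test_space_def by blast
    have "isCont (\<lambda>s. translation l s f') 0"
      using test_space_generator[OF t(1,2), of l] unfolding t(3)
      by (intro has_vector_derivative_continuous[OF generatorD])
    then have "((\<lambda>s. translation l s f') \<longlongrightarrow> f') (at 0)" by (simp add: isCont_def translation_0)
    then have "\<forall>\<^sub>F s in at 0. dist (translation l s f') f' < e / 4" using e by (intro tendstoD) auto
    then show "\<forall>\<^sub>F s in at 0. dist (translation l s f) f < e"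
    proof eventually_elim
      case (elim s)
      have "translation l s f - f = translation l s (f - f') + (translation l s f' - f') + (f' - f)"
        by (simp add: linear_diff[OF linear_translation])
      then have "norm (translation l s f - f) \<le> norm (f - f') + norm (translation l s f' - f') +
          norm (f' - f)"
        by (metis norm_triangle3 norm_translation)
      then show ?case using elim f'(2) e by (simp add: dist_norm norm_minus_commute)
    qed
  qed
qed (rule linear_translation norm_translation translation_0 translation_add)+

section \<open>Weak derivatives as generators of translations\<close>

text \<open>Weak equals strong. Invariance of S allows the weak identity to be used along the whole
  orbit of w, so \<open>U (- s) w \<bullet> f\<close> has derivative
  \<open>w \<bullet> U s g\<close>; this bounds the first order remainder of f when tested against
  w.\<close>

lemma (in ortho_group) generatorI_dense:
  assumes dense: "closure S = UNIV" and inv: "\<And>s w. w \<in> S \<Longrightarrow> U s w \<in> S"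
    and S: "\<And>w. w \<in> S \<Longrightarrow> \<exists>w'. (w, w') \<in> generator U \<and> w' \<bullet> f = - (w \<bullet> g)"
  shows "(f, g) \<in> generator U"
  unfolding generator_def has_vector_derivative_iff_quotient mem_Collect_eq prod.case
proof (rule tendstoI)
  fix e :: real assume e: "0 < e"
  have "((\<lambda>t. U t g) \<longlongrightarrow> U 0 g) (at 0)"
    by (intro tendsto tendsto_intros)
  then obtain d where d: "d > 0" "\<And>s. \<bar>s\<bar> < d \<Longrightarrow> norm (U s g - g) \<le> e / 2"
    using e unfolding LIM_eq by (metis diff_zero half_gt_zero less_eq_real_def real_norm_def
        norm_zero right_minus_eq zero)
  have "dist ((U t f - U 0 f) /\<^sub>R (t - 0)) g < e" if t: "t \<noteq> 0" "\<bar>t\<bar> < d" for t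
  proof -
    define x where "x = U t f - f - t *\<^sub>R g"
    have wx: "\<bar>w \<bullet> x\<bar> \<le> norm w * (\<bar>t\<bar> * (e / 2))" if w: "w \<in> S" for w
    proof -
      obtain w' where w': "(w, w') \<in> generator U" using S[OF w] by blast
      have der: "((\<lambda>s. U (- 1 * s) w \<bullet> f) has_vector_derivative w \<bullet> U s g) (at s)" for s
      proof -
        obtain z where z: "(U (- s) w, z) \<in> generator U" "z \<bullet> f = - (U (- s) w \<bullet> g)"
          using S[OF inv[OF w]] by blast
        have "z = U (- s) w'" by (rule generator_unique[OF z(1) generator_orbit[OF w']])
        moreover have "((\<lambda>s. U (- 1 * s) w) has_vector_derivative ((- 1) *\<^sub>R U (- 1 * s) w' + U (-
            1 * s) 0)) (at s)"
          by (rule has_vector_derivative[OF has_vector_derivative_const w'])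
        from bounded_linear.has_vector_derivative[OF bounded_linear_inner_left this, of f]
        have "((\<lambda>s. U (- 1 * s) w \<bullet> f) has_vector_derivative - (U (- s) w' \<bullet> f)) (at s)"
          by (simp add: bl_simps)
        ultimately show ?thesis using z(2) by (simp add: inner_left)
      qed
      have "norm (U (- 1 * t) w \<bullet> f - U (- 1 * 0) w \<bullet> f - (t - 0) *\<^sub>R (w \<bullet> g))
          \<le> \<bar>t - 0\<bar> * (norm w * (e / 2))"
      proof (rule vector_derivative_bound[OF der])
        fix s assume "s \<in> closed_segment 0 t"
        then have "\<bar>s\<bar> < d" using t by (auto simp: closed_segment_eq_real_ivl split: if_splits)
        have "\<bar>w \<bullet> (U s g - g)\<bar> \<le> norm w * norm (U s g - g)" by (rule Cauchy_Schwarz_ineq2)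
        also have "\<dots> \<le> norm w * (e / 2)" by (rule mult_left_mono[OF d(2)[OF \<open>\<bar>s\<bar> < d\<close>]]) simp
        finally show "norm (w \<bullet> U s g - w \<bullet> g) \<le> norm w * (e / 2)" by (simp add: inner_diff_right)
      qed
      then show ?thesis by (simp add: x_def inner_diff_right inner_left mult.left_commute)
    qed
    have "closed {w. \<bar>w \<bullet> x\<bar> \<le> norm w * (\<bar>t\<bar> * (e / 2))}"
      by (intro closed_Collect_le continuous_intros)
    then have "closure S \<subseteq> {w. \<bar>w \<bullet> x\<bar> \<le> norm w * (\<bar>t\<bar> * (e / 2))}"
      by (rule closure_minimal[rotated]) (use wx in blast)
    \<comment> \<open>By density the remainder \<open>x\<close> may be tested against
      itself.\<close>
    then have "\<bar>x \<bullet> x\<bar> \<le> norm x * (\<bar>t\<bar> * (e / 2))" unfolding dense by blast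
    then have "norm x * norm x \<le> (\<bar>t\<bar> * (e / 2)) * norm x"
      by (simp add: mult.commute flip: power2_norm_eq_inner power2_eq_square)
    then have "norm x \<le> \<bar>t\<bar> * (e / 2)"
      by (rule mult_self_le_imp_le) (use e in auto)
    also have "\<dots> < \<bar>t\<bar> * e" using t e by simp
    finally have "norm x / \<bar>t\<bar> < e" using t by (simp add: pos_divide_less_eq mult.commute)
    moreover have "(U t f - U 0 f) /\<^sub>R (t - 0) - g = x /\<^sub>R t"
      using t by (simp add: x_def scaleR_diff_right)
    ultimately show ?thesis by (simp add: dist_norm divide_inverse_commute)
  qed
  then show "\<forall>\<^sub>F t in at 0. dist ((U t f - U 0 f) /\<^sub>R (t - 0)) g < e"
    unfolding eventually_at using d(1) by (intro exI[of _ d]) (auto simp: dist_real_def)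
qed

text \<open>One inclusion is skewness against test functions; the other is the preceding criterion,
  as translates of test functions are test functions. It identifies the concrete Sobolev spaces with
  the abstract ones and makes a weak derivative the norm limit of difference quotients.\<close>

theorem weak_partial_eq_generator: "weak_partial l = generator (translation l)"
proof -
  interpret T: ortho_group "translation l" by (rule ortho_group_translation)
  have "(f, g) \<in> weak_partial l" if fg: "(f, g) \<in> generator (translation l)" for f g
    unfolding weak_partial_iff
  proof (intro allI impI conjI)
    fix u :: "real ^ 'a \<Rightarrow> real" assume u: "test u"
    show "test_L2 (partial l u) \<bullet> f = - (test_L2 u \<bullet> g)"
      using T.generator_skew[OF test_generator[OF u] fg] by simp
    have "(\<i> *\<^sub>C test_L2 u, \<i> *\<^sub>C test_L2 (partial l u)) \<in> generator (translation l)"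
      using bounded_linear.has_vector_derivative[OF bounded_linear_scaleC generatorD[OF
          test_generator[OF u, of l]], of \<i>]
      by (simp add: generator_def translation_scaleC)
    from T.generator_skew[OF this fg]
    show "(\<i> *\<^sub>C test_L2 (partial l u)) \<bullet> f = - ((\<i> *\<^sub>C test_L2 u) \<bullet> g)" by simp
  qed
  moreover have "(f, g) \<in> generator (translation l)" if fg: "(f, g) \<in> weak_partial l" for f g
  proof (rule T.generatorI_dense[OF dense_test_space])
    fix w :: "(real ^ 'a) L2" assume "w \<in> test_space"
    then obtain u v where t: "test u" "test v" and w: "w = test_L2 u + \<i> *\<^sub>C test_L2 v"
      unfolding test_space_def by blast
    have "translation l s w = test_L2 (\<lambda>x. u (s *\<^sub>R axis l 1 + x)) + \<i> *\<^sub>C test_L2 (\<lambda>x. v (s *\<^sub>R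
        axis l 1 + x))" for s
      by (simp add: w translation_plus translation_scaleC translation_test t)
    then show "translation l s w \<in> test_space" for s
      unfolding test_space_def using test_translate[OF t(1)] test_translate[OF t(2)] by blast
    show "\<exists>w'. (w, w') \<in> generator (translation l) \<and> w' \<bullet> f = - (w \<bullet> g)"
    proof (intro exI conjI)
      show "(w, test_L2 (partial l u) + \<i> *\<^sub>C test_L2 (partial l v)) \<in> generator (translation l)"
        unfolding w by (rule test_space_generator[OF t])
      show "(test_L2 (partial l u) + \<i> *\<^sub>C test_L2 (partial l v)) \<bullet> f = - (w \<bullet> g)"
        using fg t unfolding weak_partial_iff w by (simp add: inner_add_left)
    qed
  qed
  ultimately show ?thesis by auto
qed

interpretation T: complex_commuting_groups "translation :: 'n::finite \<Rightarrow> _" "(*\<^sub>C) \<i>"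
proof (intro complex_commuting_groups.intro commuting_groups.intro
    complex_commuting_groups_axioms.intro)
  show "ortho_group (translation l)" for l :: 'n by (rule ortho_group_translation)
  show "translation l s (translation k t f) = translation k t (translation l s f)" for l k :: 'n
      and s t f by (rule translation_commute)
  have "test_space \<subseteq> {f. \<forall>l::'n. f \<in> Domain (generator (translation l))}"
    unfolding test_space_def using test_space_generator by blast
  then show "closure {f. \<forall>l::'n. f \<in> Domain (generator (translation l))} = UNIV"
    using closure_mono[of test_space] dense_test_space by blast
  show "linear ((*\<^sub>C) \<i> :: (real ^ 'n) L2 \<Rightarrow> _)" by (rule linear_scaleC)
  show "\<i> *\<^sub>C translation l s f = translation l s (\<i> *\<^sub>C f)" for l :: 'n and s f
      by (simp add: translation_scaleC)
qed (simp_all add: scaleC_minus_left)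

section \<open>The continuum\<close>

lemma app_weak_partial: "app (weak_partial l) f = T.d l f"
  by (simp add: weak_partial_eq_generator)

lemma H1_eq: "H1 = T.H1"
  by (simp add: H1_def T.H1_def weak_partial_eq_generator)

lemma H2_eq: "H2 = T.H2"
  by (simp add: H2_def T.H2_def H1_eq app_weak_partial)

lemma H0_cont_eq: "H0_cont = {(f, - T.lap f) |f. f \<in> T.H2}"
  by (simp add: H0_cont_def T.lap_def H2_eq app_weak_partial)

lemma skew_graph_H0_cont: "skew_graph H0_cont = {(f, \<i> *\<^sub>C T.lap f) |f. f \<in> T.H2}"
  unfolding skew_graph_def H0_cont_eq
  by (auto simp: scaleC_minus_left linear_neg[OF linear_scaleC])

lemma self_adjoint_H0_cont: "self_adjoint (H0_cont :: (real ^ 'n::finite) L2 operator)"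
  unfolding self_adjoint_def skew_graph_H0_cont
proof (intro conjI allI impI)
  show "\<exists>c. skew_adjoint {(f :: (real ^ 'n) L2, \<i> *\<^sub>C T.lap f) |f. f \<in> T.H2} c"
    by (rule T.skew_adjoint_J_lap)
  fix f g :: "(real ^ 'n) L2" assume "(f, g) \<in> H0_cont"
  then have f: "f \<in> T.H2" "g = - T.lap f" by (auto simp: H0_cont_eq)
  show "(\<i> *\<^sub>C f, \<i> *\<^sub>C g) \<in> H0_cont"
    using T.H2_commute[OF T.bounded_linear_J T.J_T f(1)]
    by (simp add: H0_cont_eq f(2) linear_neg[OF linear_scaleC])
qed

section \<open>Conjugation of the Laplacian by position phases\<close>

abbreviation coordinate :: "'n::finite \<Rightarrow> real ^ 'n \<Rightarrow> real" where
  "coordinate j x \<equiv> x $ j"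

lemma measurable_coordinate [measurable]:
  "coordinate j \<in> borel_measurable (ref_measure :: (real ^ 'n::finite) measure)"
proof -
  have "coordinate j \<in> borel_measurable borel"
    by (intro borel_measurable_continuous_onI continuous_intros)
  then show ?thesis by (simp add: ref_measure_lborel)
qed

lemmas rep_phase_lborel = rep_phase[OF measurable_coordinate, unfolded ref_measure_lborel]

text \<open>The Weyl form of the canonical commutation relations.\<close>

lemma translation_phase:
  "translation l s (phase (coordinate j) a f) =
    (if l = j then cis (a * s) else 1) *\<^sub>C phase (coordinate j) a (translation l s f)"
proof (rule L2_lborel_eqI)
  show "AE x in lborel. rep_L2 (translation l s (phase (coordinate j) a f)) x =
      rep_L2 ((if l = j then cis (a * s) else 1) *\<^sub>C phase (coordinate j) a (translation l s f)) x"
    using rep_translation[of l s "phase (coordinate j) a f"] rep_translation[of l s f]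
      AE_translate[OF rep_phase_lborel[of j a f], of "s *\<^sub>R axis l 1"]
      rep_phase_lborel[of j a "translation l s f"]
      rep_scaleC_lborel[of "if l = j then cis (a * s) else 1" "phase (coordinate j) a (translation
          l s f)"]
    by eventually_elim (auto simp: axis_def distrib_left cis_mult[symmetric])
qed

lemma bounded_bilinear_scaleC: "bounded_bilinear ((*\<^sub>C) :: complex \<Rightarrow> 'a::ref_measure L2 \<Rightarrow> _)"
proof
  show "(c + c') *\<^sub>C f = c *\<^sub>C f + c' *\<^sub>C f" for c c' and f :: "'a L2"
    using scaleC_Re_Im[of "c + c'" f] scaleC_Re_Im[of c f] scaleC_Re_Im[of c' f]
        by (simp add: algebra_simps)
  show "(r *\<^sub>R c) *\<^sub>C f = r *\<^sub>R (c *\<^sub>C f)" for r c and f :: "'a L2" by (rule scaleR_scaleC_left)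
  show "\<exists>K. \<forall>c (f :: 'a L2). norm (c *\<^sub>C f) \<le> norm c * norm f * K"
    by (intro exI[of _ 1]) simp
qed (simp_all add: scaleC_add_right scaleC_scaleR)

lemma cis_has_vector_derivative: "((\<lambda>s. cis (a * s)) has_vector_derivative of_real a * \<i>) (at 0)"
  using cis_quotient_tendsto[of a]
  by (cases "a = 0") (simp_all add: has_vector_derivative_iff_quotient mult.commute
      cis_quotient_tendsto[of a, unfolded mult.commute[of _ a]])

context
  fixes j :: "'n::finite" and a :: real
begin

interpretation E: ortho_group "phase (coordinate j)"
  by (rule ortho_group_phase[OF measurable_coordinate])

text \<open>Differentiating the Weyl relation at s = 0 yields the product rule for the phase
  together with membership in the domain.\<close>

lemma generator_phase_translation:
  assumes f: "(f, g) \<in> generator (translation l)"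
  shows "(phase (coordinate j) a f, phase (coordinate j) a (g + (if l
      = j then a else 0) *\<^sub>R (\<i> *\<^sub>C f))) \<in> generator (translation l)"
proof -
  let ?c = "if l = j then a else 0"
  have "((\<lambda>s. phase (coordinate j) a (translation l s f))
      has_vector_derivative phase (coordinate j) a g) (at 0)"
    by (rule bounded_linear.has_vector_derivative[OF E.bounded_linear generatorD[OF f]])
  from bounded_bilinear.has_vector_derivative[OF bounded_bilinear_scaleC
      cis_has_vector_derivative[of ?c] this]
  have "((\<lambda>s. cis (?c * s) *\<^sub>C phase (coordinate j) a (translation l s f)) has_vector_derivative
      phase (coordinate j) a g + (of_real ?c * \<i>) *\<^sub>C phase (coordinate j) a f) (at 0)"
    by simp
  moreover have "cis (?c * s) *\<^sub>C phase (coordinate j) a (translation l s f)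
      = translation l s (phase (coordinate j) a f)" for s
    by (simp add: translation_phase)
  moreover have "phase (coordinate j) a g + (of_real ?c * \<i>) *\<^sub>C phase (coordinate j) a f
      = phase (coordinate j) a (g + ?c *\<^sub>R (\<i> *\<^sub>C f))"
    by (simp only: E.bl_simps phase_scaleC[OF measurable_coordinate] scaleC_of_real flip:
        scaleC_scaleC)
  ultimately show ?thesis by (simp add: generator_def)
qed

lemma phase_H1:
  assumes f: "f \<in> T.H1"
  shows "phase (coordinate j) a f \<in> T.H1" "T.d l (phase (coordinate j) a f)
      = phase (coordinate j) a (T.d l f + (if l = j then a else 0) *\<^sub>R (\<i> *\<^sub>C f))"
proof -
  note g = generator_phase_translation[OF T.H1_d[OF f]]
  show "phase (coordinate j) a f \<in> T.H1" by (rule T.H1I[OF g])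
  show "T.d l (phase (coordinate j) a f) = phase (coordinate j) a (T.d l f + (if l
      = j then a else 0) *\<^sub>R (\<i> *\<^sub>C f))" by (rule T.d_eq[OF g])
qed

lemma phase_H2:
  assumes f: "f \<in> T.H2"
  shows "phase (coordinate j) a f \<in> T.H2"
    and "T.lap (phase (coordinate j) a f) = phase (coordinate j) a (T.lap f + (2 * a) *\<^sub>R (\<i> *\<^sub>C
        T.d j f) - a\<^sup>2 *\<^sub>R f)"
proof -
  have f1: "f \<in> T.H1" "T.d l f \<in> T.H1" for l using f by (auto simp: T.H2_def)
  have i1: "\<i> *\<^sub>C f \<in> T.H1" "T.d l (\<i> *\<^sub>C f) = \<i> *\<^sub>C T.d l f" for l
    by (rule T.H1_commute[OF T.bounded_linear_J T.J_T f1(1)])+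
  let ?c = "\<lambda>l. if l = j then a else 0"
  have h1: "T.d l f + ?c l *\<^sub>R (\<i> *\<^sub>C f) \<in> T.H1" for l
    by (rule T.H1_lin(1)[OF f1(2) T.H1_scale(1)[OF i1(1)]])
  show "phase (coordinate j) a f \<in> T.H2"
    unfolding T.H2_def mem_Collect_eq phase_H1(2)[OF f1(1)]
    using phase_H1(1)[OF f1(1)] phase_H1(1)[OF h1] by blast
  have ii: "\<i> *\<^sub>C (\<i> *\<^sub>C f) = - f" by (rule scaleC_i_i)
  have "T.d l (T.d l (phase (coordinate j) a f)) = phase (coordinate j) a (T.d l (T.d l f)) +
      (if l = j then phase (coordinate j) a ((2 * a) *\<^sub>R (\<i> *\<^sub>C T.d j f) - a\<^sup>2 *\<^sub>R f) else 0)" for l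
  proof -
    have "T.d l (T.d l (phase (coordinate j) a f)) = phase (coordinate j) a (T.d l (T.d l f + ?c l
        *\<^sub>R (\<i> *\<^sub>C f)) + ?c l *\<^sub>R (\<i> *\<^sub>C (T.d l f + ?c l *\<^sub>R (\<i> *\<^sub>C f))))"
      unfolding phase_H1(2)[OF f1(1)] by (rule phase_H1(2)[OF h1])
    also have "T.d l (T.d l f + ?c l *\<^sub>R (\<i> *\<^sub>C f)) = T.d l (T.d l f) + ?c l *\<^sub>R (\<i> *\<^sub>C T.d l f)"
      by (simp only: T.H1_lin(2)[OF f1(2) T.H1_scale(1)[OF i1(1)]] T.H1_scale(2)[OF i1(1)] i1(2))
    also have "?c l *\<^sub>R (\<i> *\<^sub>C (T.d l f + ?c l *\<^sub>R (\<i> *\<^sub>C f)))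
        = ?c l *\<^sub>R (\<i> *\<^sub>C T.d l f) - (?c l)\<^sup>2 *\<^sub>R f"
      by (simp only: scaleC_add_right scaleC_scaleR ii scaleR_add_right) (simp add:
          power2_eq_square)
    finally have *: "T.d l (T.d l (phase (coordinate j) a f))
        = phase (coordinate j) a (T.d l (T.d l f) + ?c l *\<^sub>R (\<i> *\<^sub>C T.d l f) +
        (?c l *\<^sub>R (\<i> *\<^sub>C T.d l f) - (?c l)\<^sup>2 *\<^sub>R f))" .
    have "(2 * a) *\<^sub>R x = a *\<^sub>R x + a *\<^sub>R x" for x :: "(real ^ 'n) L2"
      by (simp only: mult_2 scaleR_left_distrib)
    then show ?thesis
      unfolding * by (cases "l = j") (simp_all add: E.bl_simps)
  qed
  then have "T.lap (phase (coordinate j) a f) = (\<Sum>l\<in>UNIV. phase (coordinate j) a (T.d l (T.d l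
      f))) + phase (coordinate j) a ((2 * a) *\<^sub>R (\<i> *\<^sub>C T.d j f) - a\<^sup>2 *\<^sub>R f)"
    by (simp add: T.lap_def sum.distrib)
  then show "T.lap (phase (coordinate j) a f) = phase (coordinate j) a (T.lap f + (2 * a) *\<^sub>R (\<i>
      *\<^sub>C T.d j f) - a\<^sup>2 *\<^sub>R f)"
    by (simp add: T.lap_def linear_sum[OF E.linear, symmetric] E.bl_simps)
qed

text \<open>In terms of the momentum: conjugating H_0 by the inverse phase gives H_0 + 2 a P + a^2,
  here multiplied by -i.\<close>

lemma i_lap_phase:
  assumes f: "f \<in> T.H2"
  shows "\<i> *\<^sub>C T.lap (phase (coordinate j) a f) = phase (coordinate j) a (\<i> *\<^sub>C T.lap f - (2 * a)
      *\<^sub>R T.d j f - a\<^sup>2 *\<^sub>R (\<i> *\<^sub>C f))"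
proof -
  have "\<i> *\<^sub>C T.lap (phase (coordinate j) a f) = phase (coordinate j) a (\<i> *\<^sub>C (T.lap f + (2 * a)
      *\<^sub>R (\<i> *\<^sub>C T.d j f) - a\<^sup>2 *\<^sub>R f))"
    by (simp only: phase_H2(2)[OF f] phase_scaleC[OF measurable_coordinate])
  also have "\<i> *\<^sub>C (T.lap f + (2 * a) *\<^sub>R (\<i> *\<^sub>C T.d j f) - a\<^sup>2 *\<^sub>R f)
      = \<i> *\<^sub>C T.lap f + (2 * a) *\<^sub>R (\<i> *\<^sub>C (\<i> *\<^sub>C T.d j f)) - a\<^sup>2 *\<^sub>R (\<i> *\<^sub>C f)"
    by (simp only: scaleC_add_right scaleC_scaleR linear_diff[OF linear_scaleC])
  also have "\<dots> = \<i> *\<^sub>C T.lap f - (2 * a) *\<^sub>R T.d j f - a\<^sup>2 *\<^sub>R (\<i> *\<^sub>C f)"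
    by (simp only: scaleC_i_i scaleR_minus_right diff_conv_add_uminus)
  finally show ?thesis .
qed

end

lemma mul_phase_commute:
  assumes V: "ess_bounded V" and m: "m \<in> borel_measurable ref_measure"
  shows "mul (\<lambda>x. of_real (V x)) (phase m a f) = phase m a (mul (\<lambda>x. of_real (V x)) f)"
proof -
  obtain K where K: "(\<lambda>x. complex_of_real (V x)) \<in> borel_measurable ref_measure"
    "AE x in ref_measure. norm (complex_of_real (V x)) \<le> K" using V by (rule ess_boundedD)
  show ?thesis
    by (rule L2_eqI)
      (use rep_mul[OF K, of f] rep_mul[OF K, of "phase m a f"] rep_phase[OF m, of a f]
        rep_phase[OF m, of a "mul (\<lambda>x. of_real (V x)) f"] in eventually_elim, simp)
qed

lemma H1_norm_eq: "H1_norm f = sqrt ((norm f)\<^sup>2 + (\<Sum>l\<in>UNIV. (norm (T.d l f))\<^sup>2))"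
  by (simp add: H1_norm_def app_weak_partial)

lemma norm_le_H1_norm: "norm f \<le> H1_norm f"
  unfolding H1_norm_eq by (rule real_le_rsqrt) (simp add: sum_nonneg)

section \<open>Propagation of the position under the perturbed evolution\<close>

text \<open>The commutator of H with a phase contains the unbounded P, but only along the orbit,
  where conservation of energy controls it. The restriction to |a| \<le> 1 allows a^2 to be absorbed
  into |a|.\<close>

lemma exp_cont_phase_bound:
  fixes V :: "real ^ 'n::finite \<Rightarrow> real" and j :: 'n
  assumes V: "ess_bounded V"
  defines "U \<equiv> exp_mi (op_add H0_cont (mult_op V))"
  obtains D where "1 \<le> D" "\<And>f a t. f \<in> T.H1 \<Longrightarrow> \<bar>a\<bar> \<le> 1 \<Longrightarrow>
    norm (phase (coordinate j) a (U t f) - U t (phase (coordinate j) a f))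
        \<le> \<bar>t\<bar> * (\<bar>a\<bar> * (D * H1_norm f))"
proof -
  note sa = self_adjoint_add_mult_op(1)[OF self_adjoint_H0_cont V]
  interpret U: ortho_group U unfolding U_def by (rule ortho_group_exp_mi[OF sa])
  interpret E: ortho_group "phase (coordinate j)" by (rule ortho_group_phase[OF
      measurable_coordinate])
  have U_C: "U t (c *\<^sub>C f) = c *\<^sub>C U t f" for t c f unfolding U_def by (rule exp_mi_scaleC[OF sa])
  let ?V = "mul (\<lambda>x. of_real (V x))"
  have gen: "generator U = {(f, \<i> *\<^sub>C T.lap f + (- \<i>) *\<^sub>C ?V f) |f. f \<in> T.H2}"
    unfolding U_def generator_exp_mi[OF sa] self_adjoint_add_mult_op(2)[OF self_adjoint_H0_cont V]
      skew_graph_H0_cont by auto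
  obtain K0 where K0: "(\<lambda>x. complex_of_real (V x)) \<in> borel_measurable ref_measure"
    "AE x in ref_measure. norm (complex_of_real (V x)) \<le> K0" using V by (rule ess_boundedD)
  obtain K where K: "K > 0" "\<And>x. norm (?V x) \<le> norm x * K"
    using bounded_linear.pos_bounded[OF bounded_linear_mul[OF K0]] by blast
  have U_H2: "U t f \<in> T.H2" if f: "f \<in> T.H2" for f t
    using U.generator_orbit[of f "\<i> *\<^sub>C T.lap f + (- \<i>) *\<^sub>C ?V f" t] f unfolding gen by blast
  have der: "((\<lambda>s. U s f) has_vector_derivative \<i> *\<^sub>C T.lap (U s f) + (- \<i>) *\<^sub>C ?V (U s f)) (at s)"
    "U s (\<i> *\<^sub>C T.lap f + (- \<i>) *\<^sub>C ?V f) = \<i> *\<^sub>C T.lap (U s f) + (- \<i>) *\<^sub>C ?V (U s f)"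
    if f: "f \<in> T.H2" for f s
  proof -
    have g: "(f, \<i> *\<^sub>C T.lap f + (- \<i>) *\<^sub>C ?V f) \<in> generator U" using f unfolding gen by blast
    have "(U s f, \<i> *\<^sub>C T.lap (U s f) + (- \<i>) *\<^sub>C ?V (U s f)) \<in> generator U"
      using U_H2[OF f] unfolding gen by blast
    then show eq: "U s (\<i> *\<^sub>C T.lap f + (- \<i>) *\<^sub>C ?V f) = \<i> *\<^sub>C T.lap (U s f) + (- \<i>) *\<^sub>C ?V (U s
        f)"
      by (rule generator_unique[OF U.generator_orbit[OF g]])
    show "((\<lambda>s. U s f) has_vector_derivative \<i> *\<^sub>C T.lap (U s f) + (- \<i>) *\<^sub>C ?V (U s f)) (at s)"
      using U.has_vector_derivative_orbit[OF g, of s] unfolding eq .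
  qed
  have V_le: "\<bar>?V f \<bullet> f\<bar> \<le> K * (norm f)\<^sup>2" for f
  proof -
    have "\<bar>?V f \<bullet> f\<bar> \<le> norm (?V f) * norm f" by (rule Cauchy_Schwarz_ineq2)
    also have "\<dots> \<le> (norm f * K) * norm f" by (rule mult_right_mono[OF K(2)]) simp
    finally show ?thesis by (simp add: power2_eq_square mult_ac)
  qed
  have lap_self: "T.lap f \<bullet> f = - (\<Sum>l\<in>UNIV. (norm (T.d l f))\<^sup>2)" if f: "f \<in> T.H2" for f
    using T.lap_inner[OF f, of f] f by (simp add: T.H2_def power2_norm_eq_inner)
  \<comment> \<open>The expectation of H is conserved because \<open>U s\<close> is isometric and
    commutes with i. Estimating the potential energy by K at both times costs
    \<open>2 * K\<close>.\<close>
  have energy: "(\<Sum>l\<in>UNIV. (norm (T.d l (U s f)))\<^sup>2) \<le> (\<Sum>l\<in>UNIV. (norm (T.d l f))\<^sup>2) + 2 * K *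
      (norm f)\<^sup>2"
    if f: "f \<in> T.H2" for f s
  proof -
    let ?h = "\<lambda>f. \<i> *\<^sub>C T.lap f + (- \<i>) *\<^sub>C ?V f"
    have h: "(\<i> *\<^sub>C ?h u) \<bullet> u = (?V u - T.lap u) \<bullet> u" for u
      by (simp add: scaleC_add_right scaleC_minus_left linear_diff[OF linear_scaleC])
    have "(?V (U s f) - T.lap (U s f)) \<bullet> U s f = (\<i> *\<^sub>C U s (?h f)) \<bullet> U s f"
      unfolding der(2)[OF f] h ..
    also have "\<dots> = (?V f - T.lap f) \<bullet> f"
      unfolding U_C[symmetric] U.inner by (rule h)
    finally have "?V (U s f) \<bullet> U s f + (\<Sum>l\<in>UNIV. (norm (T.d l (U s f)))\<^sup>2)
        = ?V f \<bullet> f + (\<Sum>l\<in>UNIV. (norm (T.d l f))\<^sup>2)"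
      unfolding inner_diff_left lap_self[OF f] lap_self[OF U_H2[OF f]] by simp
    then show ?thesis using V_le[of f] V_le[of "U s f"] by simp
  qed
  \<comment> \<open>Twice the momentum bound 1 + 2 K from the term linear in a, plus 1 from the term
    with a^2.\<close>
  define D where "D = 3 + 4 * K"
  have d_le: "norm (T.d j (U s f)) \<le> (1 + 2 * K) * H1_norm f" if f: "f \<in> T.H2" for f s
  proof (rule power2_le_imp_le)
    have "(norm (T.d j (U s f)))\<^sup>2 \<le> (\<Sum>l\<in>UNIV. (norm (T.d l (U s f)))\<^sup>2)"
      by (rule member_le_sum) auto
    also have "\<dots> \<le> (\<Sum>l\<in>UNIV. (norm (T.d l f))\<^sup>2) + 2 * K * (norm f)\<^sup>2" by (rule energy[OF f])
    also have "\<dots> \<le> (1 + 2 * K) * ((norm f)\<^sup>2 + (\<Sum>l\<in>UNIV. (norm (T.d l f))\<^sup>2))"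
      using K(1) by (simp add: distrib_right distrib_left sum_nonneg)
    also have "\<dots> \<le> (1 + 2 * K)\<^sup>2 * ((norm f)\<^sup>2 + (\<Sum>l\<in>UNIV. (norm (T.d l f))\<^sup>2))"
      using K(1) by (intro mult_right_mono) (auto simp: power2_eq_square sum_nonneg)
    also have "\<dots> = ((1 + 2 * K) * H1_norm f)\<^sup>2"
      by (simp add: H1_norm_eq power_mult_distrib sum_nonneg)
    finally show "(norm (T.d j (U s f)))\<^sup>2 \<le> ((1 + 2 * K) * H1_norm f)\<^sup>2" .
    show "0 \<le> (1 + 2 * K) * H1_norm f"
      using K(1) norm_le_H1_norm[of f] norm_ge_zero[of f] by (intro mult_nonneg_nonneg) linarith+
  qed
  have bound: "norm (phase (coordinate j) a (U t f) - U t (phase (coordinate j) a f))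
      \<le> \<bar>t\<bar> * (\<bar>a\<bar> * (D * H1_norm f))"
    if f: "f \<in> T.H2" and a: "\<bar>a\<bar> \<le> 1" for f a t
  proof -
    let ?E = "phase (coordinate j) a"
    let ?k = "\<lambda>u. ?E (- ((2 * a) *\<^sub>R T.d j u) - a\<^sup>2 *\<^sub>R (\<i> *\<^sub>C u))"
    have "norm (?E (U t f) - U t (?E f) - t *\<^sub>R U t 0) \<le> \<bar>t\<bar> * (\<bar>a\<bar> * (D * H1_norm f))"
    proof (rule U.commutator_bound[OF E.bounded_linear der(1)[OF f]])
      fix s
      let ?u = "U s f"
      have "?E (\<i> *\<^sub>C T.lap ?u + (- \<i>) *\<^sub>C ?V ?u) + ?k ?u
          = \<i> *\<^sub>C T.lap (?E ?u) + (- \<i>) *\<^sub>C ?V (?E ?u)"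
        unfolding i_lap_phase[OF U_H2[OF f]] mul_phase_commute[OF V measurable_coordinate]
          phase_scaleC[OF measurable_coordinate, symmetric]
        by (simp add: E.bl_simps)
      then show "(?E ?u, ?E (\<i> *\<^sub>C T.lap ?u + (- \<i>) *\<^sub>C ?V ?u) + ?k ?u) \<in> generator U"
        unfolding gen using phase_H2(1)[OF U_H2[OF f]] by auto
      have "norm (- ((2 * a) *\<^sub>R T.d j ?u) - a\<^sup>2 *\<^sub>R (\<i> *\<^sub>C ?u))
          \<le> 2 * \<bar>a\<bar> * norm (T.d j ?u) + a\<^sup>2 * norm f"
        using norm_triangle_ineq4[of "- ((2 * a) *\<^sub>R T.d j ?u)" "a\<^sup>2 *\<^sub>R (\<i> *\<^sub>C ?u)"]
            by (simp add: abs_mult)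
      also have "\<dots> \<le> 2 * \<bar>a\<bar> * ((1 + 2 * K) * H1_norm f) + \<bar>a\<bar> * H1_norm f"
      proof (rule add_mono)
        show "2 * \<bar>a\<bar> * norm (T.d j ?u) \<le> 2 * \<bar>a\<bar> * ((1 + 2 * K) * H1_norm f)"
          by (rule mult_left_mono[OF d_le[OF f]]) simp
        have "a\<^sup>2 \<le> \<bar>a\<bar>" using a mult_right_mono[OF a, of "\<bar>a\<bar>"]
            by (simp add: power2_eq_square flip: abs_mult)
        then show "a\<^sup>2 * norm f \<le> \<bar>a\<bar> * H1_norm f"
          using norm_le_H1_norm by (intro mult_mono) auto
      qed
      also have "\<dots> = \<bar>a\<bar> * (D * H1_norm f)" by (simp add: D_def algebra_simps)
      finally show "norm (U (- s) (?k ?u) + 0) \<le> \<bar>a\<bar> * (D * H1_norm f)" by simp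
    qed
    then show ?thesis by (simp add: U.bl_simps)
  qed
  obtain c where "skew_adjoint (skew_graph (H0_cont :: (real ^ 'n) L2 operator)) c"
    using self_adjoint_H0_cont by (auto simp: self_adjoint_def)
  then interpret A: skew_adjoint "skew_graph (H0_cont :: (real ^ 'n) L2 operator)" c .
  have bound': "norm (phase (coordinate j) a (U t f) - U t (phase (coordinate j) a f))
      \<le> \<bar>t\<bar> * (\<bar>a\<bar> * (D * H1_norm f))"
    if f: "f \<in> T.H1" and a: "\<bar>a\<bar> \<le> 1" for f a t
  proof -
    \<comment> \<open>Resolvents of H_0 map into \<open>H2\<close> and commute with translations,
      hence with derivatives; so the first order Sobolev norms of the approximants converge to that
      of \<open>f\<close>.\<close>
    let ?R = "\<lambda>r. A.R r f"
    have small: "\<forall>\<^sub>F r in at 0. A.small r"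
      unfolding eventually_at using A.c by (intro exI[of _ c]) (auto simp: dist_real_def)
    have R_d: "T.d l (?R r) = A.R r (T.d l f)" and R_H2: "?R r \<in> T.H2" if r: "A.small r" for r l
    proof -
      have "A.R r (translation l s g) = translation l s (A.R r g)" for l :: 'n and s g
      proof (rule A.R_intertwine[OF linear_translation _ r])
        fix u v :: "(real ^ 'n) L2" assume "(u, v) \<in> skew_graph H0_cont"
        then have u: "u \<in> T.H2" "v = \<i> *\<^sub>C T.lap u" by (auto simp: skew_graph_H0_cont)
        note c = T.H2_commute[OF T.T.bounded_linear[of l s] _ u(1)]
        have com: "translation l s (translation k t x) = translation k t (translation l s x)"
            for k t x
          by (rule translation_commute)
        show "(translation l s u, translation l s v) \<in> skew_graph H0_cont"
          using c[OF com] by (simp add: skew_graph_H0_cont u(2) translation_scaleC)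
      qed
      then show "T.d l (?R r) = A.R r (T.d l f)"
        by (intro T.H1_commute(2)[OF A.bounded_linear_R[OF r] _ f])
      obtain h where "(?R r, h) \<in> skew_graph H0_cont" by (rule A.R_graph[OF r])
      then show "?R r \<in> T.H2" by (auto simp: skew_graph_H0_cont)
    qed
    let ?N = "\<lambda>r. sqrt ((norm (?R r))\<^sup>2 + (\<Sum>l\<in>UNIV. (norm (A.R r (T.d l f)))\<^sup>2))"
    have N: "(?N \<longlongrightarrow> H1_norm f) (at 0)"
      unfolding H1_norm_eq by (intro tendsto_intros A.R_tendsto)
    show ?thesis
    proof (rule tendsto_le[OF at_neq_bot])
      show "((\<lambda>r. \<bar>t\<bar> * (\<bar>a\<bar> * (D * ?N r))) \<longlongrightarrow> \<bar>t\<bar> * (\<bar>a\<bar> * (D * H1_norm f))) (at 0)"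
        by (intro tendsto_mult_left N)
      show "((\<lambda>r. norm (phase (coordinate j) a (U t (?R r)) - U t (phase (coordinate j) a (?R
          r)))) \<longlongrightarrow>
          norm (phase (coordinate j) a (U t f) - U t (phase (coordinate j) a f))) (at 0)"
        by (intro tendsto_norm tendsto_diff bounded_linear.tendsto[OF U.bounded_linear]
            bounded_linear.tendsto[OF E.bounded_linear] A.R_tendsto)
      show "\<forall>\<^sub>F r in at 0. norm (phase (coordinate j) a (U t (?R r)) - U t (phase (coordinate j) a
          (?R r)))
          \<le> \<bar>t\<bar> * (\<bar>a\<bar> * (D * ?N r))"
        using small
      proof eventually_elim
        case (elim r)
        have "H1_norm (?R r) = ?N r" unfolding H1_norm_eq R_d[OF elim] ..
        with bound[OF R_H2[OF elim] a, of t] show ?case by simp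
      qed
    qed
  qed
  show ?thesis by (rule that[of D]) (use K(1) bound' in \<open>simp_all add: D_def\<close>)
qed

lemma exp_cont_S_norm_bound:
  fixes V :: "real ^ 'n::finite \<Rightarrow> real" and j :: 'n
  assumes V: "ess_bounded V"
  defines "U \<equiv> exp_mi (op_add H0_cont (mult_op V))"
  obtains C where "0 < C" "\<And>g r a. 0 < a \<Longrightarrow> a \<le> 1 \<Longrightarrow>
    ennreal (norm (phase (coordinate j) a (U r g) - U r g))
        \<le> ennreal (C * a * (1 + \<bar>r\<bar>)) * S_norm_cont j g"
proof -
  obtain D where D: "1 \<le> D" "\<And>f a t. f \<in> T.H1 \<Longrightarrow> \<bar>a\<bar> \<le> 1 \<Longrightarrow>
    norm (phase (coordinate j) a (U t f) - U t (phase (coordinate j) a f))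
        \<le> \<bar>t\<bar> * (\<bar>a\<bar> * (D * H1_norm f))"
    unfolding U_def using exp_cont_phase_bound[OF V, of j] by blast
  interpret U: ortho_group U
    unfolding U_def by (rule ortho_group_exp_mi self_adjoint_add_mult_op self_adjoint_H0_cont V)+
  have "ennreal (norm (phase (coordinate j) a (U r g) - U r g))
      \<le> ennreal (D * a * (1 + \<bar>r\<bar>)) * S_norm_cont j g"
    if a: "0 < a" "a \<le> 1" for g r a
  proof (cases "g \<in> H1 \<inter> Domain (Q_cont j)")
    case True
    then obtain q where q: "(g, q) \<in> mult_op (coordinate j)" by (auto simp: Q_cont_def)
    have g1: "g \<in> T.H1" using True by (simp add: H1_eq)
    define s where "s = sqrt ((H1_norm g)\<^sup>2 + (norm q)\<^sup>2)"
    have s: "H1_norm g \<le> s" "norm q \<le> s" by (auto simp: s_def intro!: real_le_rsqrt)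
    then have s0: "0 \<le> s" using norm_ge_zero[of q] by linarith
    have S: "S_norm_cont j g = ennreal s"
      using True q by (simp add: S_norm_cont_def s_def app_mult_op Q_cont_def)
    let ?E = "phase (coordinate j) a"
    have "?E (U r g) - U r g = (?E (U r g) - U r (?E g)) + U r (?E g - g)" by (simp add: U.bl_simps)
    then have "norm (?E (U r g) - U r g) \<le> norm (?E (U r g) - U r (?E g)) + norm (?E g - g)"
      by (metis norm_triangle_ineq U.norm)
    also have "\<dots> \<le> \<bar>r\<bar> * (\<bar>a\<bar> * (D * H1_norm g)) + \<bar>a\<bar> * norm q"
      using a by (intro add_mono D(2) g1 norm_phase_diff_le[OF measurable_coordinate q]) simp
    \<comment> \<open>Because \<open>1 \<le> D\<close>, the initial position is absorbed into the
      same constant.\<close>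
    also have "\<dots> \<le> \<bar>r\<bar> * (\<bar>a\<bar> * (D * s)) + \<bar>a\<bar> * (D * s)"
    proof (intro add_mono mult_left_mono)
      have "1 * s \<le> D * s" by (rule mult_right_mono[OF D(1) s0])
      then show "norm q \<le> D * s" using s(2) by simp
    qed (use s D(1) in auto)
    also have "\<dots> = D * a * (1 + \<bar>r\<bar>) * s" using a by (simp add: algebra_simps)
    finally have "ennreal (norm (?E (U r g) - U r g)) \<le> ennreal (D * a * (1 + \<bar>r\<bar>) * s)"
        by (rule ennreal_leI)
    also have "\<dots> = ennreal (D * a * (1 + \<bar>r\<bar>)) * ennreal s" by (rule ennreal_mult'') (rule s0)
    finally show ?thesis by (simp only: S)
  next
    case False
    have "0 < D * a * (1 + \<bar>r\<bar>)" using a D(1) by (simp add: add_pos_nonneg)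
    moreover have "S_norm_cont j g = \<infinity>" by (simp only: S_norm_cont_def if_not_P[OF False])
    ultimately have "ennreal (D * a * (1 + \<bar>r\<bar>)) * S_norm_cont j g = \<infinity>"
      by (simp only: ennreal_mult_top infinity_ennreal_def ennreal_eq_0_iff not_le[symmetric]
          if_False)
    then show ?thesis by simp
  qed
  with D(1) show ?thesis by (intro that[of D]) auto
qed

section \<open>Free motion in the continuum and non-zero velocity\<close>

lemma app_P_cont:
  assumes f: "f \<in> T.H1"
  shows "app (P_cont j) f = (- \<i>) *\<^sub>C T.d j f"
proof -
  have "(f, (- \<i>) *\<^sub>C T.d j f) \<in> P_cont j"
    unfolding P_cont_def weak_partial_eq_generator using T.H1_d[OF f] by blast
  moreover have "g = (- \<i>) *\<^sub>C T.d j f" if fg: "(f, g) \<in> P_cont j" for g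
  proof -
    obtain g' where g': "g = (- \<i>) *\<^sub>C g'" "(f, g') \<in> generator (translation j)"
      using fg unfolding P_cont_def weak_partial_eq_generator by blast
    show ?thesis unfolding g'(1) T.d_eq[OF g'(2)] ..
  qed
  ultimately show ?thesis
    unfolding app_def[of "P_cont j" f] by (rule the_equality)
qed

text \<open>Conjugating \<open>W\<close> by the phase gives one group; the product of
  \<open>W\<close>, translations and scalar phases, which commute, gives another. Inclusion of the
  generators identifies them. Translation by \<open>2 * a * t\<close> is exp(2 i a t P).\<close>

lemma exp_cont_phase_conj:
  fixes j :: "'n::finite" and f :: "(real ^ 'n) L2"
  defines "W \<equiv> exp_mi H0_cont"
  shows "phase (coordinate j) a (W t f) =
    W t (translation j (2 * a * t) (cis (- (a\<^sup>2) * t) *\<^sub>C phase (coordinate j) a f))"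
proof -
  note sa = self_adjoint_H0_cont
  interpret W: ortho_group W unfolding W_def by (rule ortho_group_exp_mi[OF sa])
  have gW: "generator W = {(f, \<i> *\<^sub>C T.lap f) |f. f \<in> T.H2}"
    unfolding W_def generator_exp_mi[OF sa] skew_graph_H0_cont ..
  have dense: "closure (T.H2 :: (real ^ 'n) L2 set) = UNIV"
  proof -
    have "Domain (skew_graph (H0_cont :: (real ^ 'n) L2 operator)) = T.H2"
      by (auto simp: skew_graph_H0_cont)
    with self_adjoint_dense[OF sa] show ?thesis by metis
  qed
  have W_C: "W t (c *\<^sub>C f) = c *\<^sub>C W t f" for t c f unfolding W_def by (rule exp_mi_scaleC[OF sa])
  interpret E: ortho_group "phase (coordinate j)" by (rule ortho_group_phase[OF
      measurable_coordinate])
  let ?E = "phase (coordinate j) a" and ?E' = "phase (coordinate j) (- a)"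
  have W_T: "translation l s (W t g) = W t (translation l s g)" for l s t g
  proof (rule W.commute_bounded[OF T.T.bounded_linear])
    have "Domain (generator W) = T.H2" unfolding gW by auto
    then show "closure (Domain (generator W)) = UNIV" using dense by simp
    fix u v assume "(u, v) \<in> generator W"
    then have u: "u \<in> T.H2" "v = \<i> *\<^sub>C T.lap u" by (auto simp: gW)
    have com: "translation l s (translation k t x) = translation k t (translation l s x)" for k t x
      by (rule translation_commute)
    show "(translation l s u, translation l s v) \<in> generator W"
      using T.H2_commute[OF T.T.bounded_linear[of l s] com u(1)]
          by (simp add: gW u(2) translation_scaleC)
  qed
  define X where "X t f = ?E (W t (?E' f))" for t f
  define Y where "Y t f = W t (translation j (2 * a * t) (cis (- (a\<^sup>2) * t) *\<^sub>C f))" for t f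
  have E_lin: "linear ?E" "linear ?E'" by (rule E.linear)+
  have X: "ortho_group X"
  proof (rule ortho_group.intro)
    show "linear (X t)" for t
      unfolding X_def[abs_def] using linear_compose[OF linear_compose[OF E_lin(2) W.linear]
          E_lin(1)] by (simp add: o_def)
    show "continuous_on UNIV (\<lambda>t. X t f)" for f
      unfolding X_def by (intro bounded_linear.continuous_on[OF E.bounded_linear] W.continuous)
  qed (simp_all add: X_def W.add)
  have Y: "ortho_group Y"
  proof (rule ortho_group.intro)
    show "linear (Y t)" for t
      unfolding Y_def[abs_def] using linear_compose[OF linear_compose[OF linear_scaleC
          linear_translation] W.linear] by (simp add: o_def)
    show "norm (Y t f) = norm f" for t f by (simp add: Y_def norm_translation)
    show "Y 0 f = f" for f by (simp add: Y_def translation_0)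
    show "Y (s + t) f = Y s (Y t f)" for s t f
    proof -
      have "Y s (Y t f) = W s (W t (translation j (2 * a * s) (translation j (2 * a * t) (cis (-
          (a\<^sup>2) * s) *\<^sub>C (cis (- (a\<^sup>2) * t) *\<^sub>C f)))))"
        unfolding Y_def by (simp only: W_T W_C[symmetric] translation_scaleC[symmetric])
      also have "\<dots> = Y (s + t) f"
        unfolding Y_def by (simp add: cis_mult distrib_left translation_add W.add)
      finally show ?thesis ..
    qed
    show "continuous_on UNIV (\<lambda>t. Y t f)" for f
      unfolding Y_def
    proof (intro W.continuous_on_compose T.T.continuous_on_compose continuous_intros)
      have "continuous_on UNIV (\<lambda>t. cis (- (a\<^sup>2) * t))" by (intro continuous_intros)
      then show "continuous_on UNIV (\<lambda>t. cis (- (a\<^sup>2) * t) *\<^sub>C f)"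
        by (intro bounded_bilinear.continuous_on[OF bounded_bilinear_scaleC] continuous_on_const)
    qed
  qed
  have sub: "generator X \<subseteq> generator Y"
  proof safe
    fix g h assume gh: "(g, h) \<in> generator X"
    have "((\<lambda>t. ?E' (X t g)) has_vector_derivative ?E' h) (at 0)"
      by (rule bounded_linear.has_vector_derivative[OF E.bounded_linear generatorD[OF gh]])
    then have "(?E' g, ?E' h) \<in> generator W"
      using E.inverse(1)[of a] by (simp add: generator_def X_def)
    then have E'g: "?E' g \<in> T.H2" and E'h: "?E' h = \<i> *\<^sub>C T.lap (?E' g)" by (auto simp: gW)
    have g: "g \<in> T.H2" using phase_H2(1)[OF E'g, of j a] by simp
    have "?E' h = ?E' (\<i> *\<^sub>C T.lap g + (2 * a) *\<^sub>R T.d j g - a\<^sup>2 *\<^sub>R (\<i> *\<^sub>C g))"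
      unfolding E'h i_lap_phase[OF g] by simp
    from arg_cong[OF this, of ?E]
    have h: "h = \<i> *\<^sub>C T.lap g + ((2 * a) *\<^sub>R T.d j g - a\<^sup>2 *\<^sub>R (\<i> *\<^sub>C g))" by simp
    have g1: "g \<in> T.H1" using g by (simp add: T.H2_def)
    have d1: "((\<lambda>t. cis (- (a\<^sup>2) * t) *\<^sub>C g) has_vector_derivative - (a\<^sup>2 *\<^sub>R (\<i> *\<^sub>C g))) (at 0)"
      using bounded_bilinear.has_vector_derivative[OF bounded_bilinear_scaleC
          cis_has_vector_derivative[of "- (a\<^sup>2)"] has_vector_derivative_const[of g]]
      by (simp add: scaleC_minus_left flip: scaleC_of_real)
    have d2: "((\<lambda>t. translation j (2 * a * t) (cis (- (a\<^sup>2) * t) *\<^sub>C g)) has_vector_derivative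
        (2 * a) *\<^sub>R translation j (2 * a * 0) (T.d j g) + translation j (2 * a * 0) (- (a\<^sup>2 *\<^sub>R (\<i>
            *\<^sub>C g)))) (at 0)"
      by (rule T.T.has_vector_derivative[OF d1]) (simp add: T.H1_d[OF g1])
    have "((\<lambda>t. W (1 * t) (translation j (2 * a * t) (cis (- (a\<^sup>2) * t) *\<^sub>C g)))
        has_vector_derivative
        1 *\<^sub>R W (1 * 0) (\<i> *\<^sub>C T.lap g) + W (1 * 0) ((2 * a) *\<^sub>R translation j (2 * a * 0) (T.d j
            g) + translation j (2 * a * 0) (- (a\<^sup>2 *\<^sub>R (\<i> *\<^sub>C g))))) (at 0)"
      by (rule W.has_vector_derivative[OF d2]) (use g in \<open>auto simp: gW translation_0\<close>)
    then show "(g, h) \<in> generator Y"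
      by (simp add: generator_def Y_def h translation_0)
  qed
  have "T.H2 \<subseteq> Domain (generator X)"
  proof
    fix g :: "(real ^ 'n) L2" assume "g \<in> T.H2"
    then have "(?E' g, \<i> *\<^sub>C T.lap (?E' g)) \<in> generator W" using phase_H2(1)[of g j "- a"]
        by (auto simp: gW)
    from bounded_linear.has_vector_derivative[OF E.bounded_linear generatorD[OF this], of a]
    show "g \<in> Domain (generator X)" by (auto simp: generator_def X_def)
  qed
  then have "closure (Domain (generator X)) = UNIV" using closure_mono dense by blast
  from ortho_group_eqI[OF X Y sub this, of t "?E f"]
  show ?thesis by (simp add: X_def Y_def)
qed

lemma exp_cont_free:
  fixes j :: "'n::finite"
  assumes q: "(f, q) \<in> Q_cont j" and f: "f \<in> T.H1"
  defines "W \<equiv> exp_mi H0_cont"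
  shows "(W t f, W t q + (t * 2) *\<^sub>R W t (app (P_cont j) f)) \<in> Q_cont j"
proof -
  note sa = self_adjoint_H0_cont
  interpret W: ortho_group W unfolding W_def by (rule ortho_group_exp_mi[OF sa])
  have W_C: "W t (c *\<^sub>C f) = c *\<^sub>C W t f" for t c f unfolding W_def by (rule exp_mi_scaleC[OF sa])
  interpret E: ortho_group "phase (coordinate j)" by (rule ortho_group_phase[OF
      measurable_coordinate])
  \<comment> \<open>This phase is quadratic in a, so it does not contribute to the derivative at a =
    0.\<close>
  have c: "((\<lambda>a. cis (- (a\<^sup>2) * t)) has_vector_derivative 0) (at 0)"
  proof -
    have "((\<lambda>z. exp (\<i> * - (z\<^sup>2 * of_real t))) has_field_derivative 0) (at (of_real 0))"
      by (auto intro!: derivative_eq_intros)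
    from has_vector_derivative_real_field[OF this, of UNIV] show ?thesis
      by (simp add: cis_conv_exp)
  qed
  have e: "((\<lambda>a. phase (coordinate j) a f) has_vector_derivative \<i> *\<^sub>C q) (at 0)"
    using generatorD[OF generator_phaseI[OF measurable_coordinate q[unfolded Q_cont_def]]] .
  have y: "((\<lambda>a. cis (- (a\<^sup>2) * t) *\<^sub>C phase (coordinate j) a f)
      has_vector_derivative \<i> *\<^sub>C q) (at 0)"
    using bounded_bilinear.has_vector_derivative[OF bounded_bilinear_scaleC c e]
    by (simp add: bounded_bilinear.zero_left[OF bounded_bilinear_scaleC])
  have "((\<lambda>a. translation j ((2 * t) * a) (cis (- (a\<^sup>2) * t) *\<^sub>C phase (coordinate j) a f))
      has_vector_derivative
      (2 * t) *\<^sub>R translation j ((2 * t) * 0) (T.d j f) + translation j ((2 * t) * 0) (\<i> *\<^sub>C q))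
          (at 0)"
    by (rule T.T.has_vector_derivative[OF y]) (simp add: T.H1_d[OF f])
  from bounded_linear.has_vector_derivative[OF W.bounded_linear this, of t]
  have "((\<lambda>a. W t (translation j (2 * a * t) (cis (- (a\<^sup>2) * t) *\<^sub>C phase (coordinate j) a f)))
      has_vector_derivative
      W t ((2 * t) *\<^sub>R T.d j f + \<i> *\<^sub>C q)) (at 0)"
    by (simp add: translation_0 mult_ac)
  then have "((\<lambda>a. phase (coordinate j) a (W t f)) has_vector_derivative W t ((2 * t) *\<^sub>R T.d j f
      + \<i> *\<^sub>C q)) (at 0)"
    unfolding W_def exp_cont_phase_conj[symmetric] .
  then have "(W t f, W t ((2 * t) *\<^sub>R T.d j f + \<i> *\<^sub>C q)) \<in> generator (phase (coordinate j))"
    by (simp add: generator_def)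
  from generator_phaseD[OF measurable_coordinate this]
  show ?thesis
    by (simp add: Q_cont_def app_P_cont[OF f] W.bl_simps W_C scaleC_add_right scaleC_scaleR
        add.commute mult.commute)
qed

text \<open>If the derivative along e_j vanishes, f is invariant under translations in that
  direction, whereas translating Q f by s adds s f to it. Isometry then gives |s| norm f \<le> 2
  norm (Q f) for all s, which forces f = 0.\<close>

lemma momentum_nonzero:
  fixes f :: "(real ^ 'n::finite) L2"
  assumes f: "f \<in> T.H1" and q: "(f, q) \<in> Q_cont j" and d: "T.d j f = 0"
  shows "f = 0"
proof (rule ccontr)
  assume "f \<noteq> 0"
  have g0: "(f, 0) \<in> generator (translation j)" using T.H1_d[OF f, of j] d by simp
  have T_f: "translation j s f = f" for s
    using vector_derivative_bound[OF T.T.has_vector_derivative_orbit[OF g0], of 0 s 0 0]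
    by (simp add: T.T.bl_simps)
  have "s * norm f \<le> 2 * norm q" for s
  proof -
    have Q: "AE x in lborel. rep_L2 q x = of_real (x $ j) * rep_L2 f x"
      using q unfolding Q_cont_def mult_op_def ref_measure_lborel by simp
    have "translation j s q - s *\<^sub>R translation j s f = q"
    proof (rule L2_lborel_eqI)
      have r: "AE x in lborel. rep_L2 f x = rep_L2 f (s *\<^sub>R axis j 1 + x)"
        using rep_translation[of j s f] unfolding T_f .
      show "AE x in lborel. rep_L2 (translation j s q - s *\<^sub>R translation j s f) x = rep_L2 q x"
        using rep_minus_lborel[of "translation j s q" "s *\<^sub>R translation j s f"]
          rep_scaleR_lborel[of s "translation j s f"] rep_translation[of j s q] rep_translation[of
              j s f]
          AE_translate[OF Q, of "s *\<^sub>R axis j 1"] Q r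
        by eventually_elim (simp add: algebra_simps)
    qed
    then have "s *\<^sub>R f = translation j s q - q" unfolding T_f by (simp add: algebra_simps)
    then have "\<bar>s\<bar> * norm f = norm (translation j s q - q)" by (metis norm_scaleR)
    also have "\<dots> \<le> 2 * norm q" using norm_triangle_ineq4[of "translation j s q" q]
        by (simp add: norm_translation)
    finally show ?thesis using mult_right_mono[OF abs_ge_self[of s] norm_ge_zero[of f]] by linarith
  qed
  from this[of "(2 * norm q + 1) / norm f"] show False using \<open>f \<noteq> 0\<close> by simp
qed

theorem continuum_case:
  fixes V :: "real ^ 'n::finite \<Rightarrow> real" and \<psi> :: "(real ^ 'n) L2" and j :: 'n
  defines "H \<equiv> op_add H0_cont (mult_op V)"
  assumes V: "ess_bounded V" and \<psi>: "\<psi> \<in> Domain (Q_cont j) \<inter> H1"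
    and fin: "(\<integral>\<^sup>+t\<in>{0..}. ennreal (1 + t) * S_norm_cont j (app (mult_op V) (exp_mi H0_cont t \<psi>))
        \<partial>lborel) < \<infinity>"
    and fin': "(\<integral>\<^sup>+t\<in>{0..}. ennreal (1 + t) *
      ennreal (norm (app (mult_op V) (exp_mi H0_cont t (app (P_cont j) \<psi>)))) \<partial>lborel) < \<infinity>"
  shows "Omega_exists H H0_cont \<psi> \<and> Omega_exists H H0_cont (app (P_cont j) \<psi>) \<and>
    Omega H H0_cont \<psi> \<in> Domain (Q_cont j) \<and>
    asymptotic_velocity H (Q_cont j) (Omega H H0_cont \<psi>) (2 *\<^sub>R Omega H H0_cont (app (P_cont j)
        \<psi>)) \<and>
    (\<psi> \<noteq> 0 \<longrightarrow> ballistic H (Q_cont j) (Omega H H0_cont \<psi>))"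
proof -
  obtain q where q: "(\<psi>, q) \<in> Q_cont j" using \<psi> by blast
  have \<psi>1: "\<psi> \<in> T.H1" using \<psi> by (simp add: H1_eq)
  obtain C where C: "0 < C" "\<And>g r a. 0 < a \<Longrightarrow> a \<le> 1 \<Longrightarrow>
      ennreal (norm (phase (coordinate j) a (exp_mi H r g) - exp_mi H r g))
          \<le> ennreal (C * a * (1 + \<bar>r\<bar>)) * S_norm_cont j g"
    unfolding H_def using exp_cont_S_norm_bound[OF V, of j] by blast
  have main: "Omega_exists H H0_cont \<psi> \<and> Omega_exists H H0_cont (app (P_cont j) \<psi>) \<and>
    Omega H H0_cont \<psi> \<in> Domain (mult_op (coordinate j)) \<and>
    asymptotic_velocity H (mult_op (coordinate j)) (Omega H H0_cont \<psi>) (2 *\<^sub>R Omega H H0_cont (app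
        (P_cont j) \<psi>)) \<and>
    norm (Omega H H0_cont (app (P_cont j) \<psi>)) = norm (app (P_cont j) \<psi>)"
    unfolding H_def
  proof (rule scattering_velocity[OF self_adjoint_H0_cont V measurable_coordinate, where S
      = "S_norm_cont j" and C = C and q = q])
    show "ennreal (norm g) \<le> S_norm_cont j g" for g
    proof -
      have "norm g \<le> sqrt ((H1_norm g)\<^sup>2 + (norm (app (Q_cont j) g))\<^sup>2)"
        using power_mono[OF norm_le_H1_norm[of g] norm_ge_zero, of 2]
        by (intro real_le_rsqrt) (simp add: add_increasing2)
      then show ?thesis by (simp add: S_norm_cont_def ennreal_leI)
    qed
    show "(exp_mi H0_cont t \<psi>, exp_mi H0_cont t q + (t * 2) *\<^sub>R exp_mi H0_cont t (app (P_cont j)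
        \<psi>)) \<in> mult_op (coordinate j)" for t
      using exp_cont_free[OF q \<psi>1, of t] by (simp add: Q_cont_def)
  qed (use C fin fin' in \<open>simp_all add: H_def\<close>)
  moreover have "ballistic H (Q_cont j) (Omega H H0_cont \<psi>)" if "\<psi> \<noteq> 0"
  proof -
    \<comment> \<open>The wave operator preserves the norm of P \<psi>, so the velocity vanishes
      only if the j-th derivative of \<psi> does.\<close>
    have "T.d j \<psi> \<noteq> 0" using momentum_nonzero[OF \<psi>1 q] that by blast
    then have "norm (Omega H H0_cont (app (P_cont j) \<psi>)) \<noteq> 0"
      using main by (simp add: app_P_cont[OF \<psi>1])
    then have "2 *\<^sub>R Omega H H0_cont (app (P_cont j) \<psi>) \<noteq> 0" by simp
    then show ?thesis unfolding ballistic_def Q_cont_def using main by blast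
  qed
  ultimately show ?thesis by (simp add: Q_cont_def)
qed

theorem lemmaA3:
  fixes j :: "'n::finite"
  shows "(\<forall>(V :: real ^ 'n \<Rightarrow> real) (\<psi> :: (real ^ 'n) L2).
            let H0 = H0_cont; H = op_add H0 (mult_op V) in
            C1 V \<and> ess_bounded V \<and> (\<forall>l. ess_bounded (partial l V)) \<and>
            \<psi> \<in> Domain (Q_cont j) \<inter> H1 \<and>
            (\<integral>\<^sup>+t\<in>{0..}. ennreal (1 + t) * S_norm_cont j (app (mult_op V) (exp_mi H0 t \<psi>)) \<partial>lborel) < \<infinity> \<and>
            (\<integral>\<^sup>+t\<in>{0..}. ennreal (1 + t) *
               ennreal (norm (app (mult_op V) (exp_mi H0 t (app (P_cont j) \<psi>)))) \<partial>lborel) < \<infinity>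
            \<longrightarrow>
            Omega_exists H H0 \<psi> \<and> Omega_exists H H0 (app (P_cont j) \<psi>) \<and>
            Omega H H0 \<psi> \<in> Domain (Q_cont j) \<and>
            asymptotic_velocity H (Q_cont j) (Omega H H0 \<psi>) (2 *\<^sub>R Omega H H0 (app (P_cont j) \<psi>)) \<and>
            (\<psi> \<noteq> 0 \<longrightarrow> ballistic H (Q_cont j) (Omega H H0 \<psi>)))
       \<and>
         (\<forall>(V :: ('n \<Rightarrow> int) \<Rightarrow> real) (\<psi> :: ('n \<Rightarrow> int) L2).
            let H0 = H0_lat; H = op_add H0 (mult_op V) in
            ess_bounded V \<and>
            \<psi> \<in> Domain (Q_lat j) \<and>
            (\<integral>\<^sup>+t\<in>{0..}. ennreal (1 + t) * S_norm_lat j (app (mult_op V) (exp_mi H0 t \<psi>)) \<partial>lborel) < \<infinity> \<and>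
            (\<integral>\<^sup>+t\<in>{0..}. ennreal (1 + t) *
               ennreal (norm (app (mult_op V) (exp_mi H0 t (app (P_lat j) \<psi>)))) \<partial>lborel) < \<infinity>
            \<longrightarrow>
            Omega_exists H H0 \<psi> \<and> Omega_exists H H0 (app (P_lat j) \<psi>) \<and>
            Omega H H0 \<psi> \<in> Domain (Q_lat j) \<and>
            asymptotic_velocity H (Q_lat j) (Omega H H0 \<psi>) (Omega H H0 (app (P_lat j) \<psi>)))"
  unfolding Let_def
  by (intro conjI[OF allI[OF allI[OF impI]] allI[OF allI[OF impI]]] continuum_case lattice_case; elim conjE; assumption)

end
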